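(* Let $(X,d_X)$ and $(Y,d_Y)$ be finite metric spaces, let $d_{X\times Y}$ be the maximum metric on $X\times Y$, and for a finite metric space $(Z,d_Z)$ let $\mathsf{bcd}_n^{\mathcal{R}}(Z,d_Z)$ be the $n$-dimensional barcode of the Rips filtration $\mathcal{R}(Z,d_Z)=\{R_\epsilon(Z,d_Z)\}_{\epsilon\ge 0}$ with coefficients in a fixed field $\mathbb{F}$. Then for all $n\in\mathbb{N}$, $$\mathsf{bcd}_n^{\mathcal{R}}(X\times Y,d_{X\times Y})=\bigcup_{i+j=n}\Big\{I\cap J\ \Big|\ I\in\mathsf{bcd}_i^{\mathcal{R}}(X,d_X),\ J\in\mathsf{bcd}_j^{\mathcal{R}}(Y,d_Y)\Big\},$$ where the union is a disjoint union of multisets.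
   Context: The maximum metric is $d_{X\times Y}((x,y),(x',y'))=\max\{d_X(x,x'),d_Y(y,y')\}$. The Rips complex $R_\epsilon(Z,d_Z)$ is the abstract simplicial complex whose simplices are the finite nonempty subsets of $Z$ with diameter strictly less than $\epsilon$. For a functor $V$ from the totally ordered set $[0,\infty)$ to finite dimensional $\mathbb{F}$-vector spaces, its barcode is the unique multiset of (nonempty) intervals $I\subset[0,\infty)$ with $V\cong\bigoplus_I\mathds{1}_I$, where $\mathds{1}_I$ is $\mathbb{F}$ at indices in $I$ and $0$ elsewhere, with identity maps between copies of $\mathbb{F}$ and zero maps otherwise. $\mathsf{bcd}_n^{\mathcal{R}}(Z,d_Z)$ is the barcode of $\epsilon\mapsto H_n(R_\epsilon(Z,d_Z);\mathbb{F})$ with maps induced by inclusions. Empty intersections $I\cap J$ are discarded. *)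

theory Defs
  imports "HOL-Analysis.Analysis" "HOL-Algebra.AbelCoset" "Jordan_Normal_Form.VS_Connect"
begin

section \<open>Persistence modules and barcodes\<close>

text \<open>
  The coefficient field is an arbitrary type \<open>'f\<close> of class \<open>field\<close>; vector spaces are modules over
  the ring \<open>class_ring\<close> formed by its elements. The ring components \<open>mult\<close> and \<open>one\<close> of a module
  record play no role and are left undefined.

  A functor from the poset of nonnegative reals to vector spaces is recorded by the spaces at all
  indices \<open>t\<close> and by the maps \<open>transition V s t\<close> for \<open>s \<le> t\<close>; only the values at indices \<open>\<ge> 0\<close> matter.
\<close>

record ('f, 'v) persistence_module =
  space_at :: "real \<Rightarrow> ('f, 'v) module"
  transition :: "real \<Rightarrow> real \<Rightarrow> 'v \<Rightarrow> 'v"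

definition persistence_iso ::
  "('f::field, 'v) persistence_module \<Rightarrow> ('f, 'w) persistence_module \<Rightarrow> bool"
where
  "persistence_iso V W \<longleftrightarrow>
    (\<exists>f. (\<forall>t\<ge>0. linear_map class_ring (space_at V t) (space_at W t) (f t) \<and>
                 bij_betw (f t) (carrier (space_at V t)) (carrier (space_at W t))) \<and>
         (\<forall>s\<ge>0. \<forall>t\<ge>s. \<forall>x\<in>carrier (space_at V s).
            f t (transition V s t x) = transition W s t (f s x)))"

definition interval_module :: "real set \<Rightarrow> ('f::field, 'f) persistence_module" where
  "interval_module I =
    \<lparr>space_at = (\<lambda>t. \<lparr>carrier = (if t \<in> I then UNIV else {0}), mult = undefined, one = undefined,
                      zero = 0, add = (+), smult = (*)\<rparr>),
     transition = (\<lambda>s t x. if s \<in> I \<and> t \<in> I then x else 0)\<rparr>"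

definition persistence_direct_sum ::
  "'i set \<Rightarrow> ('i \<Rightarrow> ('f, 'v) persistence_module) \<Rightarrow> ('f, 'i \<Rightarrow> 'v) persistence_module"
where
  "persistence_direct_sum A V =
    \<lparr>space_at = (\<lambda>t.
       \<lparr>carrier = {x \<in> \<Pi>\<^sub>E i\<in>A. carrier (space_at (V i) t).
                   finite {i \<in> A. x i \<noteq> \<zero>\<^bsub>space_at (V i) t\<^esub>}},
        mult = undefined, one = undefined,
        zero = (\<lambda>i\<in>A. \<zero>\<^bsub>space_at (V i) t\<^esub>),
        add = (\<lambda>x y. \<lambda>i\<in>A. x i \<oplus>\<^bsub>space_at (V i) t\<^esub> y i),
        smult = (\<lambda>a x. \<lambda>i\<in>A. a \<odot>\<^bsub>space_at (V i) t\<^esub> x i)\<rparr>),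
     transition = (\<lambda>s t x. \<lambda>i\<in>A. transition (V i) s t (x i))\<rparr>"

text \<open>
  A barcode is a finite multiset here, which suffices for filtrations of finite complexes. The
  summand \<open>(I, k)\<close> is the \<open>k\<close>-th copy of the interval module of \<open>I\<close>.
\<close>

definition barcode :: "('f::field, 'v) persistence_module \<Rightarrow> real set multiset" where
  "barcode V = (THE B.
     (\<forall>I\<in>#B. I \<noteq> {} \<and> I \<subseteq> {0..} \<and> is_interval I) \<and>
     persistence_iso V
       (persistence_direct_sum {(I, k::nat). k < count B I} (\<lambda>(I, k). interval_module I)))"


section \<open>Simplicial homology\<close>

text \<open>
  Oriented simplicial chains, following Munkres (Elements of Algebraic Topology, section 5). The list
  \<open>[v\<^sub>0, \<dots>, v\<^sub>n]\<close> of the vertices of a simplex stands for the oriented simplex given by that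
  vertex ordering. An \<open>n\<close>-chain of a complex \<open>K\<close>, a set of finite nonempty sets, is a
  finitely supported function on the oriented \<open>n\<close>-simplices of \<open>K\<close> that changes by the sign of the
  permutation when the vertices are reordered. Its value at an oriented simplex is the coefficient of
  that simplex.
\<close>

definition chains :: "nat \<Rightarrow> 'a set set \<Rightarrow> ('a list \<Rightarrow> 'f::field) set" where
  "chains n K = {c. finite {vs. c vs \<noteq> 0} \<and>
     (\<forall>vs. c vs \<noteq> 0 \<longrightarrow> distinct vs \<and> length vs = Suc n \<and> set vs \<in> K) \<and>
     (\<forall>vs \<pi>. \<pi> permutes {..<length vs} \<longrightarrow> c (permute_list \<pi> vs) = of_int (sign \<pi>) * c vs)}"

text \<open>
  The coefficient of \<open>[w\<^sub>0, \<dots>, w\<^sub>m]\<close> in the boundary of \<open>c\<close>: every simplex having this face can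
  be oriented as \<open>[v, w\<^sub>0, \<dots>, w\<^sub>m]\<close>, and then the face occurs in its boundary with
  coefficient 1. Lemma \<open>boundary_elementary_chain\<close> below recovers the usual alternating sum. The
  boundary of a 0-chain is 0, that is, homology is not reduced.
\<close>

definition boundary :: "('a list \<Rightarrow> 'f::field) \<Rightarrow> 'a list \<Rightarrow> 'f" where
  "boundary c ws = (if ws = [] then 0 else (\<Sum>v | c (v # ws) \<noteq> 0. c (v # ws)))"

definition cycles :: "nat \<Rightarrow> 'a set set \<Rightarrow> ('a list \<Rightarrow> 'f::field) set" where
  "cycles n K = {c \<in> chains n K. boundary c = (\<lambda>_. 0)}"

definition boundaries :: "nat \<Rightarrow> 'a set set \<Rightarrow> ('a list \<Rightarrow> 'f::field) set" where
  "boundaries n K = boundary ` chains (Suc n) K"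

definition function_space :: "('b \<Rightarrow> 'f::field) set \<Rightarrow> ('f, 'b \<Rightarrow> 'f) module" where
  "function_space S =
    \<lparr>carrier = S, mult = undefined, one = undefined,
     zero = (\<lambda>_. 0), add = (\<lambda>c d x. c x + d x), smult = (\<lambda>a c x. a * c x)\<rparr>"

definition quotient_space :: "('f, 'v) module \<Rightarrow> 'v set \<Rightarrow> ('f, 'v set) module" where
  "quotient_space M N =
    \<lparr>carrier = a_rcosets\<^bsub>M\<^esub> N, mult = undefined, one = undefined,
     zero = N, add = (<+>\<^bsub>M\<^esub>), smult = (\<lambda>a C. \<Union>x\<in>C. N +>\<^bsub>M\<^esub> (a \<odot>\<^bsub>M\<^esub> x))\<rparr>"

lemma vectorspace_quotient_space:
  assumes "vectorspace (K::('a,'b) ring_scheme) (M::('a,'c) module)" and "submodule K N M"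
  shows "vectorspace K (quotient_space M N)"
proof -
  interpret M: vectorspace K M by fact
  interpret N: submodule K N M by fact
  have inv: "\<ominus>\<^bsub>M\<^esub> x \<in> N" if "x \<in> N" for x
  proof -
    have xM: "x \<in> carrier M" using that N.subset by blast
    have "(\<ominus>\<^bsub>K\<^esub> \<one>\<^bsub>K\<^esub>) \<odot>\<^bsub>M\<^esub> x = \<ominus>\<^bsub>M\<^esub> x" using M.smult_l_minus[of "\<one>\<^bsub>K\<^esub>" x] xM by simp
    moreover have "(\<ominus>\<^bsub>K\<^esub> \<one>\<^bsub>K\<^esub>) \<odot>\<^bsub>M\<^esub> x \<in> N" by (rule N.smult_closed) (use that in auto)
    ultimately show ?thesis by simp
  qed
  interpret S: additive_subgroup N M
    by (intro additive_subgroup.intro subgroup.intro)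
       (use N.subset inv in \<open>auto simp: a_inv_def[symmetric]\<close>)
  interpret A: abelian_subgroup N M by (intro abelian_subgroupI3 S.additive_subgroup_axioms M.abelian_group_axioms)
  let ?Q = "quotient_space M N"
  have sm: "(\<Union>x\<in>N +>\<^bsub>M\<^esub> y. N +>\<^bsub>M\<^esub> (a \<odot>\<^bsub>M\<^esub> x)) = N +>\<^bsub>M\<^esub> (a \<odot>\<^bsub>M\<^esub> y)"
    if "a \<in> carrier K" "y \<in> carrier M" for a y
  proof -
    have "N +>\<^bsub>M\<^esub> (a \<odot>\<^bsub>M\<^esub> x) = N +>\<^bsub>M\<^esub> (a \<odot>\<^bsub>M\<^esub> y)" if x: "x \<in> N +>\<^bsub>M\<^esub> y" for x
    proof -
      obtain h where h: "h \<in> N" "x = h \<oplus>\<^bsub>M\<^esub> y" using x unfolding a_r_coset_def' by auto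
      have hM: "h \<in> carrier M" using h(1) S.a_subset by blast
      have "a \<odot>\<^bsub>M\<^esub> x = (a \<odot>\<^bsub>M\<^esub> h) \<oplus>\<^bsub>M\<^esub> (a \<odot>\<^bsub>M\<^esub> y)"
        using h hM that \<open>a \<in> carrier K\<close> \<open>y \<in> carrier M\<close> by (simp add: M.smult_r_distr)
      moreover have "a \<odot>\<^bsub>M\<^esub> h \<in> N" using N.smult_closed h(1) \<open>a \<in> carrier K\<close> by blast
      ultimately have "a \<odot>\<^bsub>M\<^esub> x \<in> N +>\<^bsub>M\<^esub> (a \<odot>\<^bsub>M\<^esub> y)" unfolding a_r_coset_def' by auto
      then show ?thesis using A.a_repr_independence' \<open>a \<in> carrier K\<close> \<open>y \<in> carrier M\<close>
        by (metis M.smult_closed)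
    qed
    moreover have "y \<in> N +>\<^bsub>M\<^esub> y" using A.a_rcos_self that by blast
    ultimately show ?thesis by blast
  qed
  have add: "(N +>\<^bsub>M\<^esub> x) \<oplus>\<^bsub>?Q\<^esub> (N +>\<^bsub>M\<^esub> y) = N +>\<^bsub>M\<^esub> (x \<oplus>\<^bsub>M\<^esub> y)"
    if "x \<in> carrier M" "y \<in> carrier M" for x y
    using A.a_rcos_sum that by (simp add: quotient_space_def)
  have smt: "a \<odot>\<^bsub>?Q\<^esub> (N +>\<^bsub>M\<^esub> y) = N +>\<^bsub>M\<^esub> (a \<odot>\<^bsub>M\<^esub> y)"
    if "a \<in> carrier K" "y \<in> carrier M" for a y
    using sm[OF that] by (simp add: quotient_space_def)
  have car: "carrier ?Q = (\<lambda>x. N +>\<^bsub>M\<^esub> x) ` carrier M"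
    by (auto simp: quotient_space_def A_RCOSETS_def')
  have zer: "\<zero>\<^bsub>?Q\<^esub> = N +>\<^bsub>M\<^esub> \<zero>\<^bsub>M\<^esub>"
    using abelian_group.a_coset_add_zero[OF M.abelian_group_axioms N.subset] by (simp add: quotient_space_def)
  have "abelian_group ?Q"
  proof (rule abelian_groupI)
    fix x assume "x \<in> carrier ?Q"
    then obtain u where u: "u \<in> carrier M" "x = N +>\<^bsub>M\<^esub> u" by (auto simp: car)
    show "\<exists>y\<in>carrier ?Q. y \<oplus>\<^bsub>?Q\<^esub> x = \<zero>\<^bsub>?Q\<^esub>"
      by (rule bexI[of _ "N +>\<^bsub>M\<^esub> (\<ominus>\<^bsub>M\<^esub> u)"]) (use u in \<open>auto simp: add zer car M.l_neg\<close>)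
  qed (auto simp: car add zer M.a_ac)
  then have "module K ?Q"
    by (intro moduleI M.R.is_cring) (auto simp: car add smt M.smult_l_distr M.smult_r_distr M.smult_assoc1)
  then show ?thesis by (simp add: vectorspace_def M.field_axioms)
qed

definition homology :: "nat \<Rightarrow> 'a set set \<Rightarrow> ('f::field, ('a list \<Rightarrow> 'f) set) module" where
  "homology n K = quotient_space (function_space (cycles n K)) (boundaries n K)"

text \<open>The map induced by an inclusion into \<open>L\<close>: the class \<open>z + B(K)\<close> goes to \<open>z + B(L)\<close>.\<close>

definition homology_inclusion ::
  "nat \<Rightarrow> 'a set set \<Rightarrow> ('a list \<Rightarrow> 'f::field) set \<Rightarrow> ('a list \<Rightarrow> 'f) set"
where
  "homology_inclusion n L C = C <+>\<^bsub>function_space (cycles n L)\<^esub> boundaries n L"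

text \<open>The chain with coefficient 1 at the oriented simplex \<open>vs\<close>, for distinct \<open>vs\<close>.\<close>

definition elementary_chain :: "'a list \<Rightarrow> 'a list \<Rightarrow> 'f::field" where
  "elementary_chain vs ws =
     (\<Sum>\<pi> | \<pi> permutes {..<length vs} \<and> permute_list \<pi> vs = ws. of_int (sign \<pi>))"


lemma permute_list_insert:
  assumes p: "p permutes {0..<n}" and i: "i < Suc n" and len: "length vs = Suc n"
  shows "permute_list (permutation_insert 0 i p) vs
       = vs ! i # permute_list p (take i vs @ drop (Suc i) vs)"
proof (rule nth_equalityI)
  show "length (permute_list (permutation_insert 0 i p) vs) =
    length (vs ! i # permute_list p (take i vs @ drop (Suc i) vs))"
    using len i by simp
  fix k assume "k < length (permute_list (permutation_insert 0 i p) vs)"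
  then have k: "k < Suc n" using len by simp
  show "permute_list (permutation_insert 0 i p) vs ! k =
    (vs ! i # permute_list p (take i vs @ drop (Suc i) vs)) ! k"
  proof (cases k)
    case 0
    then show ?thesis using len by (simp add: permute_list_def permutation_insert_expand del: upt_Suc)
  next
    case (Suc m)
    then have m: "m < n" using k by simp
    have pm: "p m < n" using permutes_in_image[OF p, of m] m by simp
    show ?thesis using len i m pm Suc
      by (simp add: permute_list_def permutation_insert_expand nth_append min_def del: upt_Suc)
  qed
qed

lemma boundary_elementary_chain:
  assumes "length vs \<ge> 2"
  shows "boundary (elementary_chain vs) =
    (\<lambda>ws. \<Sum>i<length vs. (- 1) ^ i * elementary_chain (take i vs @ drop (Suc i) vs) ws :: 'f::field)"
proof
  fix ws :: "'a list"
  obtain n where n: "length vs = Suc n" "n > 0" using assms by (cases "length vs") auto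
  let ?N = "{0..<Suc n}"
  let ?s = "\<lambda>\<pi>. of_int (sign \<pi>) :: 'f"
  let ?P = "{\<pi>. \<pi> permutes ?N}"
  let ?vi = "\<lambda>i. take i vs @ drop (Suc i) vs"
  have finP: "finite ?P" by (simp add: finite_permutations)
  have el: "elementary_chain vs us = (\<Sum>\<pi> | \<pi> permutes ?N \<and> permute_list \<pi> vs = us. ?s \<pi>)" for us
    by (simp only: elementary_chain_def n(1) lessThan_atLeast0)
  have nn: "permute_list \<pi> vs \<noteq> []" for \<pi>
    using n by (metis length_0_conv length_permute_list nat.distinct(1))
  show "boundary (elementary_chain vs) ws =
    (\<Sum>i<length vs. (- 1) ^ i * elementary_chain (?vi i) ws :: 'f)"
  proof (cases "ws = []")
    case True
    have "elementary_chain (?vi i) ws = (0::'f)" if "i < length vs" for i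
    proof -
      have "length (?vi i) = n" using that n(1) by simp
      then have "permute_list \<pi> (?vi i) \<noteq> ws" for \<pi>
        using True n by (metis length_0_conv length_permute_list not_gr_zero)
      then have "{\<pi>. \<pi> permutes {..<length (?vi i)} \<and> permute_list \<pi> (?vi i) = ws} = {}" by blast
      then show ?thesis by (simp only: elementary_chain_def sum.empty)
    qed
    then have "(\<Sum>i<length vs. (- 1) ^ i * elementary_chain (?vi i) ws :: 'f) = 0"
      by (intro sum.neutral) simp
    then show ?thesis using True by (simp add: boundary_def)
  next
    case False
    have sub: "{v. elementary_chain vs (v # ws) \<noteq> (0::'f)} \<subseteq> set vs"
    proof
      fix v assume "v \<in> {v. elementary_chain vs (v # ws) \<noteq> (0::'f)}"
      then obtain \<pi> where "\<pi> permutes ?N" "permute_list \<pi> vs = v # ws"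
        unfolding el by (auto elim!: sum.not_neutral_contains_not_neutral)
      then show "v \<in> set vs"
        by (metis list.set_intros(1) n(1) lessThan_atLeast0 set_permute_list)
    qed
    have "boundary (elementary_chain vs) ws = (\<Sum>v\<in>set vs. elementary_chain vs (v # ws) :: 'f)"
      unfolding boundary_def using False sub
      by (auto intro!: sum.mono_neutral_left)
    also have "\<dots> = (\<Sum>v\<in>set vs. \<Sum>\<pi> | \<pi> \<in> {\<pi>\<in>?P. tl (permute_list \<pi> vs) = ws} \<and> hd (permute_list \<pi> vs) = v. ?s \<pi>)"
      unfolding el by (intro sum.cong refl) (use nn in \<open>force simp: neq_Nil_conv\<close>)+
    also have "\<dots> = (\<Sum>\<pi> | \<pi> \<in> ?P \<and> tl (permute_list \<pi> vs) = ws. ?s \<pi>)"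
    proof (subst sum.group)
      show "(\<lambda>\<pi>. hd (permute_list \<pi> vs)) ` {\<pi> \<in> ?P. tl (permute_list \<pi> vs) = ws} \<subseteq> set vs"
        using nn by (auto simp: n(1) lessThan_atLeast0) (metis hd_in_set lessThan_atLeast0 n(1) set_permute_list)
    qed (use finP in auto)
    also have "\<dots> = (\<Sum>i\<in>?N. \<Sum>\<pi> | \<pi> \<in> {\<pi>\<in>?P. tl (permute_list \<pi> vs) = ws} \<and> \<pi> 0 = i. ?s \<pi>)"
    proof (subst sum.group)
      show "(\<lambda>\<pi>. \<pi> 0) ` {\<pi> \<in> ?P. tl (permute_list \<pi> vs) = ws} \<subseteq> ?N"
        using permutes_in_image by fastforce
    qed (use finP in auto)
    also have "\<dots> = (\<Sum>i\<in>?N. (- 1) ^ i * elementary_chain (?vi i) ws)"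
    proof (rule sum.cong[OF refl])
      fix i assume "i \<in> ?N"
      then have i: "i < Suc n" by simp
      let ?Q = "{q. q permutes {0..<n} \<and> permute_list q (?vi i) = ws}"
      have len: "length (?vi i) = n" using i n(1) by simp
      have eq: "{\<pi>. \<pi> \<in> {\<pi>\<in>?P. tl (permute_list \<pi> vs) = ws} \<and> \<pi> 0 = i} =
        permutation_insert 0 i ` ?Q"
      proof -
        have "{\<pi>. \<pi> \<in> {\<pi>\<in>?P. tl (permute_list \<pi> vs) = ws} \<and> \<pi> 0 = i} =
          {\<pi> \<in> permutation_insert 0 i ` {q. q permutes {0..<n}}. tl (permute_list \<pi> vs) = ws}"
          using permutation_fix[of 0 n i] i by auto
        also have "\<dots> = permutation_insert 0 i ` ?Q"
          using permute_list_insert[OF _ i n(1)] by auto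
        finally show ?thesis .
      qed
      have inj: "inj_on (permutation_insert (0::nat) i) ?Q"
      proof (rule inj_onI)
        fix q q' :: "nat \<Rightarrow> nat" assume h: "permutation_insert (0::nat) i q = permutation_insert 0 i q'"
        show "q = q'"
        proof
          fix k
          have "permutation_insert 0 i q (Suc k) = permutation_insert 0 i q' (Suc k)" using h by simp
          then show "q k = q' k" by (auto simp: permutation_insert_expand split: if_splits)
        qed
      qed
      have sg: "?s (permutation_insert 0 i q) = (- 1) ^ i * ?s q" if "q permutes {0..<n}" for q
        using signof_permutation_insert[OF that, of 0 i] i by simp
      have "(\<Sum>\<pi> | \<pi> \<in> {\<pi>\<in>?P. tl (permute_list \<pi> vs) = ws} \<and> \<pi> 0 = i. ?s \<pi>) =
        (\<Sum>q\<in>?Q. ?s (permutation_insert 0 i q))"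
        unfolding eq by (subst sum.reindex[OF inj]) simp
      also have "\<dots> = (\<Sum>q\<in>?Q. (- 1) ^ i * ?s q)"
        by (rule sum.cong) (auto simp: sg)
      also have "\<dots> = (- 1) ^ i * elementary_chain (?vi i) ws"
        by (simp only: elementary_chain_def len lessThan_atLeast0 sum_distrib_left)
      finally show "(\<Sum>\<pi> | \<pi> \<in> {\<pi>\<in>?P. tl (permute_list \<pi> vs) = ws} \<and> \<pi> 0 = i. ?s \<pi>) =
        (- 1) ^ i * elementary_chain (?vi i) ws" .
    qed
    finally show ?thesis by (simp only: n(1) lessThan_atLeast0)
  qed
qed


section \<open>The Rips filtration\<close>

definition diam_of :: "('a \<Rightarrow> 'a \<Rightarrow> real) \<Rightarrow> 'a set \<Rightarrow> real" where
  "diam_of d \<sigma> = Max {d x y | x y. x \<in> \<sigma> \<and> y \<in> \<sigma>}"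

definition rips :: "real \<Rightarrow> 'a set \<Rightarrow> ('a \<Rightarrow> 'a \<Rightarrow> real) \<Rightarrow> 'a set set" where
  "rips \<epsilon> Z d = {\<sigma>. \<sigma> \<subseteq> Z \<and> finite \<sigma> \<and> \<sigma> \<noteq> {} \<and> diam_of d \<sigma> < \<epsilon>}"

definition rips_homology :: "nat \<Rightarrow> 'a set \<Rightarrow> ('a \<Rightarrow> 'a \<Rightarrow> real) \<Rightarrow>
    ('f::field, ('a list \<Rightarrow> 'f) set) persistence_module" where
  "rips_homology n Z d =
    \<lparr>space_at = (\<lambda>\<epsilon>. homology n (rips \<epsilon> Z d)),
     transition = (\<lambda>\<epsilon> \<epsilon>'. homology_inclusion n (rips \<epsilon>' Z d))\<rparr>"

definition rips_barcode ::
  "'f::field itself \<Rightarrow> nat \<Rightarrow> 'a set \<Rightarrow> ('a \<Rightarrow> 'a \<Rightarrow> real) \<Rightarrow> real set multiset"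
where
  "rips_barcode F n Z d =
     barcode (rips_homology n Z d :: ('f, ('a list \<Rightarrow> 'f) set) persistence_module)"

definition max_dist ::
  "('a \<Rightarrow> 'a \<Rightarrow> real) \<Rightarrow> ('b \<Rightarrow> 'b \<Rightarrow> real) \<Rightarrow> 'a \<times> 'b \<Rightarrow> 'a \<times> 'b \<Rightarrow> real"
where
  "max_dist dX dY p q = max (dX (fst p) (fst q)) (dY (snd p) (snd q))"

end

theory Submission
  imports Defs "HOL-Library.Poly_Mapping"
begin

text \<open>
  Both sides of the formula are read off from explicit cycles. Call a family of cycles \<open>z\<^sub>i\<close> with
  intervals \<open>I\<^sub>i\<close> an interval basis of a filtration \<open>R\<close> of finite complexes if, at every time \<open>t\<close>,
  the \<open>z\<^sub>i\<close> with \<open>t \<in> I\<^sub>i\<close> represent a basis of the homology of \<open>R t\<close>, and \<open>z\<^sub>i\<close> bounds in \<open>R t\<close>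
  as soon as \<open>t\<close> has passed \<open>I\<^sub>i\<close>. Such a family splits the persistent homology into interval
  modules, so the barcode consists of the \<open>I\<^sub>i\<close> (lemma \<open>barcode_interval_basis\<close>); it is unique
  because the number of bars that contain both \<open>s\<close> and \<open>t\<close> is the rank of the map from time \<open>s\<close> to
  time \<open>t\<close>, and these numbers determine a multiset of intervals (\<open>barcode_eqI\<close>).

  A simplex of the Rips complex of the maximum metric is a set of pairs whose two projections are
  simplices of the Rips complexes of \<open>X\<close> and \<open>Y\<close> (\<open>rips_product\<close>). By the Kuenneth theorem
  (\<open>Kuenneth_homology_basis\<close>) the cross products of two homology bases form a homology basis of such
  a product of complexes, and the cross product of a cycle with a boundary bounds. Hence the cross
  products \<open>z\<^sub>i \<times> w\<^sub>j\<close> with the intervals \<open>I\<^sub>i \<inter> J\<^sub>j\<close> are an interval basis of the product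
  filtration (\<open>interval_basis_product\<close>), and sorting them by degree gives the formula.

  Interval bases exist because the cycles of a given degree at all times form one flag of subspaces,
  the boundaries form another, and two flags have a common adapted basis
  (\<open>adapted_basis_two_flags\<close>). A basis vector is born when it enters the flag of cycles and dies
  when it enters the flag of boundaries.

  Most of the argument uses ordered chains, in which a simplex is a list of vertices that may repeat.
  There the cone over a vertex is \<open>Cons\<close>, a simplex of a product is a list of pairs, and the cross
  product is a recursive sum over shuffles. Oriented chains are quotients of ordered chains by
  antisymmetrization. That this quotient map is a quasi-isomorphism, and the Kuenneth theorem itself,
  follow from one principle (\<open>quasi_iso_by_Mayer_Vietoris\<close>): a natural chain map is a
  quasi-isomorphism on every finite complex if it is one on every full simplex, since acyclicity of
  the mapping cone passes from two complexes and their intersection to their union.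

  Chains are not graded in these arguments: a chain may mix lists of different lengths, and degrees
  are separated only when homology bases are transferred to the homology of a fixed degree.
\<close>

section \<open>Formal sums\<close>

abbreviation lookup :: "('a \<Rightarrow>\<^sub>0 'b::zero) \<Rightarrow> 'a \<Rightarrow> 'b" where "lookup \<equiv> Poly_Mapping.lookup"
abbreviation keys :: "('a \<Rightarrow>\<^sub>0 'b::zero) \<Rightarrow> 'a set" where "keys \<equiv> Poly_Mapping.keys"
abbreviation gen :: "'a \<Rightarrow> 'a \<Rightarrow>\<^sub>0 'f::field" where "gen k \<equiv> Poly_Mapping.single k 1"

definition pscale :: "'f::field \<Rightarrow> ('a \<Rightarrow>\<^sub>0 'f) \<Rightarrow> 'a \<Rightarrow>\<^sub>0 'f" where
  "pscale a = Poly_Mapping.map ((*) a)"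

lemma lookup_pscale [simp]: "lookup (pscale a c) k = a * lookup c k"
  by (auto simp: pscale_def Poly_Mapping.map.rep_eq when_def)

global_interpretation formal: vector_space pscale
  by standard (auto intro!: poly_mapping_eqI simp: lookup_add algebra_simps)

lemma keys_pscale: "keys (pscale a c) \<subseteq> keys c"
  by (auto simp: in_keys_iff)

text \<open>
  The linear extension of a function on generators to finite formal sums.
\<close>

definition lext :: "('a \<Rightarrow> 'b \<Rightarrow>\<^sub>0 'f) \<Rightarrow> ('a \<Rightarrow>\<^sub>0 'f) \<Rightarrow> 'b \<Rightarrow>\<^sub>0 'f::field" where
  "lext f c = (\<Sum>k\<in>keys c. pscale (lookup c k) (f k))"

lemma lext_superset:
  assumes "finite S" "keys c \<subseteq> S"
  shows "lext f c = (\<Sum>k\<in>S. pscale (lookup c k) (f k))"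
  unfolding lext_def using assms
  by (intro sum.mono_neutral_left) (auto simp: in_keys_iff)

lemma lext_add: "lext f (c + d) = lext f c + lext f d"
proof -
  let ?S = "keys c \<union> keys d"
  have "lext f (c + d) = (\<Sum>k\<in>?S. pscale (lookup (c + d) k) (f k))"
    by (rule lext_superset) (auto dest: subsetD[OF keys_add])
  also have "\<dots> = lext f c + lext f d"
    by (subst (1 2) lext_superset[of ?S]) (auto simp: lookup_add formal.scale_left_distrib sum.distrib)
  finally show ?thesis .
qed

lemma lext_pscale: "lext f (pscale a c) = pscale a (lext f c)"
proof -
  have "lext f (pscale a c) = (\<Sum>k\<in>keys c. pscale (lookup (pscale a c) k) (f k))"
    by (rule lext_superset) (auto simp: keys_pscale)
  then show ?thesis by (simp add: lext_def formal.scale_sum_right)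
qed

lemma lext_single [simp]: "lext f (Poly_Mapping.single k a) = pscale a (f k)"
  by (subst lext_superset[of "{k}"]) auto

text \<open>
  Linearity for the scalar multiplication \<open>pscale\<close>, in a form whose instances are found by simplification.
\<close>

definition plinear :: "(('a \<Rightarrow>\<^sub>0 'f::field) \<Rightarrow> ('b \<Rightarrow>\<^sub>0 'f)) \<Rightarrow> bool" where
  "plinear f \<longleftrightarrow> (\<forall>c d. f (c + d) = f c + f d) \<and> (\<forall>a c. f (pscale a c) = pscale a (f c))"

lemma plinear_lext: "plinear (lext f)"
  by (simp add: plinear_def lext_add lext_pscale)

lemma plinear_id: "plinear (\<lambda>c. c)"
  by (simp add: plinear_def)

lemma plinear_zero: "plinear (\<lambda>c. 0)"
  by (simp add: plinear_def)

lemma plinear_add: "plinear f \<Longrightarrow> plinear g \<Longrightarrow> plinear (\<lambda>c. f c + g c)"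
  by (simp add: plinear_def formal.scale_right_distrib)

lemma plinear_diff: "plinear f \<Longrightarrow> plinear g \<Longrightarrow> plinear (\<lambda>c. f c - g c)"
  by (simp add: plinear_def formal.scale_right_diff_distrib)

lemma plinear_pscale: "plinear f \<Longrightarrow> plinear (\<lambda>c. pscale a (f c))"
  by (simp add: plinear_def formal.scale_right_distrib mult.commute)

lemma plinear_compose: "plinear f \<Longrightarrow> plinear g \<Longrightarrow> plinear (\<lambda>c. f (g c))"
  by (simp add: plinear_def)

lemma plinear_lookup: "plinear f \<Longrightarrow> plinear (\<lambda>c. pscale (lookup (f c) l) g)"
  by (auto simp: plinear_def lookup_add formal.scale_left_distrib)

lemma plinear_simps:
  assumes "plinear f"
  shows "f (c + d) = f c + f d" "f (c - d) = f c - f d" "f 0 = 0" "f (- c) = - f c"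
    "f (pscale a c) = pscale a (f c)" "f (sum h A) = (\<Sum>x\<in>A. f (h x))"
proof -
  show add: "f (c + d) = f c + f d" for c d using assms by (simp add: plinear_def)
  show "f (pscale a c) = pscale a (f c)" using assms by (simp add: plinear_def)
  show z: "f 0 = 0" using add[of 0 0] by simp
  show u: "f (- c) = - f c" for c using add[of c "- c"] z by (simp add: minus_unique)
  show "f (c - d) = f c - f d" using add[of c "- d"] u by simp
  show "f (sum h A) = (\<Sum>x\<in>A. f (h x))"
    by (induction A rule: infinite_finite_induct) (auto simp: add z)
qed

lemmas lext_simps = plinear_simps[OF plinear_lext]

lemma lext_gen [simp]: "lext gen c = c"
proof (rule poly_mapping_eqI)
  fix k
  have "lookup (lext gen c) k = (\<Sum>i\<in>keys c. if i = k then lookup c i else 0)"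
    unfolding lext_def lookup_sum by (intro sum.cong) (auto simp: lookup_single when_def)
  also have "\<dots> = lookup c k" by (auto simp: in_keys_iff)
  finally show "lookup (lext gen c) k = lookup c k" .
qed

lemma plinear_eq_lext:
  assumes "plinear f" shows "f c = lext (\<lambda>k. f (gen k)) c"
proof -
  have "f c = f (lext gen c)" by simp
  also have "\<dots> = lext (\<lambda>k. f (gen k)) c"
    unfolding lext_def by (simp add: plinear_simps[OF assms])
  finally show ?thesis .
qed

lemma lext_cong: "(\<And>k. k \<in> keys c \<Longrightarrow> f k = g k) \<Longrightarrow> lext f c = lext g c"
  by (simp add: lext_def)

text \<open>
  Every identity between chain maps below is checked on generators with this rule.
\<close>

lemma plinear_eqI:
  assumes "plinear f" "plinear g" "\<And>k. k \<in> keys c \<Longrightarrow> f (gen k) = g (gen k)"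
  shows "f c = g c"
  using plinear_eq_lext[OF assms(1), of c] plinear_eq_lext[OF assms(2), of c] assms(3)
  by (metis (no_types, lifting) lext_cong)

lemma keys_lext: "keys (lext f c) \<subseteq> (\<Union>k\<in>keys c. keys (f k))"
proof -
  have "keys (lext f c) \<subseteq> (\<Union>k\<in>keys c. keys (pscale (lookup c k) (f k)))"
    unfolding lext_def by (rule order.trans[OF keys_sum]) simp
  also have "\<dots> \<subseteq> (\<Union>k\<in>keys c. keys (f k))" by (intro UN_mono order_refl keys_pscale)
  finally show ?thesis .
qed

lemma lext_lext: "lext f (lext g c) = lext (\<lambda>k. lext f (g k)) c"
  by (rule plinear_eqI[where f = "\<lambda>c. lext f (lext g c)"])
    (simp_all add: plinear_lext plinear_compose)

lemma subspace_plinear_image: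
  assumes f: "plinear f" and S: "formal.subspace S"
  shows "formal.subspace (f ` S)"
  unfolding formal.subspace_def
proof (intro conjI ballI allI)
  note simps = plinear_simps[OF f]
  show "0 \<in> f ` S" using imageI[OF formal.subspace_0[OF S], of f] by (simp only: simps(3))
  fix x assume "x \<in> f ` S"
  then obtain u where u: "x = f u" "u \<in> S" by blast
  show "pscale a x \<in> f ` S" for a
    using imageI[OF formal.subspace_scale[OF S u(2), of a], of f] by (simp only: simps(5) u(1))
  fix y assume "y \<in> f ` S"
  then obtain v where v: "y = f v" "v \<in> S" by blast
  show "x + y \<in> f ` S"
    using imageI[OF formal.subspace_add[OF S u(2) v(2)], of f] by (simp only: simps(1) u(1) v(1))
qed

lemmas plinear_intros = plinear_lext plinear_id plinear_zero plinear_add plinear_diff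
  plinear_pscale plinear_lookup

section \<open>Ordered chains\<close>

type_synonym ('a, 'f) chain = "'a list \<Rightarrow>\<^sub>0 'f"

definition consc :: "'a \<Rightarrow> ('a, 'f::field) chain \<Rightarrow> ('a, 'f) chain" where
  "consc x = lext (\<lambda>l. gen (x # l))"

text \<open>
  The alternating sum of the faces of a simplex, where the only face of a vertex is the empty list.
  This augmented boundary has the simplest recursion; the boundary \<open>obd\<close> drops the empty list, and its
  coefficient is the augmentation \<open>augm\<close>.
\<close>

primrec aug_face :: "'a list \<Rightarrow> ('a, 'f::field) chain" where
  "aug_face [] = 0"
| "aug_face (x # xs) = gen xs - consc x (aug_face xs)"

definition aug_bd :: "('a, 'f::field) chain \<Rightarrow> ('a, 'f) chain" where
  "aug_bd = lext aug_face"

definition augm :: "('a, 'f::field) chain \<Rightarrow> 'f" where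
  "augm c = lookup (aug_bd c) []"

definition obd :: "('a, 'f::field) chain \<Rightarrow> ('a, 'f) chain" where
  "obd c = aug_bd c - pscale (augm c) (gen [])"

lemma plinear_consc: "plinear (consc x)" by (simp add: consc_def plinear_lext)
lemma plinear_aug_bd: "plinear aug_bd" by (simp add: aug_bd_def plinear_lext)
lemma plinear_obd: "plinear obd"
  unfolding obd_def[abs_def] augm_def by (intro plinear_intros plinear_aug_bd)

lemmas consc_simps = plinear_simps[OF plinear_consc]
lemmas aug_bd_simps = plinear_simps[OF plinear_aug_bd]
lemmas obd_simps = plinear_simps[OF plinear_obd]

lemma consc_gen [simp]: "consc x (gen l) = gen (x # l)" by (simp add: consc_def)
lemma aug_bd_gen: "aug_bd (gen l) = aug_face l" by (simp add: aug_bd_def)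

lemma lookup_consc_Nil [simp]: "lookup (consc x c) [] = 0"
proof -
  have "[] \<notin> keys (consc x c)" unfolding consc_def using keys_lext[of "\<lambda>l. gen (x # l)" c] by auto
  then show ?thesis by (simp add: in_keys_iff)
qed

lemma augm_gen: "augm (gen l) = (if length l = 1 then 1 else 0)"
  by (cases l) (auto simp: augm_def aug_bd_gen lookup_minus lookup_single when_def)

lemma augm_simps:
  "augm (c + d) = augm c + augm d" "augm (c - d) = augm c - augm d" "augm 0 = 0"
  "augm (- c) = - augm c" "augm (pscale a c) = a * augm c" "augm (sum h A) = (\<Sum>x\<in>A. augm (h x))"
  by (simp_all add: augm_def aug_bd_simps lookup_add lookup_minus lookup_sum)

text \<open>
  In the augmented complex, \<open>Cons\<close> with a fixed vertex is a contracting homotopy.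
\<close>

lemma aug_bd_consc: "aug_bd (consc x c) = c - consc x (aug_bd c)"
  by (rule plinear_eqI[where f = "\<lambda>c. aug_bd (consc x c)"])
     (auto intro!: plinear_intros plinear_compose[of "consc x" aug_bd] plinear_compose[of aug_bd "consc x"] plinear_consc plinear_aug_bd
       simp: aug_bd_gen)

lemma aug_bd_aug_face: "aug_bd (aug_face l) = 0"
  by (induction l) (auto simp: aug_bd_simps aug_bd_gen aug_bd_consc consc_simps)

lemma aug_bd_aug_bd: "aug_bd (aug_bd c) = 0"
  by (rule plinear_eqI[where g = "\<lambda>c. 0"])
    (auto intro!: plinear_intros plinear_compose[of aug_bd aug_bd] plinear_aug_bd simp: aug_bd_gen aug_bd_aug_face)

lemma augm_obd: "augm (obd c) = 0"
  by (simp add: obd_def augm_simps augm_gen) (simp add: augm_def aug_bd_aug_bd)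

lemma obd_obd: "obd (obd c) = 0"
  by (simp add: obd_def[of "obd c"] augm_obd) (simp add: obd_def aug_bd_simps aug_bd_aug_bd aug_bd_gen)

definition abstract_complex :: "'a set set \<Rightarrow> bool" where
  "abstract_complex K \<longleftrightarrow>
     finite K \<and> (\<forall>\<sigma>\<in>K. finite \<sigma> \<and> \<sigma> \<noteq> {} \<and> (\<forall>\<tau>\<subseteq>\<sigma>. \<tau> \<noteq> {} \<longrightarrow> \<tau> \<in> K))"

definition full_simplex :: "'a set \<Rightarrow> 'a set set" where
  "full_simplex \<sigma> = {\<tau>. \<tau> \<subseteq> \<sigma> \<and> \<tau> \<noteq> {}}"

definition product_complex :: "'a set set \<Rightarrow> 'b set set \<Rightarrow> ('a \<times> 'b) set set" where
  "product_complex K L = {\<rho>. fst ` \<rho> \<in> K \<and> snd ` \<rho> \<in> L}"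

definition ordered_chains :: "'a set set \<Rightarrow> ('a, 'f::field) chain set" where
  "ordered_chains K = {c. \<forall>l\<in>keys c. set l \<in> K}"

lemma abstract_complexD:
  assumes "abstract_complex K"
  shows "finite K" "\<sigma> \<in> K \<Longrightarrow> finite \<sigma>" "{} \<notin> K" "\<sigma> \<in> K \<Longrightarrow> \<tau> \<subseteq> \<sigma> \<Longrightarrow> \<tau> \<noteq> {} \<Longrightarrow> \<tau> \<in> K"
proof -
  show "finite K" "{} \<notin> K" using assms by (auto simp: abstract_complex_def)
  show "\<sigma> \<in> K \<Longrightarrow> finite \<sigma>" using assms by (simp add: abstract_complex_def)
  show "\<sigma> \<in> K \<Longrightarrow> \<tau> \<subseteq> \<sigma> \<Longrightarrow> \<tau> \<noteq> {} \<Longrightarrow> \<tau> \<in> K" using assms unfolding abstract_complex_def by blast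
qed

lemma abstract_complex_full_simplex: "finite \<sigma> \<Longrightarrow> abstract_complex (full_simplex \<sigma>)"
  by (auto simp: abstract_complex_def full_simplex_def intro: finite_subset)

lemma abstract_complex_product:
  assumes K: "abstract_complex K" and L: "abstract_complex L"
  shows "abstract_complex (product_complex K L)"
proof -
  have sub: "\<rho> \<subseteq> fst ` \<rho> \<times> snd ` \<rho>" for \<rho> :: "('a \<times> 'b) set" by (rule subset_fst_snd)
  have fin: "finite \<rho>" if "\<rho> \<in> product_complex K L" for \<rho>
    using that abstract_complexD(2)[OF K, of "fst ` \<rho>"] abstract_complexD(2)[OF L, of "snd ` \<rho>"]
    by (auto simp: product_complex_def intro!: finite_subset[OF sub finite_cartesian_product])
  have "product_complex K L \<subseteq> Pow (\<Union>K \<times> \<Union>L)"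
  proof
    fix \<rho> assume "\<rho> \<in> product_complex K L"
    then have "fst ` \<rho> \<times> snd ` \<rho> \<subseteq> \<Union>K \<times> \<Union>L" by (auto simp: product_complex_def)
    with sub show "\<rho> \<in> Pow (\<Union>K \<times> \<Union>L)" by (metis PowI order.trans)
  qed
  moreover have "finite (Pow (\<Union>K \<times> \<Union>L))"
    using K L by (auto simp: abstract_complex_def)
  ultimately have "finite (product_complex K L)" by (rule finite_subset)
  then show ?thesis
    unfolding abstract_complex_def
  proof (intro conjI ballI allI impI)
    fix \<rho> assume \<rho>: "\<rho> \<in> product_complex K L"
    show "finite \<rho>" by (rule fin[OF \<rho>])
    show "\<rho> \<noteq> {}" using \<rho> abstract_complexD(3)[OF K] by (auto simp: product_complex_def)
    fix \<rho>' assume "\<rho>' \<subseteq> \<rho>" "\<rho>' \<noteq> {}"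
    then show "\<rho>' \<in> product_complex K L"
      using \<rho> abstract_complexD(4)[OF K, of "fst ` \<rho>" "fst ` \<rho>'"] abstract_complexD(4)[OF L, of "snd ` \<rho>" "snd ` \<rho>'"]
      by (simp add: product_complex_def image_mono)
  qed
qed

lemma product_full_simplex:
  "product_complex (full_simplex \<sigma>) (full_simplex \<tau>) = full_simplex (\<sigma> \<times> \<tau>)"
proof -
  have "\<rho> \<subseteq> \<sigma> \<times> \<tau> \<longleftrightarrow> fst ` \<rho> \<subseteq> \<sigma> \<and> snd ` \<rho> \<subseteq> \<tau>" for \<rho>
    by (auto simp: subset_iff)
  then show ?thesis by (auto simp: product_complex_def full_simplex_def)
qed

lemma subspace_ordered_chains: "formal.subspace (ordered_chains K)"
  unfolding formal.subspace_def ordered_chains_def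
  by (auto dest!: subsetD[OF keys_add] subsetD[OF keys_pscale])

lemma ordered_chains_mono: "K \<subseteq> L \<Longrightarrow> ordered_chains K \<subseteq> ordered_chains L"
  by (auto simp: ordered_chains_def)

lemma gen_in_ordered_chains: "gen l \<in> ordered_chains K \<longleftrightarrow> set l \<in> K"
  by (simp add: ordered_chains_def)

lemma ordered_chains_lookup_Nil: "c \<in> ordered_chains K \<Longrightarrow> abstract_complex K \<Longrightarrow> lookup c [] = 0"
  using abstract_complexD(3)[of K] bspec[of "keys c" "\<lambda>l. set l \<in> K" "[]"]
  by (auto simp: ordered_chains_def in_keys_iff)

lemma keys_consc: "keys (consc x c) \<subseteq> (#) x ` keys c"
proof -
  have "keys (consc x c) \<subseteq> (\<Union>l\<in>keys c. keys (gen (x # l) :: ('a, 'b) chain))"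
    unfolding consc_def by (rule keys_lext)
  then show ?thesis by auto
qed

lemma keys_aug_face:
  "l \<in> keys (aug_face xs :: ('a, 'f::field) chain) \<Longrightarrow> set l \<subseteq> set xs \<and> length xs = Suc (length l)"
proof (induction xs arbitrary: l)
  case (Cons x xs)
  have "l \<in> keys (gen xs :: ('a, 'f) chain) \<union> keys (consc x (aug_face xs :: ('a, 'f) chain))"
    by (rule subsetD[OF keys_diff]) (use Cons.prems in simp)
  then have "l = xs \<or> (\<exists>l'\<in>keys (aug_face xs :: ('a, 'f) chain). l = x # l')"
    using keys_consc[of x "aug_face xs :: ('a, 'f) chain"] by auto
  then show ?case using Cons.IH by fastforce
qed simp

lemma keys_obd:
  "keys (obd c) \<subseteq> {l. l \<noteq> [] \<and> (\<exists>k\<in>keys c. set l \<subseteq> set k \<and> length k = Suc (length l))}"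
proof
  fix l assume l: "l \<in> keys (obd c)"
  have "lookup (obd c) [] = 0" by (simp add: obd_def lookup_minus augm_def)
  then have nonempty: "l \<noteq> []" using l by (auto simp: in_keys_iff)
  then have "lookup (obd c) l = lookup (aug_bd c) l"
    by (simp add: obd_def lookup_minus lookup_single)
  then have "l \<in> keys (lext aug_face c)" using l by (simp add: in_keys_iff aug_bd_def)
  then have "l \<in> (\<Union>k\<in>keys c. keys (aug_face k :: ('a, 'b) chain))"
    by (rule subsetD[OF keys_lext])
  then obtain k where k: "k \<in> keys c" "l \<in> keys (aug_face k :: ('a, 'b) chain)" by blast
  show "l \<in> {l. l \<noteq> [] \<and> (\<exists>k\<in>keys c. set l \<subseteq> set k \<and> length k = Suc (length l))}"
    using nonempty k(1) keys_aug_face[OF k(2)] by blast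
qed

lemma obd_in_ordered_chains: "abstract_complex K \<Longrightarrow> c \<in> ordered_chains K \<Longrightarrow> obd c \<in> ordered_chains K"
  unfolding ordered_chains_def
  by (auto dest!: subsetD[OF keys_obd] intro: abstract_complexD(4))

lemma consc_in_full_simplex:
  "v \<in> \<sigma> \<Longrightarrow> c \<in> ordered_chains (full_simplex \<sigma>) \<Longrightarrow> consc v c \<in> ordered_chains (full_simplex \<sigma>)"
  using keys_consc[of v c] unfolding ordered_chains_def full_simplex_def by fastforce

text \<open>
  The contraction in terms of the boundary without the empty list: a cycle in a full simplex is
  homologous to a multiple of a vertex, the multiple being its augmentation.
\<close>

lemma cone_homotopy:
  assumes "lookup c [] = 0"
  shows "obd (consc v c) + consc v (obd c) = c - pscale (augm c) (gen [v])"
proof -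
  have "augm (consc v c) = 0"
    using assms by (simp add: augm_def aug_bd_consc lookup_minus)
  then show ?thesis
    by (simp add: obd_def aug_bd_consc consc_simps)
qed

section \<open>The cross product\<close>

text \<open>
  The sum, with signs, of all monotone staircase paths of pairs from the two first to the two last
  vertices. A path starts at \<open>(x, y)\<close> and then advances in exactly one of the lists; advancing in the
  second one moves it past the remaining steps of the first one, which gives the sign. The summand
  \<open>gen []\<close> is the end of a path.
\<close>

fun shuffle :: "'a list \<Rightarrow> 'b list \<Rightarrow> ('a \<times> 'b, 'f::field) chain" where
  "shuffle (x # xs) (y # ys) = consc (x, y)
     ((if xs = [] \<and> ys = [] then gen [] else 0)
      + shuffle xs (y # ys) + pscale ((- 1) ^ length xs) (shuffle (x # xs) ys))"
| "shuffle [] ys = 0"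
| "shuffle xs [] = 0"

definition cross :: "('a, 'f::field) chain \<Rightarrow> ('b, 'f) chain \<Rightarrow> ('a \<times> 'b, 'f) chain" where
  "cross c d = lext (\<lambda>xs. lext (shuffle xs) d) c"

text \<open>
  The sign of the Leibniz rule depends on the degree. Since chains may mix degrees, it is applied as
  an operator; it is \<open>- 1\<close> to the length of a list, which is one more than its degree.
\<close>

definition parity_sign :: "('a, 'f::field) chain \<Rightarrow> ('a, 'f) chain" where
  "parity_sign = lext (\<lambda>l. pscale ((- 1) ^ length l) (gen l))"

lemma plinear_cross_left: "plinear (\<lambda>c. cross c d)"
  unfolding cross_def by (rule plinear_lext)

lemma plinear_cross_right: "plinear (cross c)"
  unfolding cross_def[abs_def] lext_def[of _ c]
proof (induction "keys c" rule: infinite_finite_induct)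
qed (auto simp: plinear_def lext_simps formal.scale_right_distrib sum.distrib formal.scale_sum_right mult.commute)

lemma plinear_parity_sign: "plinear parity_sign" by (simp add: parity_sign_def plinear_lext)

lemmas cross_simps = plinear_simps[OF plinear_cross_left] plinear_simps[OF plinear_cross_right]
lemmas parity_sign_simps = plinear_simps[OF plinear_parity_sign]

lemma cross_gen: "cross (gen xs) (gen ys) = shuffle xs ys" by (simp add: cross_def)

lemma cross_Nil_left: "cross (gen []) d = 0"
  by (rule plinear_eqI[where g = "\<lambda>c. 0"]) (auto intro: plinear_cross_right plinear_zero simp: cross_gen)

lemma shuffle_Nil_right: "shuffle xs [] = 0" by (cases xs) auto

lemma cross_Nil_right: "cross c (gen []) = 0"
  by (rule plinear_eqI[where g = "\<lambda>c. 0" and f = "\<lambda>c. cross c (gen [])"])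
    (auto intro: plinear_cross_left plinear_zero simp: cross_gen shuffle_Nil_right)

lemma plinear_eqI2:
  assumes "\<And>d. plinear (\<lambda>c. f c d)" "\<And>d. plinear (\<lambda>c. g c d)" "\<And>c. plinear (f c)" "\<And>c. plinear (g c)"
    and "\<And>k l. f (gen k) (gen l) = g (gen k) (gen l)"
  shows "f c d = g c d"
proof (rule plinear_eqI[where f = "\<lambda>c. f c d" and g = "\<lambda>c. g c d"])
  fix k
  show "f (gen k) d = g (gen k) d" by (rule plinear_eqI) (use assms in auto)
qed (use assms in auto)

text \<open>
  The recursion of \<open>shuffle\<close> in bilinear form. The sign is \<open>- 1\<close> to the number of remaining entries of
  the first list, which is why \<open>parity_sign\<close> stands inside \<open>consc x\<close>.
\<close>

lemma cross_consc:
  "cross (consc x c) (consc y d) = consc (x, y)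
     (pscale (lookup c [] * lookup d []) (gen []) + cross c (consc y d) + cross (consc x (parity_sign c)) d)"
proof (rule plinear_eqI2[where f = "\<lambda>c d. cross (consc x c) (consc y d)"])
  fix xs ys show "cross (consc x (gen xs)) (consc y (gen ys)) = consc (x, y)
     (pscale (lookup (gen xs) [] * lookup (gen ys) []) (gen []) + cross (gen xs) (consc y (gen ys))
       + cross (consc x (parity_sign (gen xs))) (gen ys))"
    by (auto simp: cross_gen parity_sign_def consc_simps cross_simps lookup_single when_def)
next
  note linear = plinear_def cross_simps consc_simps parity_sign_simps lookup_add
    formal.scale_left_distrib formal.scale_right_distrib distrib_left distrib_right
  show "plinear (\<lambda>c. cross (consc x c) (consc y d))" for d by (simp add: linear)
  show "plinear (\<lambda>d. cross (consc x c) (consc y d))" for c by (simp add: linear)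
  show "plinear (\<lambda>c. consc (x, y) (pscale (lookup c [] * lookup d []) (gen [])
          + cross c (consc y d) + cross (consc x (parity_sign c)) d))" for d
    by (simp add: linear mult.assoc)
  show "plinear (\<lambda>d. consc (x, y) (pscale (lookup c [] * lookup d []) (gen [])
          + cross c (consc y d) + cross (consc x (parity_sign c)) d))" for c
    by (simp add: linear mult.left_commute)
qed

lemma parity_sign_gen: "parity_sign (gen l) = pscale ((- 1) ^ length l) (gen l)"
  by (simp add: parity_sign_def)

lemma parity_sign_consc: "parity_sign (consc x c) = - consc x (parity_sign c)"
proof -
  have "parity_sign (consc x c) = consc x (pscale (-1) (parity_sign c))"
    by (rule plinear_eqI[where f = "\<lambda>c. parity_sign (consc x c)"])
      (simp_all add: plinear_def parity_sign_gen consc_simps parity_sign_simps algebra_simps)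
  then show ?thesis by (simp add: consc_simps)
qed

lemma parity_sign_aug_bd: "parity_sign (aug_bd c) = - aug_bd (parity_sign c)"
proof -
  have face: "parity_sign (aug_face l) = pscale ((-1) ^ Suc (length l)) (aug_face l)" for l :: "'a list"
    by (induction l) (auto simp: parity_sign_simps parity_sign_gen parity_sign_consc consc_simps
          formal.scale_right_diff_distrib)
  have "parity_sign (aug_bd c) = pscale (-1) (aug_bd (parity_sign c))"
    by (rule plinear_eqI[where f = "\<lambda>c. parity_sign (aug_bd c)"])
      (simp_all add: plinear_def parity_sign_gen aug_bd_simps parity_sign_simps aug_bd_gen face algebra_simps)
  then show ?thesis by simp
qed

lemma parity_sign_gen_cases: "parity_sign (gen l) = gen l \<or> parity_sign (gen l) = - gen l"
  by (cases "even (length l)") (auto simp: parity_sign_gen)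

lemma augm_consc: "augm (consc x c) = lookup c []"
  by (simp add: augm_def aug_bd_consc lookup_minus)

text \<open>
  The Leibniz rule on generators, by induction along the recursion of \<open>shuffle\<close>: expanding the boundary
  of a cone with \<open>aug_bd_consc\<close> and using the induction hypotheses, both sides become the same
  combination of products of shorter lists. The last summand accounts for a product of two vertices,
  whose augmented boundary is the empty list.
\<close>

lemma aug_bd_shuffle:
  "aug_bd (shuffle xs ys :: ('a \<times> 'b, 'f::field) chain) = cross (aug_bd (gen xs)) (gen ys)
     - cross (parity_sign (gen xs)) (aug_bd (gen ys)) + pscale (augm (gen xs) * augm (gen ys)) (gen [])"
proof (induction xs ys rule: shuffle.induct)
  case (1 x xs y ys)
  define u where "u = (gen xs :: ('a, 'f) chain)"
  define v where "v = (gen ys :: ('b, 'f) chain)"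
  have gen: "gen (x # xs) = consc x u" "gen (y # ys) = consc y v" by (simp_all add: u_def v_def)
  have IH1: "aug_bd (cross u (consc y v)) = cross (aug_bd u) (consc y v)
     - cross (parity_sign u) (aug_bd (consc y v)) + pscale (augm u * augm (consc y v)) (gen [])"
    using 1(1) by (simp add: u_def v_def cross_gen)
  have IH2: "aug_bd (cross (consc x u) v) = cross (aug_bd (consc x u)) v
     - cross (parity_sign (consc x u)) (aug_bd v) + pscale (augm (consc x u) * augm v) (gen [])"
    using 1(2) by (simp add: u_def v_def cross_gen)
  have s: "parity_sign u = u \<or> parity_sign u = - u" unfolding u_def by (rule parity_sign_gen_cases)
  have lk: "lookup (aug_bd u) [] = augm u" "lookup (aug_bd v) [] = augm v" by (simp_all add: augm_def)
  have "shuffle (x # xs) (y # ys) = cross (consc x u) (consc y v)"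
    by (simp only: gen[symmetric] cross_gen)
  also have "aug_bd \<dots> = cross (aug_bd (consc x u)) (consc y v)
     - cross (parity_sign (consc x u)) (aug_bd (consc y v)) + pscale (augm (consc x u) * augm (consc y v)) (gen [])"
    \<comment> \<open>The sign operator acts on a generator as a sign, so both signs can be tried.\<close>
    using s by (elim disjE)
      (simp_all add: cross_consc aug_bd_consc aug_bd_simps consc_simps cross_simps parity_sign_consc parity_sign_aug_bd
        augm_consc lk IH1 IH2 aug_bd_gen algebra_simps)
  finally show ?case by (simp only: gen)
qed (auto simp: aug_bd_simps cross_Nil_left cross_Nil_right aug_bd_gen augm_simps augm_gen cross_simps parity_sign_gen)

lemma aug_bd_cross:
  "aug_bd (cross c d) = cross (aug_bd c) d - cross (parity_sign c) (aug_bd d) + pscale (augm c * augm d) (gen [])"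
proof (rule plinear_eqI2[where f = "\<lambda>c d. aug_bd (cross c d)"])
  fix xs ys show "aug_bd (cross (gen xs) (gen ys)) = cross (aug_bd (gen xs)) (gen ys)
     - cross (parity_sign (gen xs)) (aug_bd (gen ys)) + pscale (augm (gen xs) * augm (gen ys)) (gen [])"
    by (simp add: cross_gen aug_bd_shuffle)
next
  show "plinear (\<lambda>c. aug_bd (cross c d))" for d by (rule plinear_compose[OF plinear_aug_bd plinear_cross_left])
  show "plinear (\<lambda>d. aug_bd (cross c d))" for c by (rule plinear_compose[OF plinear_aug_bd plinear_cross_right])
  show "plinear (\<lambda>c. cross (aug_bd c) d - cross (parity_sign c) (aug_bd d) + pscale (augm c * augm d) (gen []))" for d
    by (simp add: plinear_def aug_bd_simps cross_simps parity_sign_simps augm_simps algebra_simps)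
  show "plinear (\<lambda>d. cross (aug_bd c) d - cross (parity_sign c) (aug_bd d) + pscale (augm c * augm d) (gen []))" for c
    by (simp add: plinear_def aug_bd_simps cross_simps parity_sign_simps augm_simps algebra_simps)
qed

lemma keys_shuffle:
  "l \<in> keys (shuffle xs ys :: ('a \<times> 'b, 'f::field) chain) \<Longrightarrow> xs \<noteq> [] \<and> ys \<noteq> [] \<and> l \<noteq> [] \<and> set l \<subseteq> set xs \<times> set ys \<and> Suc (length l) = length xs + length ys"
proof (induction xs ys arbitrary: l rule: shuffle.induct)
  case (1 x xs y ys)
  obtain l' where l: "l = (x, y) # l'" "l' \<in> keys ((if xs = [] \<and> ys = [] then gen [] else 0) + shuffle xs (y # ys)
      + pscale ((- 1) ^ length xs) (shuffle (x # xs) ys) :: ('a \<times> 'b, 'f) chain)"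
    using subsetD[OF keys_consc 1(3)[unfolded shuffle.simps]] by blast
  then have "l' \<in> keys (if xs = [] \<and> ys = [] then gen [] else 0 :: ('a \<times> 'b, 'f) chain)
      \<or> l' \<in> keys (shuffle xs (y # ys) :: ('a \<times> 'b, 'f) chain)
      \<or> l' \<in> keys (shuffle (x # xs) ys :: ('a \<times> 'b, 'f) chain)"
    using keys_add keys_pscale by (metis (no_types, lifting) UnE subsetD)
  then show ?case
  proof (elim disjE)
    assume "l' \<in> keys (if xs = [] \<and> ys = [] then gen [] else 0 :: ('a \<times> 'b, 'f) chain)"
    then show ?thesis using l(1) by (auto split: if_splits)
  next
    assume "l' \<in> keys (shuffle xs (y # ys) :: ('a \<times> 'b, 'f) chain)"
    from 1(1)[OF this] show ?thesis using l(1) by auto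
  next
    assume "l' \<in> keys (shuffle (x # xs) ys :: ('a \<times> 'b, 'f) chain)"
    from 1(2)[OF this] show ?thesis using l(1) by auto
  qed
qed auto

lemma keys_cross:
  fixes c :: "('a, 'f::field) chain"
  assumes "l \<in> keys (cross c d)"
  shows "\<exists>xs\<in>keys c. \<exists>ys\<in>keys d. l \<in> keys (shuffle xs ys :: ('a \<times> 'b, 'f) chain)"
proof -
  obtain xs where xs: "xs \<in> keys c" "l \<in> keys (lext (shuffle xs) d)"
    using assms keys_lext[of "\<lambda>xs. lext (shuffle xs) d" c] unfolding cross_def by blast
  with keys_lext[of "shuffle xs" d] show ?thesis by blast
qed

lemma cross_in_product:
  fixes c :: "('a, 'f::field) chain"
  assumes "abstract_complex K" "abstract_complex L" "c \<in> ordered_chains K" "d \<in> ordered_chains L"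
  shows "cross c d \<in> ordered_chains (product_complex K L)"
proof -
  have "set l \<in> product_complex K L" if l: "l \<in> keys (cross c d)" for l
  proof -
    obtain xs ys where h: "xs \<in> keys c" "ys \<in> keys d" "l \<in> keys (shuffle xs ys :: ('a \<times> 'b, 'f) chain)"
      using keys_cross[OF l] by blast
    have sub: "l \<noteq> []" "fst ` set l \<subseteq> set xs" "snd ` set l \<subseteq> set ys" using keys_shuffle[OF h(3)] by auto
    have "set xs \<in> K" "set ys \<in> L" using assms h by (auto simp: ordered_chains_def)
    then show ?thesis
      using abstract_complexD(4)[OF assms(1) _ sub(2)] abstract_complexD(4)[OF assms(2) _ sub(3)] sub(1)
      by (auto simp: product_complex_def)
  qed
  then show ?thesis by (auto simp: ordered_chains_def)
qed

lemma lookup_cross_Nil: "lookup (cross c d) [] = 0"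
  using keys_cross[of "[]" c d] keys_shuffle[of "[]"] by (auto simp: in_keys_iff[symmetric] not_in_keys_iff_lookup_eq_zero[symmetric])

lemma augm_cross: "augm (cross c d) = augm c * augm d"
  by (simp add: augm_def[of "cross c d"] aug_bd_cross lookup_add lookup_minus lookup_cross_Nil)

text \<open>
  The Leibniz rule in the usual form: the augmentation is multiplicative, so that its contributions
  cancel, and products with the empty list vanish.
\<close>

lemma obd_cross: "obd (cross c d) = cross (obd c) d - cross (parity_sign c) (obd d)"
  by (simp add: obd_def augm_cross aug_bd_cross cross_simps cross_Nil_left cross_Nil_right)

section \<open>Mayer-Vietoris arguments\<close>

text \<open>
  A functor \<open>D\<close> from finite complexes to subcomplexes of one ambient group, such that unions of complexes
  go to sums and intersections to intersections; in other words, the Mayer-Vietoris sequences of \<open>D\<close>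
  are exact.
\<close>

definition Mayer_Vietoris :: "('a set set \<Rightarrow> 'v::ab_group_add set) \<Rightarrow> ('v \<Rightarrow> 'v) \<Rightarrow> bool" where
  "Mayer_Vietoris D d \<longleftrightarrow>
     (\<forall>x y. d (x - y) = d x - d y) \<and>
     (\<forall>K. abstract_complex K \<longrightarrow> 0 \<in> D K \<and> (\<forall>x\<in>D K. d x \<in> D K \<and> d (d x) = 0 \<and> (\<forall>y\<in>D K. x - y \<in> D K))) \<and>
     D {} = {0} \<and>
     (\<forall>K L. K \<subseteq> L \<longrightarrow> D K \<subseteq> D L) \<and>
     (\<forall>K L. D K \<inter> D L \<subseteq> D (K \<inter> L)) \<and>
     (\<forall>K L. abstract_complex K \<longrightarrow> abstract_complex L \<longrightarrow> (\<forall>x\<in>D (K \<union> L). \<exists>y\<in>D K. x - y \<in> D L))"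

lemma Mayer_VietorisI:
  assumes "\<And>x y. d (x - y) = d x - d y"
    and "\<And>K. abstract_complex K \<Longrightarrow> 0 \<in> D K"
    and "\<And>K x. abstract_complex K \<Longrightarrow> x \<in> D K \<Longrightarrow> d x \<in> D K"
    and "\<And>K x. abstract_complex K \<Longrightarrow> x \<in> D K \<Longrightarrow> d (d x) = 0"
    and "\<And>K x y. abstract_complex K \<Longrightarrow> x \<in> D K \<Longrightarrow> y \<in> D K \<Longrightarrow> x - y \<in> D K"
    and "D {} = {0}"
    and "\<And>K L x. K \<subseteq> L \<Longrightarrow> x \<in> D K \<Longrightarrow> x \<in> D L"
    and "\<And>K L x. x \<in> D K \<Longrightarrow> x \<in> D L \<Longrightarrow> x \<in> D (K \<inter> L)"
    and "\<And>K L x. abstract_complex K \<Longrightarrow> abstract_complex L \<Longrightarrow> x \<in> D (K \<union> L) \<Longrightarrow> \<exists>y\<in>D K. x - y \<in> D L"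
  shows "Mayer_Vietoris D d"
  unfolding Mayer_Vietoris_def
  by (intro conjI allI impI ballI subsetI) (use assms in \<open>auto simp del: Diff_iff\<close>)

lemma Mayer_VietorisD:
  assumes "Mayer_Vietoris D d"
  shows "d (x - y) = d x - d y"
    and "abstract_complex K \<Longrightarrow> 0 \<in> D K"
    and "abstract_complex K \<Longrightarrow> x \<in> D K \<Longrightarrow> d x \<in> D K"
    and "abstract_complex K \<Longrightarrow> x \<in> D K \<Longrightarrow> d (d x) = 0"
    and "abstract_complex K \<Longrightarrow> x \<in> D K \<Longrightarrow> y \<in> D K \<Longrightarrow> x - y \<in> D K"
    and "D {} = {0}"
    and "K \<subseteq> L \<Longrightarrow> x \<in> D K \<Longrightarrow> x \<in> D L"
    and "x \<in> D K \<Longrightarrow> x \<in> D L \<Longrightarrow> x \<in> D (K \<inter> L)"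
    and "abstract_complex K \<Longrightarrow> abstract_complex L \<Longrightarrow> x \<in> D (K \<union> L) \<Longrightarrow> \<exists>y\<in>D K. x - y \<in> D L"
  using assms unfolding Mayer_Vietoris_def by ((elim conjE; simp; fail) | blast)+

text \<open>
  Induction on the number of simplices. Remove a maximal simplex \<open>\<sigma>\<close>: the complex is the union of the
  rest and of the full simplex on \<open>\<sigma>\<close>, and the rest and the intersection are smaller. A cycle is
  split into \<open>a\<close> in the rest and \<open>z - a\<close> in the full simplex; their boundaries agree up to sign, hence lie in
  the intersection, and bound there. Correcting both parts by that chain makes them cycles, which
  bound by induction and by assumption.
\<close>

lemma Mayer_Vietoris_acyclic:
  fixes D :: "'a set set \<Rightarrow> 'v::ab_group_add set"
  assumes MV: "Mayer_Vietoris D d"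
    and simplex: "\<And>\<sigma> z. finite \<sigma> \<Longrightarrow> \<sigma> \<noteq> {} \<Longrightarrow> z \<in> D (full_simplex \<sigma>) \<Longrightarrow> d z = 0
      \<Longrightarrow> \<exists>y\<in>D (full_simplex \<sigma>). d y = z"
    and "abstract_complex K" "z \<in> D K" "d z = 0"
  shows "\<exists>y\<in>D K. d y = z"
  using assms(3-5)
proof (induction "card K" arbitrary: K z rule: less_induct)
  case less
  note MVD = Mayer_VietorisD[OF MV]
  have add: "d (x + y) = d x + d y" for x y
    using MVD(1)[of "x + y" y] by (simp add: algebra_simps)
  have addD: "x + y \<in> D L" if "abstract_complex L" "x \<in> D L" "y \<in> D L" for L x y
    using MVD(5)[OF that(1,2) MVD(5)[OF that(1) MVD(2)[OF that(1)] that(3)]] by simp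
  note K = abstract_complexD[OF less.prems(1)]
  show ?case
  proof (cases "K = {}")
    case True
    then have "z = 0" using less.prems(2) MVD(6) by simp
    then show ?thesis using MVD(1)[of 0 0] MVD(2)[OF less.prems(1)] by auto
  next
    case False
    obtain \<sigma> where \<sigma>: "\<sigma> \<in> K" and max: "\<And>\<tau>. \<tau> \<in> K \<Longrightarrow> \<sigma> \<subseteq> \<tau> \<Longrightarrow> \<tau> = \<sigma>"
      using finite_has_maximal[OF K(1) False] by metis
    let ?S = "full_simplex \<sigma>" and ?K1 = "K - {\<sigma>}"
    have fin: "finite \<sigma>" "\<sigma> \<noteq> {}" using \<sigma> K by auto
    have S: "abstract_complex ?S" using fin by (rule_tac abstract_complex_full_simplex)
    have SK: "?S \<subseteq> K" "\<sigma> \<in> ?S" using \<sigma> fin K(4)[OF \<sigma>] by (auto simp: full_simplex_def)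
    show ?thesis
    proof (cases "K = ?S")
      case True
      then show ?thesis using simplex[OF fin] less.prems by metis
    next
      case False
      have K1: "abstract_complex ?K1"
        unfolding abstract_complex_def using K max by blast
      have I: "abstract_complex (?K1 \<inter> ?S)"
        using K1 S unfolding abstract_complex_def by blast
      have card1: "card ?K1 < card K" using \<sigma> K(1) by (intro psubset_card_mono) auto
      moreover have "card (?K1 \<inter> ?S) \<le> card ?K1" using K(1) by (intro card_mono) auto
      ultimately have cardI: "card (?K1 \<inter> ?S) < card K" by simp
      have un: "K = ?K1 \<union> ?S" using SK by auto
      obtain a where a: "a \<in> D ?K1" "z - a \<in> D ?S"
        using MVD(9)[OF K1 S, of z] un less.prems(2) by auto
      have "d (z - a) = - d a" using MVD(1) less.prems(3) by simp
      then have "d a = 0 - d (z - a)" by simp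
      then have "d a \<in> D ?S" using MVD(5)[OF S MVD(2)[OF S] MVD(3)[OF S a(2)]] by simp
      then have "d a \<in> D (?K1 \<inter> ?S)" using MVD(8) MVD(3)[OF K1 a(1)] by blast
      moreover have "d (d a) = 0" by (rule MVD(4)[OF K1 a(1)])
      ultimately obtain e where e: "e \<in> D (?K1 \<inter> ?S)" "d e = d a"
        using less.hyps[OF cardI I] by blast
      have e12: "e \<in> D ?K1" "e \<in> D ?S" using e(1) MVD(7)[of "?K1 \<inter> ?S" _ e] by auto
      have "a - e \<in> D ?K1" "d (a - e) = 0" using MVD(5)[OF K1 a(1) e12(1)] MVD(1) e(2) by auto
      then obtain y1 where y1: "y1 \<in> D ?K1" "d y1 = a - e" using less.hyps[OF card1 K1] by blast
      have "(z - a) + e \<in> D ?S" by (rule addD[OF S a(2) e12(2)])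
      moreover have "d ((z - a) + e) = 0" by (simp add: add MVD(1) e(2) less.prems(3))
      ultimately obtain y2 where y2: "y2 \<in> D ?S" "d y2 = (z - a) + e" using simplex[OF fin] by blast
      have "y1 \<in> D K" "y2 \<in> D K" using y1(1) y2(1) MVD(7)[of ?K1 K] MVD(7)[OF SK(1)] by auto
      then have "y1 + y2 \<in> D K" "d (y1 + y2) = z"
        using addD[OF less.prems(1)] by (auto simp: add y1(2) y2(2))
      then show ?thesis by blast
    qed
  qed
qed

text \<open>
  Acyclicity of the mapping cone, whose differential sends \<open>(a, b)\<close> to \<open>(dA a, \<psi> a - dB b)\<close>. Taking \<open>a = 0\<close>
  it says that every cycle \<open>b\<close> is homologous to the image of a cycle, and taking \<open>a\<close> a cycle with
  bounding image it says that \<open>a\<close> bounds.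
\<close>

definition quasi_iso ::
  "'v::ab_group_add set \<Rightarrow> ('v \<Rightarrow> 'v) \<Rightarrow> 'w::ab_group_add set \<Rightarrow> ('w \<Rightarrow> 'w) \<Rightarrow> ('v \<Rightarrow> 'w) \<Rightarrow> bool" where
  "quasi_iso A dA B dB \<psi> \<longleftrightarrow>
     (\<forall>a\<in>A. \<forall>b\<in>B. dA a = 0 \<longrightarrow> \<psi> a = dB b \<longrightarrow> (\<exists>a'\<in>A. \<exists>b'\<in>B. dA a' = a \<and> \<psi> a' - dB b' = b))"

text \<open>
  The mapping cones of \<open>\<psi>\<close> form a functor with exact Mayer-Vietoris sequences again.
\<close>

lemma quasi_iso_by_Mayer_Vietoris:
  fixes T :: "'a set set \<Rightarrow> 'v::ab_group_add set" and S :: "'a set set \<Rightarrow> 'w::ab_group_add set"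
  assumes T: "Mayer_Vietoris T dT" and S: "Mayer_Vietoris S dS"
    and diff: "\<And>x y. \<psi> (x - y) = \<psi> x - \<psi> y"
    and into: "\<And>K x. abstract_complex K \<Longrightarrow> x \<in> T K \<Longrightarrow> \<psi> x \<in> S K"
    and chain: "\<And>K x. abstract_complex K \<Longrightarrow> x \<in> T K \<Longrightarrow> \<psi> (dT x) = dS (\<psi> x)"
    and simplex: "\<And>\<sigma>. finite \<sigma> \<Longrightarrow> \<sigma> \<noteq> {} \<Longrightarrow> quasi_iso (T (full_simplex \<sigma>)) dT (S (full_simplex \<sigma>)) dS \<psi>"
    and K: "abstract_complex K"
  shows "quasi_iso (T K) dT (S K) dS \<psi>"
proof -
  let ?D = "\<lambda>K. T K \<times> S K" and ?d = "\<lambda>(t, c). (dT t, \<psi> t - dS c)"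
  note TD = Mayer_VietorisD[OF T] and SD = Mayer_VietorisD[OF S]
  have zero: "dS 0 = 0" using SD(1)[of 0 0] by simp
  have MV: "Mayer_Vietoris ?D ?d"
  proof (rule Mayer_VietorisI)
    show "?d (x - y) = ?d x - ?d y" for x y
      by (cases x; cases y) (simp add: TD(1) SD(1) diff)
    show "0 \<in> ?D L" if "abstract_complex L" for L using TD(2) SD(2) that by (simp add: zero_prod_def)
    show "?d x \<in> ?D L" if "abstract_complex L" "x \<in> ?D L" for L x
      using that TD(3) SD(3,5) into by auto
    show "?d (?d x) = 0" if "abstract_complex L" "x \<in> ?D L" for L x
      using that TD(4) SD(1,4) chain by (auto simp: zero_prod_def)
    show "x - y \<in> ?D L" if "abstract_complex L" "x \<in> ?D L" "y \<in> ?D L" for L x y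
      using that TD(5) SD(5) by auto
    show "?D {} = {0}" using TD(6) SD(6) by (simp add: zero_prod_def)
    show "x \<in> ?D L" if "K \<subseteq> L" "x \<in> ?D K" for K L x using that TD(7) SD(7) by blast
    show "x \<in> ?D (K \<inter> L)" if "x \<in> ?D K" "x \<in> ?D L" for K L x using that TD(8) SD(8) by blast
    show "\<exists>y\<in>?D K. x - y \<in> ?D L" if KL: "abstract_complex K" "abstract_complex L" and x: "x \<in> ?D (K \<union> L)" for K L x
    proof -
      obtain t c where tc: "x = (t, c)" "t \<in> T (K \<union> L)" "c \<in> S (K \<union> L)" using x by auto
      obtain t' c' where "t' \<in> T K" "t - t' \<in> T L" "c' \<in> S K" "c - c' \<in> S L"
        using TD(9)[OF KL tc(2)] SD(9)[OF KL tc(3)] by blast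
      then show ?thesis using tc(1) by (intro bexI[of _ "(t', c')"]) auto
    qed
  qed
  have "\<exists>y\<in>?D (full_simplex \<sigma>). ?d y = z"
    if "finite \<sigma>" "\<sigma> \<noteq> {}" "z \<in> ?D (full_simplex \<sigma>)" "?d z = 0" for \<sigma> z
    using simplex[OF that(1,2)] that(3,4) unfolding quasi_iso_def by (fastforce simp: zero_prod_def)
  from Mayer_Vietoris_acyclic[OF MV this K]
  have "\<exists>y\<in>?D K. ?d y = z" if "z \<in> ?D K" "?d z = 0" for z using that by blast
  then show ?thesis unfolding quasi_iso_def by (fastforce simp: zero_prod_def)
qed

text \<open>
  A complex with the homology of a point, represented by the cycle \<open>p\<close> and detected by \<open>\<epsilon>\<close>.
\<close>

definition augmented_acyclic ::
  "('a \<Rightarrow>\<^sub>0 'f::field) set \<Rightarrow> (('a \<Rightarrow>\<^sub>0 'f) \<Rightarrow> ('a \<Rightarrow>\<^sub>0 'f)) \<Rightarrow> (('a \<Rightarrow>\<^sub>0 'f) \<Rightarrow> 'f) \<Rightarrow> ('a \<Rightarrow>\<^sub>0 'f) \<Rightarrow> bool"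
where
  "augmented_acyclic A d \<epsilon> p \<longleftrightarrow> formal.subspace A \<and> plinear d \<and> p \<in> A \<and> d p = 0 \<and>
     (\<forall>c\<in>A. \<epsilon> (d c) = 0) \<and> (\<forall>c\<in>A. d c = 0 \<longrightarrow> (\<exists>y\<in>A. d y = c - pscale (\<epsilon> c) p))"

text \<open>
  A cycle \<open>a\<close> whose image bounds has augmentation 0 and so bounds. If it is the boundary of \<open>y\<close>, the remaining
  cycle \<open>b - \<psi> y\<close> is homologous to a multiple of the base point, which lifts along \<open>\<psi>\<close>.
\<close>

lemma quasi_iso_augmented_acyclic:
  assumes A: "augmented_acyclic A dA \<epsilon>A pA" and B: "augmented_acyclic B dB \<epsilon>B pB"
    and lin: "plinear \<psi>" and into: "\<And>a. a \<in> A \<Longrightarrow> \<psi> a \<in> B"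
    and chain: "\<And>a. a \<in> A \<Longrightarrow> \<psi> (dA a) = dB (\<psi> a)"
    and aug: "\<And>a. a \<in> A \<Longrightarrow> \<epsilon>B (\<psi> a) = \<epsilon>A a" and pt: "\<psi> pA = pB"
  shows "quasi_iso A dA B dB \<psi>"
  unfolding quasi_iso_def
proof (intro ballI impI)
  fix a b assume a: "a \<in> A" "dA a = 0" and b: "b \<in> B" "\<psi> a = dB b"
  have linear: "plinear dA" "plinear dB" and sub: "formal.subspace A" "formal.subspace B"
    using A B by (auto simp: augmented_acyclic_def)
  note simps = plinear_simps[OF linear(1)] plinear_simps[OF linear(2)] plinear_simps[OF lin]
  have "\<epsilon>A a = \<epsilon>B (dB b)" using aug[OF a(1)] b(2) by simp
  also have "\<dots> = 0" using B b(1) by (simp add: augmented_acyclic_def)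
  finally obtain y where y: "y \<in> A" "dA y = a" using A a by (auto simp: augmented_acyclic_def)
  let ?b = "b - \<psi> y"
  have "?b \<in> B" "dB ?b = 0"
    using formal.subspace_diff[OF sub(2)] b y into chain[OF y(1)] by (auto simp: simps)
  then obtain u where u: "u \<in> B" "dB u = ?b - pscale (\<epsilon>B ?b) pB"
    using B unfolding augmented_acyclic_def by blast
  show "\<exists>a'\<in>A. \<exists>b'\<in>B. dA a' = a \<and> \<psi> a' - dB b' = b"
  proof (intro bexI conjI)
    show "dA (y + pscale (\<epsilon>B ?b) pA) = a" using A y by (simp add: simps augmented_acyclic_def)
    show "\<psi> (y + pscale (\<epsilon>B ?b) pA) - dB (- u) = b" by (simp add: simps pt u(2))
    show "- u \<in> B" using u(1) sub(2) by (rule_tac formal.subspace_neg)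
    show "y + pscale (\<epsilon>B ?b) pA \<in> A"
      using y(1) sub(1) A by (auto simp: augmented_acyclic_def intro!: formal.subspace_add formal.subspace_scale)
  qed
qed

lemma augmented_acyclic_ordered_chains:
  assumes "finite \<sigma>" "v \<in> \<sigma>"
  shows "augmented_acyclic (ordered_chains (full_simplex \<sigma>)) obd augm (gen [v])"
  unfolding augmented_acyclic_def
proof (intro conjI ballI impI subspace_ordered_chains plinear_obd)
  note comp = abstract_complex_full_simplex[OF assms(1)]
  show "gen [v] \<in> ordered_chains (full_simplex \<sigma>)" using assms by (auto simp: gen_in_ordered_chains full_simplex_def)
  show "obd (gen [v]) = 0" by (simp add: obd_def aug_bd_gen augm_gen consc_simps)
  show "augm (obd c) = 0" for c by (rule augm_obd)
  fix c :: "('a, 'b) chain" assume c: "c \<in> ordered_chains (full_simplex \<sigma>)" "obd c = 0"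
  show "\<exists>y\<in>ordered_chains (full_simplex \<sigma>). obd y = c - pscale (augm c) (gen [v])"
    using cone_homotopy[OF ordered_chains_lookup_Nil[OF c(1) comp], of v] c(2)
    by (intro bexI[OF _ consc_in_full_simplex[OF assms(2) c(1)]]) (simp add: consc_simps)
qed

definition prestrict :: "('a \<Rightarrow> bool) \<Rightarrow> ('a \<Rightarrow>\<^sub>0 'f::field) \<Rightarrow> 'a \<Rightarrow>\<^sub>0 'f" where
  "prestrict P = lext (\<lambda>k. if P k then gen k else 0)"

lemma plinear_prestrict: "plinear (prestrict P)" by (simp add: prestrict_def plinear_lext)

lemma lookup_prestrict: "lookup (prestrict P c) k = (if P k then lookup c k else 0)"
proof -
  have "lookup (prestrict P c) k = (\<Sum>i\<in>keys c. if i = k then (if P k then lookup c k else 0) else 0)"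
    unfolding prestrict_def lext_def lookup_sum by (intro sum.cong) (auto simp: lookup_single when_def)
  then show ?thesis by (auto simp: in_keys_iff)
qed

lemma Mayer_Vietoris_ordered_chains: "Mayer_Vietoris ordered_chains (obd :: ('a, 'f::field) chain \<Rightarrow> _)"
proof (rule Mayer_VietorisI)
  show "obd (x - y) = obd x - obd y" for x y :: "('a, 'f) chain" by (rule obd_simps)
  show "0 \<in> ordered_chains K" for K :: "'a set set" by (simp add: ordered_chains_def)
  show "obd x \<in> ordered_chains K" if "abstract_complex K" "x \<in> ordered_chains K" for K and x :: "('a, 'f) chain"
    using that by (rule obd_in_ordered_chains)
  show "x - y \<in> ordered_chains K" if "x \<in> ordered_chains K" "y \<in> ordered_chains K" for K and x y :: "('a, 'f) chain"
    using that by (rule formal.subspace_diff[OF subspace_ordered_chains])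
  show "ordered_chains {} = {0 :: ('a, 'f) chain}" by (auto simp: ordered_chains_def)
  show "\<exists>y\<in>ordered_chains K. x - y \<in> ordered_chains L" if "x \<in> ordered_chains (K \<union> L)"
    for K L :: "'a set set" and x :: "('a, 'f) chain"
    using that by (intro bexI[of _ "prestrict (\<lambda>l. set l \<in> K) x"])
      (auto simp: ordered_chains_def in_keys_iff lookup_prestrict lookup_minus split: if_splits)
qed (auto simp: obd_obd ordered_chains_def)

lemma Mayer_Vietoris_compose:
  fixes D :: "'b set set \<Rightarrow> 'v::ab_group_add set" and P :: "'a set set \<Rightarrow> 'b set set"
  assumes D: "Mayer_Vietoris D d"
    and P: "\<And>K. abstract_complex K \<Longrightarrow> abstract_complex (P K)" "P {} = {}" "\<And>K L. K \<subseteq> L \<Longrightarrow> P K \<subseteq> P L"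
      "\<And>K L. P (K \<inter> L) = P K \<inter> P L" "\<And>K L. P (K \<union> L) = P K \<union> P L"
  shows "Mayer_Vietoris (\<lambda>K. D (P K)) d"
proof (rule Mayer_VietorisI)
  note MVD = Mayer_VietorisD[OF D]
  show "D (P {}) = {0}" by (simp add: P(2) MVD(6))
  show "x \<in> D (P (K \<inter> L))" if "x \<in> D (P K)" "x \<in> D (P L)" for K L x
    unfolding P(4) using that by (rule MVD(8))
  show "\<exists>y\<in>D (P K). x - y \<in> D (P L)"
    if "abstract_complex K" "abstract_complex L" "x \<in> D (P (K \<union> L))" for K L x
    by (rule MVD(9)[OF P(1)[OF that(1)] P(1)[OF that(2)] that(3)[unfolded P(5)]])
  show "x \<in> D (P L)" if "K \<subseteq> L" "x \<in> D (P K)" for K L x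
    by (rule MVD(7)[OF P(3)[OF that(1)] that(2)])
qed (blast intro: Mayer_VietorisD(1-5)[OF D] P(1))+

lemma Mayer_Vietoris_product:
  assumes "Mayer_Vietoris D d"
  shows "abstract_complex L \<Longrightarrow> Mayer_Vietoris (\<lambda>K. D (product_complex K L)) d"
    and "abstract_complex K \<Longrightarrow> Mayer_Vietoris (\<lambda>L. D (product_complex K L)) d"
  by (rule Mayer_Vietoris_compose[OF assms];
      (simp add: abstract_complex_product; fail | unfold product_complex_def, blast))+

lemma full_simplex_vertex: "v \<in> \<sigma> \<Longrightarrow> gen [v] \<in> ordered_chains (full_simplex \<sigma>)"
  by (auto simp: gen_in_ordered_chains full_simplex_def)

lemma obd_vertex: "obd (gen [v]) = 0"
  by (simp add: obd_def aug_bd_gen augm_gen consc_simps)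

lemma obd_cross_vertex: "obd (cross (gen [v]) c) = cross (gen [v]) (obd c)"
  by (simp add: obd_cross obd_vertex cross_simps parity_sign_gen)

text \<open>
  A full simplex times \<open>L\<close> has the homology of \<open>L\<close>. Inducting over \<open>L\<close>, only the case of a product of two
  full simplices is left, which is itself a full simplex.
\<close>

lemma quasi_iso_vertex_times:
  assumes \<sigma>: "finite \<sigma>" "v \<in> \<sigma>" and L: "abstract_complex L"
  shows "quasi_iso (ordered_chains L) obd (ordered_chains (product_complex (full_simplex \<sigma>) L)) obd
    (cross (gen [v] :: _ \<Rightarrow>\<^sub>0 'f::field))"
proof (rule quasi_iso_by_Mayer_Vietoris[OF Mayer_Vietoris_ordered_chains _ _ _ _ _ L])
  note comp = abstract_complex_full_simplex[OF \<sigma>(1)]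
  show "Mayer_Vietoris (\<lambda>L. ordered_chains (product_complex (full_simplex \<sigma>) L)) obd"
    by (rule Mayer_Vietoris_product(2)[OF Mayer_Vietoris_ordered_chains comp])
  show "cross (gen [v]) (x - y) = cross (gen [v]) x - cross (gen [v]) y" for x y by (simp add: cross_simps)
  show into: "cross (gen [v]) x \<in> ordered_chains (product_complex (full_simplex \<sigma>) K)"
    if "abstract_complex K" "x \<in> ordered_chains K" for K x
    using that cross_in_product[OF comp _ full_simplex_vertex[OF \<sigma>(2)]] by blast
  show chain: "cross (gen [v]) (obd x) = obd (cross (gen [v]) x)" for x :: "('b, 'f) chain"
    by (simp add: obd_cross_vertex)
  fix \<tau> :: "'b set" assume \<tau>: "finite \<tau>" "\<tau> \<noteq> {}"
  then obtain w where w: "w \<in> \<tau>" by blast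
  have fin: "finite (\<sigma> \<times> \<tau>)" "(v, w) \<in> \<sigma> \<times> \<tau>" using \<sigma> \<tau> w by auto
  show "quasi_iso (ordered_chains (full_simplex \<tau>)) obd (ordered_chains (product_complex (full_simplex \<sigma>) (full_simplex \<tau>))) obd
    (cross (gen [v] :: _ \<Rightarrow>\<^sub>0 'f))"
  proof (rule quasi_iso_augmented_acyclic[OF augmented_acyclic_ordered_chains[OF \<tau>(1) w]])
    show "augmented_acyclic (ordered_chains (product_complex (full_simplex \<sigma>) (full_simplex \<tau>))) obd augm (gen [(v, w)])"
      unfolding product_full_simplex by (rule augmented_acyclic_ordered_chains[OF fin])
    show "plinear (cross (gen [v] :: _ \<Rightarrow>\<^sub>0 'f))" by (rule plinear_cross_right)
  qed (use into[OF abstract_complex_full_simplex[OF \<tau>(1)]] chain in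
      \<open>auto simp: augm_cross augm_gen cross_gen consc_simps\<close>)
qed

section \<open>The Kuenneth theorem\<close>

text \<open>
  The classes of the cycles \<open>z i\<close> with \<open>i \<in> A\<close> are a basis of \<open>Z / B\<close>; combinations are given by their
  coefficients, as formal sums of indices.
\<close>

definition homology_basis ::
  "('k \<Rightarrow>\<^sub>0 'f::field) set \<Rightarrow> ('k \<Rightarrow>\<^sub>0 'f) set \<Rightarrow> 'i set \<Rightarrow> ('i \<Rightarrow> 'k \<Rightarrow>\<^sub>0 'f) \<Rightarrow> bool"
where
  "homology_basis Z B A z \<longleftrightarrow> (\<forall>i\<in>A. z i \<in> Z) \<and>
     (\<forall>x\<in>Z. \<exists>a. keys a \<subseteq> A \<and> x - lext z a \<in> B) \<and>
     (\<forall>a. keys a \<subseteq> A \<longrightarrow> lext z a \<in> B \<longrightarrow> a = 0)"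

definition ordered_cycles :: "'a set set \<Rightarrow> ('a, 'f::field) chain set" where
  "ordered_cycles K = {c \<in> ordered_chains K. obd c = 0}"

definition ordered_boundaries :: "'a set set \<Rightarrow> ('a, 'f::field) chain set" where
  "ordered_boundaries K = obd ` ordered_chains K"

definition family :: "'j set \<Rightarrow> ('j \<Rightarrow> 'v::zero) \<Rightarrow> 'j \<Rightarrow>\<^sub>0 'v" where
  "family S f = Abs_poly_mapping (\<lambda>j. if j \<in> S then f j else 0)"

lemma lookup_family: "finite S \<Longrightarrow> lookup (family S f) j = (if j \<in> S then f j else 0)"
  unfolding family_def
  by (subst Poly_Mapping.lookup_Abs_poly_mapping) (auto elim: rev_finite_subset split: if_splits)

lemma keys_family: "finite S \<Longrightarrow> keys (family S f) \<subseteq> S"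
  by (auto simp: in_keys_iff lookup_family split: if_splits)

lemma lookup_map_zero: "f 0 = 0 \<Longrightarrow> lookup (Poly_Mapping.map f c) j = f (lookup c j)"
  by (auto simp: Poly_Mapping.map.rep_eq when_def)

lemma lookup_map_obd: "lookup (Poly_Mapping.map obd c) j = obd (lookup c j)"
  by (simp add: lookup_map_zero obd_simps)

text \<open>
  The direct sum of copies of the ordered chains of \<open>K\<close>, one for each index in \<open>Q\<close>. If \<open>w\<close> is a homology
  basis of \<open>L\<close> indexed by \<open>Q\<close>, this complex stands for the tensor product of the chains of \<open>K\<close> with the
  homology of \<open>L\<close>.
\<close>

definition chain_families :: "'j set \<Rightarrow> 'a set set \<Rightarrow> ('j \<Rightarrow>\<^sub>0 ('a, 'f::field) chain) set" where
  "chain_families Q K = {c. keys c \<subseteq> Q \<and> (\<forall>j. lookup c j \<in> ordered_chains K)}"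

lemma chain_families_diff:
  assumes "x \<in> chain_families Q K" "y \<in> chain_families Q K"
  shows "x - y \<in> chain_families Q K"
  using assms keys_diff[of x y] unfolding chain_families_def
  by (auto simp: lookup_minus intro!: formal.subspace_diff[OF subspace_ordered_chains])

lemma family_in_chain_families:
  assumes "finite S" "S \<subseteq> Q" "\<And>j. j \<in> S \<Longrightarrow> f j \<in> ordered_chains K"
  shows "family S f \<in> chain_families Q K"
  using assms keys_family[OF assms(1), of f] formal.subspace_0[OF subspace_ordered_chains]
  by (auto simp: chain_families_def lookup_family)

lemma Mayer_Vietoris_chain_families:
  "Mayer_Vietoris (chain_families Q) (Poly_Mapping.map (obd :: ('a, 'f::field) chain \<Rightarrow> _))"
proof (rule Mayer_VietorisI)
  note MVD = Mayer_VietorisD[OF Mayer_Vietoris_ordered_chains]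
  let ?d = "Poly_Mapping.map (obd :: ('a, 'f) chain \<Rightarrow> _)"
  show "?d (x - y) = ?d x - ?d y" for x y :: "'b \<Rightarrow>\<^sub>0 ('a, 'f) chain"
    by (rule poly_mapping_eqI) (simp add: lookup_map_obd lookup_minus obd_simps)
  show "0 \<in> chain_families Q K" for K :: "'a set set"
    by (simp add: chain_families_def formal.subspace_0[OF subspace_ordered_chains])
  show "?d x \<in> chain_families Q K" if "abstract_complex K" "x \<in> chain_families Q K" for K and x :: "'b \<Rightarrow>\<^sub>0 ('a, 'f) chain"
  proof -
    have "keys (?d x) \<subseteq> keys x" by (auto simp: in_keys_iff lookup_map_obd obd_simps)
    then show ?thesis using that by (auto simp: chain_families_def lookup_map_obd intro: obd_in_ordered_chains)
  qed
  show "?d (?d x) = 0" for x :: "'b \<Rightarrow>\<^sub>0 ('a, 'f) chain"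
    by (rule poly_mapping_eqI) (simp add: lookup_map_obd obd_obd)
  show "x - y \<in> chain_families Q K" if "x \<in> chain_families Q K" "y \<in> chain_families Q K"
    for K and x y :: "'b \<Rightarrow>\<^sub>0 ('a, 'f) chain"
    using that by (rule chain_families_diff)
  show "chain_families Q {} = {0 :: 'b \<Rightarrow>\<^sub>0 ('a, 'f) chain}"
    by (auto simp: chain_families_def MVD(6) intro!: poly_mapping_eqI)
  show "x \<in> chain_families Q L" if "K \<subseteq> L" "x \<in> chain_families Q K" for K L and x :: "'b \<Rightarrow>\<^sub>0 ('a, 'f) chain"
    using that ordered_chains_mono[OF that(1)] by (auto simp: chain_families_def)
  show "x \<in> chain_families Q (K \<inter> L)" if "x \<in> chain_families Q K" "x \<in> chain_families Q L"
    for K L and x :: "'b \<Rightarrow>\<^sub>0 ('a, 'f) chain"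
    using that by (auto simp: chain_families_def ordered_chains_def)
  show "\<exists>y\<in>chain_families Q K. x - y \<in> chain_families Q L"
    if KL: "abstract_complex K" "abstract_complex L" and x: "x \<in> chain_families Q (K \<union> L)"
    for K L and x :: "'b \<Rightarrow>\<^sub>0 ('a, 'f) chain"
  proof -
    have "\<forall>j. \<exists>y. y \<in> ordered_chains K \<and> lookup x j - y \<in> ordered_chains L"
      using MVD(9)[OF KL] x by (fastforce simp: chain_families_def)
    then obtain y where y: "\<And>j. y j \<in> ordered_chains K" "\<And>j. lookup x j - y j \<in> ordered_chains L" by metis
    let ?y = "family (keys x) y"
    have Q: "keys x \<subseteq> Q" using x by (simp add: chain_families_def)
    have "?y \<in> chain_families Q K" by (rule family_in_chain_families[OF _ Q]) (use y in auto)
    moreover have "x - ?y \<in> chain_families Q L"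
    proof -
      have "lookup (x - ?y) j \<in> ordered_chains L" for j
        using y(2)[of j] formal.subspace_0[OF subspace_ordered_chains, of L]
        by (auto simp: lookup_minus lookup_family in_keys_iff)
      moreover have "keys (x - ?y) \<subseteq> Q"
        using keys_diff[of x ?y] keys_family[of "keys x" y] Q by auto
      ultimately show ?thesis by (simp add: chain_families_def)
    qed
    ultimately show ?thesis by blast
  qed
qed

text \<open>
  Since the \<open>w j\<close> are cycles, this is a chain map from the direct sum to the chains of the product.
\<close>

definition cross_families :: "('j \<Rightarrow> ('b, 'f::field) chain) \<Rightarrow> ('j \<Rightarrow>\<^sub>0 ('a, 'f) chain) \<Rightarrow> ('a \<times> 'b, 'f) chain" where
  "cross_families w c = (\<Sum>j\<in>keys c. cross (lookup c j) (w j))"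

lemma cross_families_superset:
  "finite S \<Longrightarrow> keys c \<subseteq> S \<Longrightarrow> cross_families w c = (\<Sum>j\<in>S. cross (lookup c j) (w j))"
  unfolding cross_families_def
  by (rule sum.mono_neutral_left) (auto simp: in_keys_iff cross_simps)

lemma cross_families_diff: "cross_families w (c - d) = cross_families w c - cross_families w d"
proof -
  let ?S = "keys c \<union> keys d"
  have fin: "finite ?S" by simp
  show ?thesis
    using cross_families_superset[OF fin, of "c - d" w] cross_families_superset[OF fin, of c w]
      cross_families_superset[OF fin, of d w] keys_diff[of c d]
    by (simp add: lookup_minus cross_simps sum_subtractf)
qed

lemma cross_families_add: "cross_families w (c + d) = cross_families w c + cross_families w d"
  using cross_families_diff[of w "c + d" d] by (simp add: algebra_simps)

lemma cross_families_family:
  "finite S \<Longrightarrow> cross_families w (family S f) = (\<Sum>j\<in>S. cross (f j) (w j))"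
  by (subst cross_families_superset[of S]) (auto simp: lookup_family keys_family[THEN subsetD])

lemma obd_cross_cycle: "obd d = 0 \<Longrightarrow> obd (cross c d) = cross (obd c) d"
  by (simp add: obd_cross cross_simps)

lemma obd_cross_families:
  assumes "\<And>j. j \<in> keys c \<Longrightarrow> obd (w j) = 0"
  shows "obd (cross_families w c) = cross_families w (Poly_Mapping.map obd c)"
proof -
  have "keys (Poly_Mapping.map obd c) \<subseteq> keys c" by (auto simp: in_keys_iff lookup_map_obd obd_simps)
  then have "cross_families w (Poly_Mapping.map obd c) = (\<Sum>j\<in>keys c. cross (obd (lookup c j)) (w j))"
    by (subst cross_families_superset[of "keys c"]) (auto simp: lookup_map_obd)
  then show ?thesis using assms by (simp add: cross_families_def obd_simps obd_cross_cycle)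
qed

lemma cross_families_in_product:
  assumes K: "abstract_complex K" and L: "abstract_complex L" and c: "c \<in> chain_families Q K"
    and w: "\<And>j. j \<in> Q \<Longrightarrow> w j \<in> ordered_chains L"
  shows "cross_families w c \<in> ordered_chains (product_complex K L)"
  unfolding cross_families_def
proof (rule formal.subspace_sum[OF subspace_ordered_chains])
  fix j assume "j \<in> keys c"
  then show "cross (lookup c j) (w j) \<in> ordered_chains (product_complex K L)"
    using c w by (intro cross_in_product[OF K L]) (auto simp: chain_families_def)
qed

text \<open>
  The heart of the Kuenneth theorem, with the homology of \<open>L\<close> in place of its chains, so that no tensor
  product of complexes has to be decomposed. Inducting over \<open>K\<close>, only the case of a full simplex is
  left. There the family is homologous to a family of multiples of one vertex, and the claim
  becomes the fact that \<open>v \<times> -\<close> is a quasi-isomorphism (\<open>quasi_iso_vertex_times\<close>) and \<open>w\<close> is a basis.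
\<close>

lemma quasi_iso_cross_families:
  fixes w :: "'j \<Rightarrow> ('b, 'f::field) chain" and K :: "'a set set"
  assumes K: "abstract_complex K" and L: "abstract_complex L"
    and w: "homology_basis (ordered_cycles L) (ordered_boundaries L) Q w"
  shows "quasi_iso (chain_families Q K) (Poly_Mapping.map obd) (ordered_chains (product_complex K L)) obd
    (cross_families w)"
proof (rule quasi_iso_by_Mayer_Vietoris[OF Mayer_Vietoris_chain_families
      Mayer_Vietoris_product(1)[OF Mayer_Vietoris_ordered_chains L] cross_families_diff _ _ _ K])
  have wL: "w j \<in> ordered_chains L" "obd (w j) = 0" if "j \<in> Q" for j
    using w that by (auto simp: homology_basis_def ordered_cycles_def)
  show into: "cross_families w x \<in> ordered_chains (product_complex K L)"
    if "abstract_complex K" "x \<in> chain_families Q K" for K :: "'a set set" and x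
    using cross_families_in_product[OF that(1) L that(2)] wL(1) by blast
  show chain: "cross_families w (Poly_Mapping.map obd x) = obd (cross_families w x)"
    if "x \<in> chain_families Q K" for K :: "'a set set" and x
    by (rule obd_cross_families[symmetric]) (use wL(2) that in \<open>auto simp: chain_families_def\<close>)
  fix \<sigma> :: "'a set" assume \<sigma>: "finite \<sigma>" "\<sigma> \<noteq> {}"
  then obtain v where v: "v \<in> \<sigma>" by blast
  let ?S = "full_simplex \<sigma>"
  let ?P = "ordered_chains (product_complex ?S L) :: ('a \<times> 'b, 'f) chain set"
  have S: "abstract_complex ?S" by (rule abstract_complex_full_simplex[OF \<sigma>(1)])
  have P: "formal.subspace ?P" by (rule subspace_ordered_chains)
  have acyc: "augmented_acyclic (ordered_chains ?S) obd augm (gen [v] :: ('a, 'f) chain)"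
    by (rule augmented_acyclic_ordered_chains[OF \<sigma>(1) v])
  have vertex: "quasi_iso (ordered_chains L) obd ?P obd (cross (gen [v]))"
    by (rule quasi_iso_vertex_times[OF \<sigma>(1) v L])
  have comb: "cross (gen [v]) (lext w e) = (\<Sum>j\<in>keys e. cross (pscale (lookup e j) (gen [v])) (w j))" for e
    unfolding lext_def by (simp add: cross_simps)
  have wcycle: "lext w e \<in> ordered_chains L" "obd (lext w e) = 0" if "keys e \<subseteq> Q" for e
  proof -
    show "lext w e \<in> ordered_chains L"
      unfolding lext_def using wL(1) that
      by (intro formal.subspace_sum[OF subspace_ordered_chains] formal.subspace_scale[OF subspace_ordered_chains]) auto
    show "obd (lext w e) = 0"
      unfolding lext_def using wL(2) that by (auto simp: obd_simps intro!: sum.neutral)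
  qed
  show "quasi_iso (chain_families Q ?S) (Poly_Mapping.map obd) ?P obd (cross_families w)"
    unfolding quasi_iso_def
  proof (intro ballI impI)
    fix a b assume a: "a \<in> chain_families Q ?S" "Poly_Mapping.map obd a = 0"
      and b: "b \<in> ?P" "cross_families w a = obd b"
    have keysa: "keys a \<subseteq> Q" using a(1) by (simp add: chain_families_def)
    have "\<forall>j. \<exists>u\<in>ordered_chains ?S. obd u = lookup a j - pscale (augm (lookup a j)) (gen [v])"
    proof
      fix j
      have "obd (lookup a j) = 0" using lookup_map_obd[of a j] a(2) by simp
      then show "\<exists>u\<in>ordered_chains ?S. obd u = lookup a j - pscale (augm (lookup a j)) (gen [v])"
        using acyc a(1) by (auto simp: augmented_acyclic_def chain_families_def)
    qed
    then obtain u where u: "\<And>j. u j \<in> ordered_chains ?S"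
      "\<And>j. obd (u j) = lookup a j - pscale (augm (lookup a j)) (gen [v])" by metis
    \<comment> \<open>Component \<open>j\<close> of \<open>a\<close> is \<open>e j\<close> times the vertex \<open>v\<close>, up to the boundary of \<open>U j\<close>.\<close>
    define e where "e = family (keys a) (\<lambda>j. augm (lookup a j))"
    define U where "U = family (keys a) u"
    have ke: "keys e \<subseteq> keys a" unfolding e_def by (rule keys_family) simp
    have U: "U \<in> chain_families Q ?S" unfolding U_def by (rule family_in_chain_families[OF _ keysa]) (use u in auto)
    have PU: "cross_families w U \<in> ?P" by (rule into[OF S U])
    have obdU: "obd (cross_families w U) = cross_families w a - cross (gen [v]) (lext w e)"
    proof -
      have "obd (cross_families w U) = (\<Sum>j\<in>keys a. cross (obd (u j)) (w j))"
        unfolding U_def using wL(2) keysa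
        by (auto simp: cross_families_family obd_simps intro!: sum.cong obd_cross_cycle)
      also have "\<dots> = (\<Sum>j\<in>keys a. cross (lookup a j) (w j)) - (\<Sum>j\<in>keys a. cross (pscale (augm (lookup a j)) (gen [v])) (w j))"
        by (simp add: u(2) cross_simps sum_subtractf)
      also have "(\<Sum>j\<in>keys a. cross (pscale (augm (lookup a j)) (gen [v])) (w j)) =
          (\<Sum>j\<in>keys e. cross (pscale (lookup e j) (gen [v])) (w j))"
        using ke by (intro sum.mono_neutral_cong_right) (auto simp: e_def lookup_family in_keys_iff cross_simps)
      finally show ?thesis by (simp add: comb cross_families_def)
    qed
    \<comment> \<open>Injectivity for \<open>v \<times> -\<close> shows that \<open>e\<close> vanishes, so that \<open>a\<close> is the boundary of \<open>U\<close>.\<close>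
    let ?b = "b - cross_families w U"
    have bP: "?b \<in> ?P" using formal.subspace_diff[OF P b(1) PU] .
    have "cross (gen [v]) (lext w e) = obd ?b" using obdU b(2) by (simp add: obd_simps)
    moreover have "lext w e \<in> ordered_chains L" "obd (lext w e) = 0" using wcycle ke keysa by auto
    ultimately have "\<exists>y\<in>ordered_chains L. obd y = lext w e"
      using vertex bP unfolding quasi_iso_def by blast
    then have "lext w e \<in> ordered_boundaries L" unfolding ordered_boundaries_def by (metis image_eqI)
    then have "e = 0" using w ke keysa unfolding homology_basis_def by blast
    then have aug0: "augm (lookup a j) = 0" if "j \<in> keys a" for j
      using lookup_family[of "keys a" "\<lambda>j. augm (lookup a j)" j] that by (simp add: e_def)
    have mapU: "Poly_Mapping.map obd U = a"
    proof (rule poly_mapping_eqI)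
      fix j show "lookup (Poly_Mapping.map obd U) j = lookup a j"
        using aug0[of j] u(2)[of j] by (auto simp: lookup_map_obd U_def lookup_family obd_simps in_keys_iff)
    qed
    \<comment> \<open>Surjectivity for \<open>v \<times> -\<close> writes the remaining cycle in terms of the basis \<open>w\<close>.\<close>
    have "obd ?b = 0" using obdU b(2) \<open>e = 0\<close> by (simp add: obd_simps lext_simps cross_simps)
    moreover have "0 \<in> ordered_chains L" by (rule formal.subspace_0[OF subspace_ordered_chains])
    ultimately obtain y y' where y: "y \<in> ordered_chains L" "obd y = 0" "y' \<in> ?P" "cross (gen [v]) y - obd y' = ?b"
      using vertex bP unfolding quasi_iso_def by (metis cross_simps(9) obd_simps(3))
    then obtain f where f: "keys f \<subseteq> Q" "y - lext w f \<in> ordered_boundaries L"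
      using w unfolding homology_basis_def ordered_cycles_def by blast
    then obtain x where x: "x \<in> ordered_chains L" "obd x = y - lext w f" unfolding ordered_boundaries_def by auto
    define F where "F = family (keys f) (\<lambda>j. pscale (lookup f j) (gen [v] :: ('a, 'f) chain))"
    have F: "F \<in> chain_families Q ?S" unfolding F_def
      using f(1) full_simplex_vertex[OF v] by (intro family_in_chain_families) (auto intro: formal.subspace_scale[OF subspace_ordered_chains])
    have mapF: "Poly_Mapping.map obd F = 0"
      by (rule poly_mapping_eqI) (auto simp: lookup_map_obd F_def lookup_family obd_simps obd_vertex)
    have crossF: "cross_families w F = cross (gen [v]) (lext w f)"
      unfolding F_def by (simp add: cross_families_family comb)
    show "\<exists>a'\<in>chain_families Q ?S. \<exists>b'\<in>?P. Poly_Mapping.map obd a' = a \<and> cross_families w a' - obd b' = b"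
    proof (intro bexI conjI)
      let ?a = "U - (0 - F)"
      have 0: "0 \<in> chain_families Q ?S" by (simp add: chain_families_def formal.subspace_0[OF subspace_ordered_chains])
      show "?a \<in> chain_families Q ?S" by (intro chain_families_diff U F 0)
      show "Poly_Mapping.map obd ?a = a"
        using mapU mapF Mayer_VietorisD(1)[OF Mayer_Vietoris_chain_families, of U "0 - F"]
          Mayer_VietorisD(1)[OF Mayer_Vietoris_chain_families, of 0 F]
        by (metis Poly_Mapping.map_eq_zero_iff diff_zero keys_zero empty_iff)
      show "y' - cross (gen [v]) x \<in> ?P"
        using y(3) cross_in_product[OF S L full_simplex_vertex[OF v] x(1)] by (rule formal.subspace_diff[OF P])
      have "cross_families w ?a = cross_families w U + cross (gen [v]) (lext w f)"
        by (simp add: cross_families_add crossF)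
      moreover have "obd (y' - cross (gen [v]) x) = obd y' - cross (gen [v]) y + cross (gen [v]) (lext w f)"
        by (simp add: obd_simps obd_cross_vertex x(2) cross_simps)
      ultimately have "cross_families w ?a - obd (y' - cross (gen [v]) x)
          = cross_families w U + (cross (gen [v]) y - obd y')" by (simp only: algebra_simps)
      then show "cross_families w ?a - obd (y' - cross (gen [v]) x) = b" by (simp add: y(4))
    qed
  qed
qed

definition slice :: "'j \<Rightarrow> ('i \<times> 'j \<Rightarrow>\<^sub>0 'f::field) \<Rightarrow> 'i \<Rightarrow>\<^sub>0 'f" where
  "slice j = lext (\<lambda>(i, j'). if j' = j then gen i else 0)"

lemma lookup_slice: "lookup (slice j a) i = lookup a (i, j)"
proof -
  have "lookup (slice j a) i = (\<Sum>k\<in>keys a. if k = (i, j) then lookup a k else 0)"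
    unfolding slice_def lext_def lookup_sum by (intro sum.cong) (auto simp: lookup_single when_def split: if_splits)
  then show ?thesis by (auto simp: in_keys_iff)
qed

text \<open>
  The homology of a direct sum of copies of the chains of \<open>K\<close> is the direct sum of copies of the homology
  of \<open>K\<close>, so the homology basis \<open>z\<close> of \<open>K\<close> can be inserted in each component of
  \<open>quasi_iso_cross_families\<close>.
\<close>

theorem Kuenneth_homology_basis:
  fixes z :: "'i \<Rightarrow> ('a, 'f::field) chain" and w :: "'j \<Rightarrow> ('b, 'f) chain"
  assumes K: "abstract_complex K" and L: "abstract_complex L"
    and z: "homology_basis (ordered_cycles K) (ordered_boundaries K) P z"
    and w: "homology_basis (ordered_cycles L) (ordered_boundaries L) Q w"
  shows "homology_basis (ordered_cycles (product_complex K L)) (ordered_boundaries (product_complex K L))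
    (P \<times> Q) (\<lambda>(i, j). cross (z i) (w j))"
proof -
  let ?KL = "product_complex K L"
  let ?zw = "\<lambda>(i, j). cross (z i) (w j)"
  have zK: "z i \<in> ordered_chains K" "obd (z i) = 0" if "i \<in> P" for i
    using z that by (auto simp: homology_basis_def ordered_cycles_def)
  have wL: "w j \<in> ordered_chains L" "obd (w j) = 0" if "j \<in> Q" for j
    using w that by (auto simp: homology_basis_def ordered_cycles_def)
  note qi = quasi_iso_cross_families[OF K L w]
  show ?thesis
    unfolding homology_basis_def
  proof (intro conjI ballI allI impI)
    fix ij assume "ij \<in> P \<times> Q"
    then show "?zw ij \<in> ordered_cycles ?KL"
      using zK wL by (auto simp: ordered_cycles_def obd_cross_cycle cross_simps intro!: cross_in_product[OF K L])
  next
    fix x :: "('a \<times> 'b, 'f) chain" assume x: "x \<in> ordered_cycles ?KL"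
    have zero: "0 \<in> chain_families Q K" "Poly_Mapping.map obd (0 :: 'j \<Rightarrow>\<^sub>0 ('a, 'f) chain) = 0"
      "cross_families w 0 = 0"
      by (simp_all add: chain_families_def formal.subspace_0[OF subspace_ordered_chains] cross_families_def
          Poly_Mapping.map_eq_zero_iff)
    have "x \<in> ordered_chains ?KL" "cross_families w 0 = obd x"
      using x zero(3) by (simp_all add: ordered_cycles_def)
    from qi[unfolded quasi_iso_def, rule_format, OF zero(1) this(1) zero(2) this(2)]
    obtain t x' where t: "t \<in> chain_families Q K" "Poly_Mapping.map obd t = 0"
      "x' \<in> ordered_chains ?KL" "cross_families w t - obd x' = x"
      by blast
    have keyst: "keys t \<subseteq> Q" using t(1) by (simp add: chain_families_def)
    have "\<forall>j. \<exists>a u. keys a \<subseteq> P \<and> u \<in> ordered_chains K \<and> lookup t j - lext z a = obd u"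
    proof
      fix j
      have "obd (lookup t j) = 0" using lookup_map_obd[of t j] t(2) by simp
      then have "lookup t j \<in> ordered_cycles K" using t(1) by (simp add: ordered_cycles_def chain_families_def)
      then show "\<exists>a u. keys a \<subseteq> P \<and> u \<in> ordered_chains K \<and> lookup t j - lext z a = obd u"
        using z unfolding homology_basis_def ordered_boundaries_def by blast
    qed
    then obtain a u where au: "\<And>j. keys (a j) \<subseteq> P" "\<And>j. u j \<in> ordered_chains K"
      "\<And>j. lookup t j - lext z (a j) = obd (u j)" by metis
    define A where "A = (\<Sum>j\<in>keys t. lext (\<lambda>i. gen (i, j)) (a j))"
    have "keys (lext (\<lambda>i. gen (i, j) :: _ \<Rightarrow>\<^sub>0 'f) (a j)) \<subseteq> P \<times> Q" if "j \<in> keys t" for j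
    proof -
      have "keys (lext (\<lambda>i. gen (i, j) :: _ \<Rightarrow>\<^sub>0 'f) (a j)) \<subseteq> (\<Union>i\<in>keys (a j). keys (gen (i, j) :: _ \<Rightarrow>\<^sub>0 'f))"
        by (rule keys_lext)
      then show ?thesis using au(1)[of j] that keyst by auto
    qed
    then have keysA: "keys A \<subseteq> P \<times> Q"
      unfolding A_def by (intro order.trans[OF keys_sum] UN_least) auto
    have "lext ?zw A = (\<Sum>j\<in>keys t. cross (lext z (a j)) (w j))"
    proof -
      have "lext ?zw (lext (\<lambda>i. gen (i, j)) (a j)) = cross (lext z (a j)) (w j)" for j
        unfolding lext_lext by (simp add: lext_def cross_simps)
      then show ?thesis by (simp add: A_def lext_simps)
    qed
    also have "\<dots> = (\<Sum>j\<in>keys t. cross (lookup t j) (w j) - obd (cross (u j) (w j)))"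
    proof (rule sum.cong[OF refl])
      fix j assume "j \<in> keys t"
      then have "obd (w j) = 0" using keyst wL by auto
      moreover have "lext z (a j) = lookup t j - obd (u j)" using au(3)[of j] by (simp add: algebra_simps)
      ultimately show "cross (lext z (a j)) (w j) = cross (lookup t j) (w j) - obd (cross (u j) (w j))"
        by (simp add: obd_cross_cycle cross_simps)
    qed
    also have "\<dots> = cross_families w t - obd (\<Sum>j\<in>keys t. cross (u j) (w j))"
      by (simp add: sum_subtractf cross_families_def obd_simps)
    finally have eq: "x - lext ?zw A = obd ((\<Sum>j\<in>keys t. cross (u j) (w j)) - x')"
      using t(4) by (simp add: obd_simps algebra_simps)
    have "(\<Sum>j\<in>keys t. cross (u j) (w j)) \<in> ordered_chains ?KL"
      using keyst wL(1) au(2) by (intro formal.subspace_sum[OF subspace_ordered_chains] cross_in_product[OF K L]) auto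
    then have "x - lext ?zw A \<in> ordered_boundaries ?KL"
      unfolding eq ordered_boundaries_def using t(3) by (intro imageI formal.subspace_diff[OF subspace_ordered_chains])
    with keysA show "\<exists>a. keys a \<subseteq> P \<times> Q \<and> x - lext ?zw a \<in> ordered_boundaries ?KL" by blast
  next
    fix a assume a: "keys a \<subseteq> P \<times> Q" "lext ?zw a \<in> ordered_boundaries ?KL"
    have keys_slice: "keys (slice j a) \<subseteq> P" for j
      using a(1) by (auto simp: in_keys_iff lookup_slice)
    define J where "J = snd ` keys a"
    have J: "finite J" "J \<subseteq> Q" using a(1) by (auto simp: J_def)
    define t where "t = family J (\<lambda>j. lext z (slice j a))"
    have zs: "lext z (slice j a) \<in> ordered_chains K" "obd (lext z (slice j a)) = 0" for j
      unfolding lext_def using keys_slice[of j] zK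
      by (auto simp: obd_simps intro!: formal.subspace_sum[OF subspace_ordered_chains]
            formal.subspace_scale[OF subspace_ordered_chains] sum.neutral)
    have t: "t \<in> chain_families Q K" "Poly_Mapping.map obd t = 0"
      unfolding t_def using zs J
      by (auto intro!: family_in_chain_families poly_mapping_eqI simp: lookup_map_obd lookup_family obd_simps)
    have zslice: "lext z (slice j a) = (\<Sum>(i, j')\<in>keys a. if j' = j then pscale (lookup a (i, j')) (z i) else 0)" for j
    proof -
      have "lext z (slice j a) = lext (\<lambda>(i, j'). if j' = j then z i else 0) a"
        unfolding slice_def lext_lext by (intro lext_cong) (auto simp: lext_simps)
      then show ?thesis unfolding lext_def by (auto intro!: sum.cong)
    qed
    have "cross_families w t = (\<Sum>j\<in>J. cross (lext z (slice j a)) (w j))"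
      unfolding t_def by (rule cross_families_family[OF J(1)])
    also have "\<dots> = (\<Sum>j\<in>J. \<Sum>(i, j')\<in>keys a. if j' = j then cross (pscale (lookup a (i, j')) (z i)) (w j') else 0)"
      unfolding zslice cross_simps by (auto intro!: sum.cong simp: cross_simps)
    also have "\<dots> = (\<Sum>(i, j')\<in>keys a. \<Sum>j\<in>J. if j' = j then cross (pscale (lookup a (i, j')) (z i)) (w j') else 0)"
      by (subst sum.swap) (simp add: case_prod_beta)
    also have "\<dots> = lext ?zw a"
      unfolding lext_def
    proof (rule sum.cong[OF refl])
      fix k assume "k \<in> keys a"
      then obtain i j where k: "k = (i, j)" "j \<in> J" by (cases k) (force simp: J_def)
      show "(case k of (i, j') \<Rightarrow> \<Sum>j\<in>J. if j' = j then cross (pscale (lookup a (i, j')) (z i)) (w j') else 0)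
          = pscale (lookup a k) (?zw k)"
        using k J(1) by (simp add: cross_simps)
    qed
    finally have "cross_families w t \<in> ordered_boundaries ?KL" using a(2) by simp
    then obtain b where b: "b \<in> ordered_chains ?KL" "cross_families w t = obd b" unfolding ordered_boundaries_def by blast
    from qi[unfolded quasi_iso_def, rule_format, OF t(1) b(1) t(2) b(2)]
    obtain u where u: "u \<in> chain_families Q K" "Poly_Mapping.map obd u = t" by blast
    have "slice j a = 0" if "j \<in> J" for j
    proof -
      have "lext z (slice j a) = obd (lookup u j)"
        using lookup_map_obd[of u j] that by (simp add: u(2) t_def lookup_family[OF J(1)])
      then have "lext z (slice j a) \<in> ordered_boundaries K"
        using u(1) by (auto simp: ordered_boundaries_def chain_families_def)
      then show ?thesis using z keys_slice unfolding homology_basis_def by blast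
    qed
    then have J0: "lookup a (i, j) = 0" if "j \<in> J" for i j using that lookup_slice[of j a i] by simp
    show "a = 0"
    proof (rule poly_mapping_eqI)
      fix k show "lookup a k = lookup 0 k"
        using J0[of "snd k" "fst k"] by (cases "k \<in> keys a") (auto simp: J_def in_keys_iff)
    qed
  qed
qed

section \<open>Comparison with oriented chains\<close>

lemma elementary_chain_eq_0:
  assumes "\<And>\<pi>. \<pi> permutes {..<length vs} \<Longrightarrow> permute_list \<pi> vs \<noteq> ws"
  shows "elementary_chain vs ws = 0"
proof -
  have "{\<pi>. \<pi> permutes {..<length vs} \<and> permute_list \<pi> vs = ws} = {}" using assms by blast
  then show ?thesis by (simp only: elementary_chain_def sum.empty)
qed

lemma elementary_chain_permuted:
  fixes vs :: "'a list"
  assumes "elementary_chain vs ws \<noteq> (0 :: 'f::field)"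
  obtains \<pi> where "\<pi> permutes {..<length vs}" "permute_list \<pi> vs = ws"
  using assms elementary_chain_eq_0 by blast

lemma permutation_permutes: "\<pi> permutes {..<n::nat} \<Longrightarrow> permutation \<pi>"
  by (rule permutes_imp_permutation) auto

text \<open>
  A permutation carries \<open>vs\<close> to \<open>ws\<close> if and only if its inverse, which has the same sign, carries \<open>ws\<close> to \<open>vs\<close>.
\<close>

lemma elementary_chain_commute: "elementary_chain vs ws = (elementary_chain ws vs :: 'f::field)"
proof (cases "length vs = length ws")
  case False
  then have "permute_list \<pi> vs \<noteq> ws" "permute_list \<pi> ws \<noteq> vs" for \<pi> by (metis length_permute_list)+
  then show ?thesis by (simp add: elementary_chain_eq_0)
next
  case True
  have inverse: "permute_list (inv_into UNIV \<pi>) us = xs"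
    if "\<pi> permutes {..<length xs}" "permute_list \<pi> xs = us" for \<pi> and us xs :: "'a list"
  proof -
    have "permute_list (inv_into UNIV \<pi>) us = permute_list (\<pi> \<circ> inv_into UNIV \<pi>) xs"
      unfolding that(2)[symmetric] by (rule permute_list_compose[OF permutes_inv[OF that(1)], symmetric])
    then show ?thesis by (simp add: permutes_inv_o[OF that(1)])
  qed
  show ?thesis
    unfolding elementary_chain_def
    by (rule sum.reindex_bij_witness[of _ "inv_into UNIV" "inv_into UNIV"])
      (use True inverse in \<open>auto simp: permutes_inv permutes_inv_inv sign_inverse permutation_permutes\<close>)
qed

lemma elementary_chain_permute_list:
  assumes \<tau>: "\<tau> permutes {..<length ws}"
  shows "elementary_chain vs (permute_list \<tau> ws) = (of_int (sign \<tau>) * elementary_chain vs ws :: 'f::field)"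
proof (cases "length vs = length ws")
  case False
  then have "permute_list \<pi> vs \<noteq> ws" "permute_list \<pi> vs \<noteq> permute_list \<tau> ws" for \<pi>
    by (metis length_permute_list)+
  then show ?thesis by (simp add: elementary_chain_eq_0)
next
  case True
  have \<tau>': "\<tau> permutes {..<length vs}" using \<tau> True by simp
  show ?thesis
    unfolding elementary_chain_def sum_distrib_left
  proof (rule sum.reindex_bij_witness[of _ "\<lambda>\<pi>. \<pi> \<circ> \<tau>" "\<lambda>\<pi>. \<pi> \<circ> inv_into UNIV \<tau>"])
    fix \<pi> assume "\<pi> \<in> {\<pi>. \<pi> permutes {..<length vs} \<and> permute_list \<pi> vs = permute_list \<tau> ws}"
    then have \<pi>: "\<pi> permutes {..<length vs}" "permute_list \<pi> vs = permute_list \<tau> ws" by auto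
    show "\<pi> \<circ> inv_into UNIV \<tau> \<circ> \<tau> = \<pi>" by (simp add: o_assoc[symmetric] permutes_inv_o[OF \<tau>])
    have "permute_list (\<pi> \<circ> inv_into UNIV \<tau>) vs = permute_list (inv_into UNIV \<tau>) (permute_list \<tau> ws)"
      using permute_list_compose[OF permutes_inv[OF \<tau>']] \<pi>(2) by metis
    also have "\<dots> = permute_list (\<tau> \<circ> inv_into UNIV \<tau>) ws" by (rule permute_list_compose[OF permutes_inv[OF \<tau>], symmetric])
    finally have "permute_list (\<pi> \<circ> inv_into UNIV \<tau>) vs = ws" by (simp add: permutes_inv_o[OF \<tau>])
    then show "\<pi> \<circ> inv_into UNIV \<tau> \<in> {\<pi>. \<pi> permutes {..<length vs} \<and> permute_list \<pi> vs = ws}"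
      using permutes_compose[OF permutes_inv[OF \<tau>'] \<pi>(1)] by simp
    have "sign (\<pi> \<circ> inv_into UNIV \<tau>) = sign \<pi> * sign \<tau>"
      using sign_compose[of \<pi> "inv_into UNIV \<tau>"] sign_inverse[of \<tau>] permutation_inverse[of \<tau>]
        permutation_permutes[OF \<pi>(1)] permutation_permutes[OF \<tau>] by simp
    then show "of_int (sign \<tau>) * of_int (sign (\<pi> \<circ> inv_into UNIV \<tau>)) = (of_int (sign \<pi>) :: 'f)"
      by (cases \<tau> rule: sign_cases) auto
  next
    fix \<pi> assume "\<pi> \<in> {\<pi>. \<pi> permutes {..<length vs} \<and> permute_list \<pi> vs = ws}"
    then have \<pi>: "\<pi> permutes {..<length vs}" "permute_list \<pi> vs = ws" by auto
    show "\<pi> \<circ> \<tau> \<circ> inv_into UNIV \<tau> = \<pi>" by (simp add: o_assoc[symmetric] permutes_inv_o[OF \<tau>])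
    show "\<pi> \<circ> \<tau> \<in> {\<pi>. \<pi> permutes {..<length vs} \<and> permute_list \<pi> vs = permute_list \<tau> ws}"
      using permutes_compose[OF \<tau>' \<pi>(1)] permute_list_compose[OF \<tau>', of \<pi>] \<pi>(2) by simp
  qed
qed

text \<open>
  Composing with the transposition of two equal entries pairs the permutations that contribute \<open>1\<close> with
  those that contribute \<open>- 1\<close>. In characteristic 2 antisymmetry alone would not give this.
\<close>

lemma elementary_chain_not_distinct:
  assumes "\<not> distinct vs"
  shows "elementary_chain vs ws = (0 :: 'f::field)"
proof -
  obtain i j where ij: "i < length vs" "j < length vs" "i \<noteq> j" "vs ! i = vs ! j"
    using assms by (auto simp: distinct_conv_nth)
  let ?t = "Transposition.transpose i j"
  let ?S = "{\<pi>. \<pi> permutes {..<length vs} \<and> permute_list \<pi> vs = ws}"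
  have t: "?t permutes {..<length vs}" using ij by (intro permutes_swap_id) auto
  have fix_t: "permute_list ?t vs = vs"
    by (rule nth_equalityI) (use ij in \<open>auto simp: permute_list_nth[OF t] Transposition.transpose_def\<close>)
  have tt: "?t \<circ> ?t = id" by simp
  have step: "?t \<circ> \<pi> \<in> ?S \<and> sign (?t \<circ> \<pi>) = - sign \<pi>" if "\<pi> \<in> ?S" for \<pi>
  proof -
    have \<pi>: "\<pi> permutes {..<length vs}" "permute_list \<pi> vs = ws" using that by auto
    have "permute_list (?t \<circ> \<pi>) vs = ws" using permute_list_compose[OF \<pi>(1), of ?t] fix_t \<pi>(2) by simp
    moreover have "sign (?t \<circ> \<pi>) = - sign \<pi>"
      using sign_compose[OF permutation_permutes[OF t] permutation_permutes[OF \<pi>(1)]] ij(3) by (simp add: sign_swap_id)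
    ultimately show ?thesis using permutes_compose[OF \<pi>(1) t] by simp
  qed
  have fin: "finite ?S" by (rule finite_subset[OF _ finite_permutations[of "{..<length vs}"]]) auto
  have "(\<Sum>\<pi>\<in>?S \<inter> {\<pi>. sign \<pi> = - 1}. of_int (sign \<pi>) :: 'f) = (\<Sum>\<pi>\<in>?S \<inter> {\<pi>. sign \<pi> = 1}. - of_int (sign \<pi>))"
    by (rule sum.reindex_bij_witness[of _ "\<lambda>\<pi>. ?t \<circ> \<pi>" "\<lambda>\<pi>. ?t \<circ> \<pi>"])
      (use step tt in \<open>auto simp: o_assoc\<close>)
  moreover have "elementary_chain vs ws = (\<Sum>\<pi>\<in>?S \<inter> {\<pi>. sign \<pi> = 1}. of_int (sign \<pi>))
      + (\<Sum>\<pi>\<in>?S \<inter> {\<pi>. sign \<pi> = - 1}. of_int (sign \<pi>) :: 'f)"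
  proof -
    have "sign \<pi> = 1 \<or> sign \<pi> = - 1" for \<pi> :: "nat \<Rightarrow> nat" by (cases \<pi> rule: sign_cases) auto
    then have "?S - {\<pi>. sign \<pi> = 1} = ?S \<inter> {\<pi>. sign \<pi> = - 1}" by auto
    then show ?thesis
      unfolding elementary_chain_def by (subst sum.Int_Diff[OF fin, of _ "{\<pi>. sign \<pi> = 1}"]) simp
  qed
  ultimately show ?thesis by (simp add: sum_negf)
qed

lemma elementary_chain_distinct:
  assumes "distinct vs" and \<pi>: "\<pi> permutes {..<length vs}"
  shows "elementary_chain vs (permute_list \<pi> vs) = (of_int (sign \<pi>) :: 'f::field)"
proof -
  have "{\<sigma>. \<sigma> permutes {..<length vs} \<and> permute_list \<sigma> vs = vs} = {id}"
  proof -
    have "\<sigma> = id" if "\<sigma> permutes {..<length vs}" "permute_list \<sigma> vs = vs" for \<sigma>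
    proof
      fix i show "\<sigma> i = id i"
      proof (cases "i < length vs")
        case True
        then have "vs ! \<sigma> i = vs ! i" "\<sigma> i < length vs"
          using permute_list_nth[OF that(1) True] that(2) permutes_in_image[OF that(1)] by auto
        then show ?thesis using nth_eq_iff_index_eq[OF assms(1)] True by auto
      next
        case False then show ?thesis using permutes_not_in[OF that(1)] by auto
      qed
    qed
    then show ?thesis by (auto simp: permutes_id)
  qed
  then have "elementary_chain vs vs = (1 :: 'f)" by (simp add: elementary_chain_def sign_id)
  then show ?thesis using elementary_chain_permute_list[OF \<pi>, of vs, where ?'f = 'f] by simp
qed

text \<open>
  Laplace expansion: the permutations that carry \<open>ws\<close> to \<open>v # us\<close> are sorted by the position \<open>i\<close> from which
  \<open>v\<close> is taken. It shows that the cone of an elementary chain only depends on that elementary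
  chain.
\<close>

lemma elementary_chain_Cons:
  "elementary_chain (v # us) ws =
    (\<Sum>i<length ws. if ws ! i = v then (- 1) ^ i * elementary_chain us (take i ws @ drop (Suc i) ws) else 0 :: 'f::field)"
proof (cases "length ws")
  case 0
  then show ?thesis using elementary_chain_eq_0[of "v # us" ws] by (auto simp: permute_list_def)
next
  case (Suc n)
  let ?N = "{0..<Suc n}"
  let ?wi = "\<lambda>i. take i ws @ drop (Suc i) ws"
  let ?s = "\<lambda>\<pi>. of_int (sign \<pi>) :: 'f"
  let ?S = "{\<pi>. \<pi> permutes ?N \<and> permute_list \<pi> ws = v # us}"
  have fin: "finite ?S" by (rule finite_subset[OF _ finite_permutations[of ?N]]) auto
  have "elementary_chain (v # us) ws = (\<Sum>\<pi>\<in>?S. ?s \<pi>)"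
    by (subst elementary_chain_commute) (simp only: elementary_chain_def Suc lessThan_atLeast0)
  also have "\<dots> = (\<Sum>i\<in>?N. \<Sum>\<pi> | \<pi> \<in> ?S \<and> \<pi> 0 = i. ?s \<pi>)"
    by (rule sum.group[symmetric]) (use fin permutes_in_image in fastforce)+
  also have "\<dots> = (\<Sum>i\<in>?N. if ws ! i = v then (- 1) ^ i * elementary_chain us (?wi i) else 0)"
  proof (rule sum.cong[OF refl])
    fix i assume "i \<in> ?N"
    then have i: "i < Suc n" by simp
    let ?Q = "{q. q permutes {0..<n} \<and> permute_list q (?wi i) = us}"
    have len: "length (?wi i) = n" using i Suc by simp
    have "{\<pi>. \<pi> \<in> ?S \<and> \<pi> 0 = i} = {\<pi> \<in> permutation_insert 0 i ` {q. q permutes {0..<n}}. permute_list \<pi> ws = v # us}"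
      using permutation_fix[of 0 n i] i by auto
    also have "\<dots> = (if ws ! i = v then permutation_insert 0 i ` ?Q else {})"
      using permute_list_insert[OF _ i Suc] by auto
    finally have eq: "{\<pi>. \<pi> \<in> ?S \<and> \<pi> 0 = i} = (if ws ! i = v then permutation_insert 0 i ` ?Q else {})" .
    have inj: "inj_on (permutation_insert 0 i) ?Q"
      by (rule inj_on_subset[OF permutation_insert_inj_on[of 0 n i]]) (use i in auto)
    have "(\<Sum>\<pi>\<in>permutation_insert 0 i ` ?Q. ?s \<pi>) = (\<Sum>q\<in>?Q. (- 1) ^ i * ?s q)"
      using signof_permutation_insert[of _ n 0 i] i by (auto simp: sum.reindex[OF inj] intro!: sum.cong)
    also have "\<dots> = (- 1) ^ i * elementary_chain us (?wi i)"
      by (subst elementary_chain_commute) (simp only: elementary_chain_def len lessThan_atLeast0 sum_distrib_left)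
    finally show "(\<Sum>\<pi> | \<pi> \<in> ?S \<and> \<pi> 0 = i. ?s \<pi>) = (if ws ! i = v then (- 1) ^ i * elementary_chain us (?wi i) else 0)"
      unfolding eq by simp
  qed
  finally show ?thesis by (simp only: Suc lessThan_atLeast0)
qed

text \<open>
  The chain \<open>elementary_chain vs\<close> as a formal sum; in particular it is 0 if a vertex repeats.
\<close>

definition orient_list :: "'a list \<Rightarrow> ('a, 'f::field) chain" where
  "orient_list vs = (\<Sum>\<pi> | \<pi> permutes {..<length vs}. pscale (of_int (sign \<pi>)) (gen (permute_list \<pi> vs)))"

definition orient :: "('a, 'f::field) chain \<Rightarrow> ('a, 'f) chain" where
  "orient = lext orient_list"

definition oriented_bd :: "('a, 'f::field) chain \<Rightarrow> ('a, 'f) chain" where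
  "oriented_bd = lext (\<lambda>l. if tl l = [] then 0 else gen (tl l))"

definition alternating_chains :: "'a set set \<Rightarrow> ('a, 'f::field) chain set" where
  "alternating_chains K = {c. (\<forall>l\<in>keys c. distinct l \<and> set l \<in> K) \<and>
     (\<forall>l \<pi>. \<pi> permutes {..<length l} \<longrightarrow> lookup c (permute_list \<pi> l) = of_int (sign \<pi>) * lookup c l)}"

lemma plinear_orient: "plinear orient" by (simp add: orient_def plinear_lext)
lemma plinear_oriented_bd: "plinear oriented_bd" by (simp add: oriented_bd_def plinear_lext)
lemmas orient_simps = plinear_simps[OF plinear_orient]
lemmas oriented_bd_simps = plinear_simps[OF plinear_oriented_bd]

lemma lookup_orient_list: "lookup (orient_list vs) = elementary_chain vs"
proof
  fix ws
  have fin: "finite {\<pi>. \<pi> permutes {..<length vs}}" by (simp add: finite_permutations)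
  have "lookup (orient_list vs) ws = (\<Sum>\<pi> | \<pi> permutes {..<length vs}. if permute_list \<pi> vs = ws then of_int (sign \<pi>) else 0)"
    unfolding orient_list_def lookup_sum by (intro sum.cong) (auto simp: lookup_single when_def)
  also have "\<dots> = elementary_chain vs ws"
    unfolding elementary_chain_def using fin by (subst sum.inter_filter[symmetric]) auto
  finally show "lookup (orient_list vs) ws = elementary_chain vs ws" .
qed

lemma lookup_orient: "lookup (orient c) ws = (\<Sum>vs\<in>keys c. lookup c vs * elementary_chain vs ws)"
  by (simp add: orient_def lext_def lookup_sum lookup_orient_list)

lemma orient_gen: "orient (gen vs) = orient_list vs" by (simp add: orient_def)

text \<open>
  The coefficient of a face in \<open>boundary\<close> is the sum over all simplices that extend it in front, so \<open>boundary\<close>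
  simply deletes the first vertex of each list.
\<close>

lemma lookup_oriented_bd: "lookup (oriented_bd c) = boundary (lookup c)"
proof
  fix ws
  have *: "lookup (oriented_bd c) ws = (\<Sum>l\<in>keys c. if tl l = ws \<and> ws \<noteq> [] then lookup c l else 0)"
    unfolding oriented_bd_def lext_def lookup_sum by (intro sum.cong) (auto simp: lookup_single when_def)
  show "lookup (oriented_bd c) ws = boundary (lookup c) ws"
  proof (cases "ws = []")
    case True then show ?thesis using * by (simp add: boundary_def)
  next
    case False
    have "{l \<in> keys c. tl l = ws \<and> ws \<noteq> []} = (\<lambda>v. v # ws) ` {v. lookup c (v # ws) \<noteq> 0}"
      using False by (auto simp: in_keys_iff image_iff) (metis list.collapse list.sel(2))
    then have "lookup (oriented_bd c) ws = (\<Sum>l\<in>(\<lambda>v. v # ws) ` {v. lookup c (v # ws) \<noteq> 0}. lookup c l)"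
      by (simp add: * sum.inter_filter[symmetric])
    also have "\<dots> = (\<Sum>v | lookup c (v # ws) \<noteq> 0. lookup c (v # ws))"
      by (subst sum.reindex) (auto simp: inj_on_def)
    finally show ?thesis using False by (simp add: boundary_def)
  qed
qed

lemma aug_face_sum: "aug_face vs = (\<Sum>i<length vs. pscale ((- 1) ^ i) (gen (take i vs @ drop (Suc i) vs)))"
  by (induction vs) (auto simp: sum.lessThan_Suc_shift consc_simps sum_negf simp del: sum.lessThan_Suc)

lemma oriented_bd_orient: "oriented_bd (orient c) = orient (obd c)"
proof (rule plinear_eqI[where f = "\<lambda>c. oriented_bd (orient c)"])
  show "plinear (\<lambda>c. oriented_bd (orient c))" by (rule plinear_compose[OF plinear_oriented_bd plinear_orient])
  show "plinear (\<lambda>c. orient (obd c))" by (rule plinear_compose[OF plinear_orient plinear_obd])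
  fix vs :: "'a list"
  show "oriented_bd (orient (gen vs)) = orient (obd (gen vs) :: ('a, 'b) chain)"
  proof (cases "length vs \<ge> 2")
    case True
    have "obd (gen vs) = (\<Sum>i<length vs. pscale ((- 1) ^ i) (gen (take i vs @ drop (Suc i) vs)) :: ('a, 'b) chain)"
      using True by (simp add: obd_def augm_gen aug_bd_gen aug_face_sum)
    then show ?thesis
      by (intro poly_mapping_eqI) (simp add: lookup_oriented_bd orient_gen lookup_orient_list
          boundary_elementary_chain[OF True] orient_simps lookup_sum)
  next
    case False
    have "obd (gen vs :: ('a, 'b) chain) = 0"
      using False by (cases vs) (auto simp: obd_def augm_gen aug_bd_gen consc_simps Suc_le_eq)
    moreover have "oriented_bd (orient_list vs :: ('a, 'b) chain) = 0"
    proof -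
      have "tl (permute_list \<pi> vs) = []" for \<pi>
        using False length_tl[of "permute_list \<pi> vs"] by (simp flip: length_0_conv)
      then show ?thesis by (simp add: orient_list_def oriented_bd_simps) (simp add: oriented_bd_def)
    qed
    ultimately show ?thesis by (simp add: orient_gen orient_simps)
  qed
qed

lemma orient_in_alternating_chains:
  assumes "c \<in> ordered_chains K" shows "orient c \<in> alternating_chains K"
  unfolding alternating_chains_def
proof (intro CollectI conjI ballI allI impI)
  fix ws assume "ws \<in> keys (orient c)"
  then have "(\<Sum>vs\<in>keys c. lookup c vs * elementary_chain vs ws) \<noteq> 0" by (simp add: in_keys_iff lookup_orient)
  then obtain vs where vs: "vs \<in> keys c" "elementary_chain vs ws \<noteq> (0::'b)"
    by (auto elim!: sum.not_neutral_contains_not_neutral)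
  then have "distinct vs" using elementary_chain_not_distinct by blast
  moreover obtain \<pi> where "\<pi> permutes {..<length vs}" "permute_list \<pi> vs = ws"
    using elementary_chain_permuted[OF vs(2)] .
  ultimately show "distinct ws" "set ws \<in> K" using assms vs(1) by (auto simp: ordered_chains_def)
qed (simp add: lookup_orient elementary_chain_permute_list sum_distrib_left mult.left_commute)

text \<open>
  For each simplex choose one list \<open>r \<sigma>\<close> of its vertices in the support, and keep only the coefficients
  of the chosen lists: antisymmetrization recovers the others.
\<close>

lemma alternating_chain_is_oriented:
  fixes c :: "('a, 'f::field) chain"
  assumes c: "c \<in> alternating_chains K"
  obtains x where "x \<in> ordered_chains K" "orient x = c" "keys x \<subseteq> keys c"
proof -
  define r where "r \<sigma> = (SOME l. l \<in> keys c \<and> set l = \<sigma>)" for \<sigma>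
  have r: "r (set l) \<in> keys c" "set (r (set l)) = set l" if "l \<in> keys c" for l
    using someI[of "\<lambda>l'. l' \<in> keys c \<and> set l' = set l" l] that by (auto simp: r_def)
  define x where "x = prestrict (\<lambda>l. l = r (set l)) c"
  have lx: "lookup x l = (if l = r (set l) then lookup c l else 0)" for l by (simp add: x_def lookup_prestrict)
  have kx: "keys x = {l \<in> keys c. l = r (set l)}" by (auto simp: in_keys_iff lx split: if_splits)
  have dist: "distinct l" "set l \<in> K" if "l \<in> keys c" for l
    using c that unfolding alternating_chains_def by blast+
  have alt: "lookup c (permute_list \<pi> l) = of_int (sign \<pi>) * lookup c l" if "\<pi> permutes {..<length l}" for l \<pi>
    using c that unfolding alternating_chains_def by blast
  have term_eq: "lookup c l * elementary_chain l ws = (if set l = set ws then lookup c ws else 0)"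
    if l: "l \<in> keys c" and ws: "ws \<in> keys c" for l ws
  proof (cases "set l = set ws")
    case True
    then have "mset l = mset ws" using dist[OF l] dist[OF ws] by (simp add: set_eq_iff_mset_eq_distinct)
    then obtain \<pi> where \<pi>: "\<pi> permutes {..<length l}" "permute_list \<pi> l = ws"
      using mset_eq_permutation[of ws l] by metis
    then show ?thesis
      using alt[OF \<pi>(1)] elementary_chain_distinct[OF dist(1)[OF l] \<pi>(1), where ?'f = 'f] True by auto
  next
    case False
    then have "elementary_chain l ws = (0::'f)"
      by (metis elementary_chain_permuted set_permute_list)
    then show ?thesis using False by simp
  qed
  have "orient x = c"
  proof (rule poly_mapping_eqI)
    fix ws
    have eq: "lookup (orient x) ws = (\<Sum>l\<in>keys x. lookup c l * elementary_chain l ws)"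
      unfolding lookup_orient by (intro sum.cong) (auto simp: kx lx)
    show "lookup (orient x) ws = lookup c ws"
    proof (cases "ws \<in> keys c")
      case True
      have "lookup (orient x) ws = (\<Sum>l\<in>keys x. if l = r (set ws) then lookup c ws else 0)"
        unfolding eq
      proof (rule sum.cong[OF refl])
        fix l assume "l \<in> keys x"
        then have "l \<in> keys c" "l = r (set l)" by (auto simp: kx)
        then show "lookup c l * elementary_chain l ws = (if l = r (set ws) then lookup c ws else 0)"
          using term_eq[OF _ True, of l] r(2)[OF True] by metis
      qed
      also have "\<dots> = lookup c ws" using r[OF True] by (simp add: kx)
      finally show ?thesis .
    next
      case False
      have "elementary_chain l ws = (0::'f)" if "l \<in> keys c" for l
      proof (rule ccontr)
        assume "elementary_chain l ws \<noteq> (0::'f)"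
        then obtain \<pi> where "\<pi> permutes {..<length l}" "permute_list \<pi> l = ws"
          by (rule elementary_chain_permuted)
        then have "lookup c ws = of_int (sign \<pi>) * lookup c l" using alt by metis
        moreover have "of_int (sign \<pi>) \<noteq> (0::'f)" by (cases \<pi> rule: sign_cases) auto
        ultimately show False using that False by (simp add: in_keys_iff)
      qed
      then show ?thesis using False by (simp add: eq kx in_keys_iff)
    qed
  qed
  moreover have "x \<in> ordered_chains K" using dist by (auto simp: ordered_chains_def kx)
  ultimately show ?thesis using that kx by blast
qed

text \<open>
  Hence the cone operator of ordered chains descends to oriented chains, where it makes full simplices
  acyclic.
\<close>

lemma orient_consc_eq_0:
  assumes "orient x = 0" shows "orient (consc v x) = 0"
proof -
  have lk: "lookup (orient (consc v x)) ws = (\<Sum>us\<in>keys x. lookup x us * elementary_chain (v # us) ws)" for ws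
    by (simp add: consc_def orient_def lext_lext) (simp add: lext_def lookup_sum lookup_orient_list)
  show ?thesis
  proof (rule poly_mapping_eqI)
    fix ws
    have "lookup (orient (consc v x)) ws = (\<Sum>i<length ws. \<Sum>us\<in>keys x.
        if ws ! i = v then (- 1) ^ i * (lookup x us * elementary_chain us (take i ws @ drop (Suc i) ws)) else 0)"
      unfolding lk elementary_chain_Cons sum_distrib_left
      by (subst sum.swap) (auto intro!: sum.cong simp: mult.left_commute)
    also have "\<dots> = (\<Sum>i<length ws. if ws ! i = v then (- 1) ^ i * lookup (orient x) (take i ws @ drop (Suc i) ws) else 0)"
      by (intro sum.cong refl) (simp add: lookup_orient sum_distrib_left)
    finally show "lookup (orient (consc v x)) ws = lookup 0 ws" by (simp add: assms)
  qed
qed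

lemma alternating_chain_orientE:
  assumes "c \<in> alternating_chains K"
  obtains x where "x \<in> ordered_chains K" "c = orient x"
  using alternating_chain_is_oriented[OF assms] by metis

lemma oriented_bd_in_alternating_chains:
  assumes "abstract_complex K" "c \<in> alternating_chains K"
  shows "oriented_bd c \<in> alternating_chains K" "oriented_bd (oriented_bd c) = 0"
  using assms(2)
  by (elim alternating_chain_orientE; simp add: oriented_bd_orient obd_obd orient_simps
      orient_in_alternating_chains obd_in_ordered_chains[OF assms(1)])+

lemma subspace_alternating_chains: "formal.subspace (alternating_chains K :: ('a, 'f::field) chain set)"
  unfolding formal.subspace_def
proof (intro conjI ballI allI)
  show "0 \<in> alternating_chains K" by (simp add: alternating_chains_def)
next
  fix x y :: "('a, 'f) chain" assume "x \<in> alternating_chains K" "y \<in> alternating_chains K"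
  then show "x + y \<in> alternating_chains K"
    using keys_add[of x y] by (auto simp: alternating_chains_def lookup_add distrib_left)
next
  fix a and x :: "('a, 'f) chain" assume "x \<in> alternating_chains K"
  then show "pscale a x \<in> alternating_chains K"
    using keys_pscale[of a x] by (auto simp: alternating_chains_def mult.left_commute)
qed

lemma Mayer_Vietoris_alternating_chains:
  "Mayer_Vietoris alternating_chains (oriented_bd :: ('a, 'f::field) chain \<Rightarrow> _)"
proof (rule Mayer_VietorisI)
  show "oriented_bd (x - y) = oriented_bd x - oriented_bd y" for x y :: "('a, 'f) chain" by (rule oriented_bd_simps)
  show "0 \<in> alternating_chains K" for K :: "'a set set" by (rule formal.subspace_0[OF subspace_alternating_chains])
  show "x - y \<in> alternating_chains K" if "x \<in> alternating_chains K" "y \<in> alternating_chains K" for K and x y :: "('a, 'f) chain"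
    using that by (rule formal.subspace_diff[OF subspace_alternating_chains])
  show "alternating_chains {} = {0 :: ('a, 'f) chain}" by (auto simp: alternating_chains_def)
  show "x \<in> alternating_chains L" if "K \<subseteq> L" "x \<in> alternating_chains K" for K L and x :: "('a, 'f) chain"
    using that by (auto simp: alternating_chains_def)
  show "x \<in> alternating_chains (K \<inter> L)" if "x \<in> alternating_chains K" "x \<in> alternating_chains L" for K L and x :: "('a, 'f) chain"
    using that by (auto simp: alternating_chains_def)
  show "\<exists>y\<in>alternating_chains K. x - y \<in> alternating_chains L" if "x \<in> alternating_chains (K \<union> L)"
    for K L :: "'a set set" and x :: "('a, 'f) chain"
    using that by (intro bexI[of _ "prestrict (\<lambda>l. set l \<in> K) x"])
      (auto simp: alternating_chains_def in_keys_iff lookup_prestrict lookup_minus split: if_splits)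
qed (blast intro: oriented_bd_in_alternating_chains)+

lemma augm_orient: "augm (orient c) = augm (c :: ('a, 'f::field) chain)"
proof -
  have list: "augm (orient_list vs) = (augm (gen vs) :: 'f)" for vs :: "'a list"
  proof (cases "length vs = 1")
    case True
    then have "{\<pi>. \<pi> permutes {..<length vs}} = {id}" by (simp add: lessThan_Suc)
    then show ?thesis by (simp add: orient_list_def sign_id)
  next
    case False
    then show ?thesis by (simp add: orient_list_def augm_simps augm_gen)
  qed
  have "augm (orient c) = (\<Sum>k\<in>keys c. lookup c k * augm (gen k))"
    by (simp add: orient_def lext_def augm_simps list)
  also have "\<dots> = augm (lext gen c)" unfolding lext_def[of gen] by (simp add: augm_simps)
  finally show ?thesis by simp
qed

lemma orient_vertex: "orient (gen [v]) = gen [v]"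
proof -
  have "{\<pi>. \<pi> permutes {..<Suc 0}} = {id}" by (simp add: lessThan_Suc)
  then show ?thesis by (simp add: orient_gen orient_list_def sign_id)
qed

text \<open>
  Lift a cycle to an ordered chain and contract it there. The boundary of the lift need not vanish, but
  it is antisymmetrized to 0, and so is its cone.
\<close>

lemma augmented_acyclic_alternating_chains:
  assumes "finite \<sigma>" "v \<in> \<sigma>"
  shows "augmented_acyclic (alternating_chains (full_simplex \<sigma>)) oriented_bd augm (gen [v] :: _ \<Rightarrow>\<^sub>0 'f::field)"
  unfolding augmented_acyclic_def
proof (intro conjI ballI impI subspace_alternating_chains plinear_oriented_bd)
  note comp = abstract_complex_full_simplex[OF assms(1)]
  show "gen [v] \<in> alternating_chains (full_simplex \<sigma>)"
    using orient_in_alternating_chains[OF full_simplex_vertex[OF assms(2)]] by (simp add: orient_vertex)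
  show "oriented_bd (gen [v]) = 0" by (simp add: oriented_bd_def)
  fix c :: "('a, 'f) chain" assume c: "c \<in> alternating_chains (full_simplex \<sigma>)"
  then obtain x where x: "x \<in> ordered_chains (full_simplex \<sigma>)" "c = orient x" by (rule alternating_chain_orientE)
  show "augm (oriented_bd c) = 0" by (simp add: x(2) oriented_bd_orient augm_orient augm_obd)
  assume "oriented_bd c = 0"
  then have "orient (obd x) = 0" by (simp add: x(2) oriented_bd_orient)
  then have zero: "orient (consc v (obd x)) = 0" by (rule orient_consc_eq_0)
  have "obd (consc v x) + consc v (obd x) = x - pscale (augm x) (gen [v])"
    by (rule cone_homotopy[OF ordered_chains_lookup_Nil[OF x(1) comp]])
  then have "orient (obd (consc v x) + consc v (obd x)) = orient (x - pscale (augm x) (gen [v]))" by (rule arg_cong)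
  then have "orient (obd (consc v x)) = orient (x - pscale (augm x) (gen [v]))"
    by (simp only: orient_simps(1) zero add_0_right)
  then have "oriented_bd (orient (consc v x)) = c - pscale (augm c) (gen [v])"
    by (simp add: oriented_bd_orient orient_simps x(2) augm_orient orient_vertex)
  then show "\<exists>y\<in>alternating_chains (full_simplex \<sigma>). oriented_bd y = c - pscale (augm c) (gen [v])"
    using orient_in_alternating_chains[OF consc_in_full_simplex[OF assms(2) x(1)]] by blast
qed

theorem quasi_iso_orient:
  assumes "abstract_complex K"
  shows "quasi_iso (ordered_chains K) obd (alternating_chains K) oriented_bd (orient :: _ \<Rightarrow> ('a, 'f::field) chain)"
proof (rule quasi_iso_by_Mayer_Vietoris[OF Mayer_Vietoris_ordered_chains Mayer_Vietoris_alternating_chains _ _ _ _ assms])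
  show "orient (x - y) = orient x - orient y" for x y :: "('a, 'f) chain" by (rule orient_simps)
  show "orient x \<in> alternating_chains K" if "x \<in> ordered_chains K" for K and x :: "('a, 'f) chain"
    using that by (rule orient_in_alternating_chains)
  show "orient (obd x) = oriented_bd (orient x)" for x :: "('a, 'f) chain" by (simp add: oriented_bd_orient)
  fix \<sigma> :: "'a set" assume \<sigma>: "finite \<sigma>" "\<sigma> \<noteq> {}"
  then obtain v where v: "v \<in> \<sigma>" by blast
  show "quasi_iso (ordered_chains (full_simplex \<sigma>)) obd (alternating_chains (full_simplex \<sigma>)) oriented_bd
      (orient :: _ \<Rightarrow> ('a, 'f) chain)"
    by (rule quasi_iso_augmented_acyclic[OF augmented_acyclic_ordered_chains[OF \<sigma>(1) v]
          augmented_acyclic_alternating_chains[OF \<sigma>(1) v] plinear_orient])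
      (auto simp: orient_in_alternating_chains oriented_bd_orient augm_orient orient_vertex)
qed

section \<open>Degrees\<close>

definition homogeneous :: "nat \<Rightarrow> ('a, 'f::field) chain set" where
  "homogeneous n = {c. \<forall>l\<in>keys c. length l = Suc n}"

definition degree_part :: "nat \<Rightarrow> ('a, 'f::field) chain \<Rightarrow> ('a, 'f) chain" where
  "degree_part n = prestrict (\<lambda>l. length l = Suc n)"

lemma plinear_degree_part: "plinear (degree_part n)" by (simp add: degree_part_def plinear_prestrict)
lemmas degree_part_simps = plinear_simps[OF plinear_degree_part]

lemma prestrict_gen: "prestrict P (gen k) = (if P k then gen k else 0)" by (simp add: prestrict_def)

lemma prestrict_id: "(\<And>k. k \<in> keys c \<Longrightarrow> P k) \<Longrightarrow> prestrict P c = c"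
  by (rule poly_mapping_eqI) (auto simp: lookup_prestrict in_keys_iff)

lemma prestrict_none: "(\<And>k. k \<in> keys c \<Longrightarrow> \<not> P k) \<Longrightarrow> prestrict P c = 0"
  by (rule poly_mapping_eqI) (auto simp: lookup_prestrict in_keys_iff)

lemma degree_part_homogeneous: "c \<in> homogeneous n \<Longrightarrow> degree_part m c = (if m = n then c else 0)"
  unfolding degree_part_def homogeneous_def by (auto intro: prestrict_id prestrict_none)

lemma degree_part_in_homogeneous: "degree_part n c \<in> homogeneous n"
  by (auto simp: degree_part_def homogeneous_def in_keys_iff lookup_prestrict split: if_splits)

lemma subspace_homogeneous: "formal.subspace (homogeneous n)"
  unfolding formal.subspace_def homogeneous_def
  using keys_add keys_pscale by (auto dest!: subsetD[OF keys_add] subsetD[OF keys_pscale])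

lemma degree_part_orient: "degree_part n (orient c) = orient (degree_part n c)"
proof (rule plinear_eqI[where f = "\<lambda>c. degree_part n (orient c)"])
  show "plinear (\<lambda>c. degree_part n (orient c))" by (rule plinear_compose[OF plinear_degree_part plinear_orient])
  show "plinear (\<lambda>c. orient (degree_part n c))" by (rule plinear_compose[OF plinear_orient plinear_degree_part])
  fix l :: "'a list"
  show "degree_part n (orient (gen l)) = orient (degree_part n (gen l) :: ('a, 'b) chain)"
    by (auto simp: orient_gen orient_list_def degree_part_simps)
      (auto simp: degree_part_def prestrict_gen orient_simps orient_gen orient_list_def)
qed

lemma degree_part_oriented_bd: "degree_part n (oriented_bd c) = oriented_bd (degree_part (Suc n) c)"
proof (rule plinear_eqI[where f = "\<lambda>c. degree_part n (oriented_bd c)"])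
  show "plinear (\<lambda>c. degree_part n (oriented_bd c))" by (rule plinear_compose[OF plinear_degree_part plinear_oriented_bd])
  show "plinear (\<lambda>c. oriented_bd (degree_part (Suc n) c))" by (rule plinear_compose[OF plinear_oriented_bd plinear_degree_part])
  fix l :: "'a list"
  show "degree_part n (oriented_bd (gen l)) = oriented_bd (degree_part (Suc n) (gen l) :: ('a, 'b) chain)"
    by (cases l) (auto simp: oriented_bd_def degree_part_def prestrict_gen plinear_simps[OF plinear_prestrict] lext_simps)
qed

lemma degree_part_obd: "degree_part n (obd c) = obd (degree_part (Suc n) c)"
proof (rule plinear_eqI[where f = "\<lambda>c. degree_part n (obd c)"])
  show "plinear (\<lambda>c. degree_part n (obd c))" by (rule plinear_compose[OF plinear_degree_part plinear_obd])
  show "plinear (\<lambda>c. obd (degree_part (Suc n) c))" by (rule plinear_compose[OF plinear_obd plinear_degree_part])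
  fix l :: "'a list"
  have *: "k \<in> keys (obd (gen l) :: ('a, 'b) chain) \<Longrightarrow> length l = Suc (length k)" for k
    using keys_obd[of "gen l :: ('a, 'b) chain"] by auto
  show "degree_part n (obd (gen l)) = obd (degree_part (Suc n) (gen l) :: ('a, 'b) chain)"
  proof (cases "length l = Suc (Suc n)")
    case True
    then show ?thesis using * unfolding degree_part_def prestrict_gen by (auto intro!: prestrict_id)
  next
    case False
    then show ?thesis using * unfolding degree_part_def prestrict_gen
      by (auto simp: obd_simps intro!: prestrict_none)
  qed
qed

lemma degree_part_in_ordered_chains: "c \<in> ordered_chains K \<Longrightarrow> degree_part n c \<in> ordered_chains K"
  by (auto simp: ordered_chains_def degree_part_def in_keys_iff lookup_prestrict split: if_splits)

lemma degree_part_in_alternating_chains: "c \<in> alternating_chains K \<Longrightarrow> degree_part n c \<in> alternating_chains K"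
  by (auto simp: alternating_chains_def degree_part_def in_keys_iff lookup_prestrict split: if_splits)

definition oriented_cycles :: "nat \<Rightarrow> 'a set set \<Rightarrow> ('a, 'f::field) chain set" where
  "oriented_cycles n K = {c \<in> alternating_chains K \<inter> homogeneous n. oriented_bd c = 0}"

definition oriented_boundaries :: "nat \<Rightarrow> 'a set set \<Rightarrow> ('a, 'f::field) chain set" where
  "oriented_boundaries n K = oriented_bd ` (alternating_chains K \<inter> homogeneous (Suc n))"

lemma degree_part_lext:
  assumes "\<And>i. i \<in> keys a \<Longrightarrow> z i \<in> homogeneous (deg i)"
  shows "degree_part n (lext z a) = lext z (prestrict (\<lambda>i. deg i = n) a)"
proof -
  have "degree_part n (lext z a) = (\<Sum>i\<in>keys a. pscale (lookup a i) (degree_part n (z i)))"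
    by (simp add: lext_def degree_part_simps)
  also have "\<dots> = (\<Sum>i\<in>keys a. pscale (lookup (prestrict (\<lambda>i. deg i = n) a) i) (z i))"
    by (intro sum.cong refl) (simp add: degree_part_homogeneous[OF assms] lookup_prestrict)
  also have "\<dots> = lext z (prestrict (\<lambda>i. deg i = n) a)"
    by (rule lext_superset[symmetric]) (auto simp: in_keys_iff lookup_prestrict split: if_splits)
  finally show ?thesis .
qed

text \<open>
  Antisymmetrization is a quasi-isomorphism in all degrees together; projecting to the lists of length
  \<open>n + 1\<close> commutes with all maps involved and separates the degrees.
\<close>

lemma homology_basis_oriented:
  fixes z :: "'i \<Rightarrow> ('a, 'f::field) chain"
  assumes K: "abstract_complex K"
    and basis: "homology_basis (ordered_cycles K) (ordered_boundaries K) A z"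
    and deg: "\<And>i. i \<in> A \<Longrightarrow> z i \<in> homogeneous (deg i)"
  shows "homology_basis (oriented_cycles n K) (oriented_boundaries n K) {i \<in> A. deg i = n} (\<lambda>i. orient (z i))"
  unfolding homology_basis_def
proof (intro conjI ballI allI impI)
  have zK: "z i \<in> ordered_chains K" "obd (z i) = 0" if "i \<in> A" for i
    using basis that by (auto simp: homology_basis_def ordered_cycles_def)
  note qi = quasi_iso_orient[OF K, unfolded quasi_iso_def, rule_format]
  note alt0 = formal.subspace_0[OF subspace_alternating_chains]
    and alt_diff = formal.subspace_diff[OF subspace_alternating_chains]
  {
    fix i assume i: "i \<in> {i \<in> A. deg i = n}"
    then have "orient (z i) \<in> alternating_chains K" "oriented_bd (orient (z i)) = 0"
      using zK by (auto simp: orient_in_alternating_chains oriented_bd_orient orient_simps)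
    moreover have "degree_part n (z i) = z i"
      using i deg[of i] by (simp add: degree_part_homogeneous)
    then have "orient (z i) = degree_part n (orient (z i))" by (simp add: degree_part_orient)
    then have "orient (z i) \<in> homogeneous n" using degree_part_in_homogeneous[of n "orient (z i)"] by simp
    ultimately show "orient (z i) \<in> oriented_cycles n K" by (simp add: oriented_cycles_def)
  next
    fix x :: "('a, 'f) chain" assume x: "x \<in> oriented_cycles n K"
    then have x': "x \<in> alternating_chains K" "x \<in> homogeneous n" "orient 0 = oriented_bd x"
      by (auto simp: oriented_cycles_def orient_simps)
    obtain t b where t: "t \<in> ordered_chains K" "obd t = 0" and b: "b \<in> alternating_chains K" "orient t - oriented_bd b = x"
      using qi[OF formal.subspace_0[OF subspace_ordered_chains] x'(1) obd_simps(3) x'(3)] by auto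
    then obtain a where a: "keys a \<subseteq> A" "t - lext z a \<in> ordered_boundaries K"
      using basis by (auto simp: homology_basis_def ordered_cycles_def)
    then obtain u where u: "u \<in> ordered_chains K" "t = lext z a + obd u"
      by (auto simp: ordered_boundaries_def algebra_simps)
    let ?a = "prestrict (\<lambda>i. deg i = n) a" and ?y = "degree_part (Suc n) (orient u - b)"
    have ka: "keys ?a \<subseteq> {i \<in> A. deg i = n}"
      using a(1) by (auto simp: in_keys_iff lookup_prestrict split: if_splits)
    have "x = orient (lext z a) + oriented_bd (orient u - b)"
      using b(2) u(2) by (simp add: orient_simps oriented_bd_simps oriented_bd_orient algebra_simps)
    then have "degree_part n x = orient (degree_part n (lext z a)) + oriented_bd ?y"
      by (simp only: degree_part_simps(1) degree_part_orient degree_part_oriented_bd)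
    moreover have "degree_part n (lext z a) = lext z ?a" by (rule degree_part_lext) (use deg a(1) in auto)
    moreover have "degree_part n x = x" by (simp add: degree_part_homogeneous[OF x'(2)])
    ultimately have "x = orient (lext z ?a) + oriented_bd ?y" by simp
    moreover have "orient (lext z ?a) = lext (\<lambda>i. orient (z i)) ?a" by (simp add: orient_def lext_lext)
    ultimately have "x - lext (\<lambda>i. orient (z i)) ?a = oriented_bd ?y" by simp
    moreover have "?y \<in> alternating_chains K"
      by (intro degree_part_in_alternating_chains alt_diff orient_in_alternating_chains u(1) b(1))
    ultimately have "x - lext (\<lambda>i. orient (z i)) ?a \<in> oriented_boundaries n K"
      using degree_part_in_homogeneous by (auto simp: oriented_boundaries_def)
    with ka show "\<exists>a. keys a \<subseteq> {i \<in> A. deg i = n} \<and> x - lext (\<lambda>i. orient (z i)) a \<in> oriented_boundaries n K"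
      by blast
  next
    fix a assume a: "keys a \<subseteq> {i \<in> A. deg i = n}" "lext (\<lambda>i. orient (z i)) a \<in> oriented_boundaries n K"
    have "orient (lext z a) = lext (\<lambda>i. orient (z i)) a" by (simp add: orient_def lext_lext)
    then obtain e where e: "e \<in> alternating_chains K" "orient (lext z a) = oriented_bd e"
      using a(2) by (auto simp: oriented_boundaries_def)
    have "lext z a \<in> ordered_chains K"
      unfolding lext_def using zK a(1)
      by (intro formal.subspace_sum[OF subspace_ordered_chains] formal.subspace_scale[OF subspace_ordered_chains]) auto
    moreover have "obd (lext z a) = 0"
      unfolding lext_def using zK a(1) by (auto simp: obd_simps intro!: sum.neutral)
    ultimately obtain t where "t \<in> ordered_chains K" "obd t = lext z a" using qi[OF _ e(1) _ e(2)] by blast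
    then have "lext z a \<in> ordered_boundaries K" unfolding ordered_boundaries_def by (metis imageI)
    then show "a = 0" using basis a(1) by (auto simp: homology_basis_def)
  }
qed

lemma orient_boundary:
  assumes "c \<in> ordered_boundaries K" "c \<in> homogeneous n"
  shows "orient c \<in> oriented_boundaries n K"
proof -
  obtain u where u: "u \<in> ordered_chains K" "c = obd u" using assms(1) by (auto simp: ordered_boundaries_def)
  have "c = obd (degree_part (Suc n) u)"
    using degree_part_homogeneous[OF assms(2), of n] u(2) by (simp add: degree_part_obd)
  then have "orient c = oriented_bd (degree_part (Suc n) (orient u))" by (simp add: oriented_bd_orient degree_part_orient)
  then show ?thesis
    using degree_part_in_alternating_chains[OF orient_in_alternating_chains[OF u(1)]] degree_part_in_homogeneous
    by (auto simp: oriented_boundaries_def)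
qed

section \<open>Interval bases of filtrations\<close>

text \<open>
  Ordered cycles \<open>z i\<close>, homogeneous of degree \<open>deg i\<close>, with lifetimes \<open>I i\<close>. An interval may be empty, which
  is convenient for products; such a cycle does not contribute to the barcode.
\<close>

definition interval_basis ::
  "(real \<Rightarrow> 'a set set) \<Rightarrow> 'i set \<Rightarrow> ('i \<Rightarrow> ('a, 'f::field) chain) \<Rightarrow> ('i \<Rightarrow> nat) \<Rightarrow> ('i \<Rightarrow> real set) \<Rightarrow> bool"
where
  "interval_basis R A z deg I \<longleftrightarrow>
     (\<forall>i\<in>A. is_interval (I i) \<and> I i \<subseteq> {0..} \<and> z i \<in> homogeneous (deg i)) \<and>
     (\<forall>i\<in>A. \<forall>s\<in>I i. \<forall>t\<ge>s. t \<notin> I i \<longrightarrow> z i \<in> ordered_boundaries (R t)) \<and>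
     (\<forall>t\<ge>0. homology_basis (ordered_cycles (R t)) (ordered_boundaries (R t)) {i \<in> A. t \<in> I i} z) \<and>
     (\<forall>n. finite {i \<in> A. deg i = n})"

definition filtration :: "(real \<Rightarrow> 'a set set) \<Rightarrow> bool" where
  "filtration R \<longleftrightarrow> (\<forall>t. abstract_complex (R t)) \<and> (\<forall>s t. s \<le> t \<longrightarrow> R s \<subseteq> R t)"

lemma filtration_product:
  "filtration R \<Longrightarrow> filtration S \<Longrightarrow> filtration (\<lambda>t. product_complex (R t) (S t))"
  unfolding filtration_def by (simp add: abstract_complex_product) (unfold product_complex_def, blast)

lemma ordered_cycles_mono: "K \<subseteq> L \<Longrightarrow> ordered_cycles K \<subseteq> ordered_cycles L"
  and ordered_boundaries_mono: "K \<subseteq> L \<Longrightarrow> ordered_boundaries K \<subseteq> ordered_boundaries L"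
  using ordered_chains_mono[of K L] by (auto simp: ordered_cycles_def ordered_boundaries_def)

lemma cross_homogeneous:
  assumes "c \<in> homogeneous m" "d \<in> homogeneous n"
  shows "cross c d \<in> homogeneous (m + n)"
  unfolding homogeneous_def
proof (intro CollectI ballI)
  fix l assume l: "l \<in> keys (cross c d)"
  obtain xs ys where h: "xs \<in> keys c" "ys \<in> keys d" "l \<in> keys (shuffle xs ys :: ('a \<times> 'c, 'b) chain)"
    using keys_cross[OF l] by blast
  then show "length l = Suc (m + n)" using keys_shuffle[OF h(3)] assms by (fastforce simp: homogeneous_def)
qed

text \<open>
  If \<open>d\<close> is the boundary of \<open>u\<close>, the Leibniz rule makes \<open>c \<times> d\<close> the boundary of \<open>c \<times> u\<close> up to sign; the sign
  operator is an involution that preserves cycles.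
\<close>

lemma cross_cycle_boundary:
  assumes "abstract_complex K" "abstract_complex L" "c \<in> ordered_cycles K" "d \<in> ordered_boundaries L"
  shows "cross c d \<in> ordered_boundaries (product_complex K L)"
proof -
  obtain u where u: "u \<in> ordered_chains L" "d = obd u" using assms(4) by (auto simp: ordered_boundaries_def)
  have c: "c \<in> ordered_chains K" "obd c = 0" using assms(3) by (auto simp: ordered_cycles_def)
  have ps: "parity_sign c \<in> ordered_chains K"
  proof -
    have "keys (parity_sign c) \<subseteq> keys c"
      using keys_lext[of "\<lambda>l. pscale ((- 1) ^ length l) (gen l)" c] keys_pscale by (fastforce simp: parity_sign_def)
    then show ?thesis using c(1) by (auto simp: ordered_chains_def)
  qed
  have "parity_sign (parity_sign c) = c"
    by (rule plinear_eqI[where f = "\<lambda>c. parity_sign (parity_sign c)" and g = "\<lambda>c. c"])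
      (auto intro: plinear_compose plinear_parity_sign plinear_id simp: parity_sign_gen parity_sign_simps simp flip: power_add)
  moreover have "obd (parity_sign c) = 0"
  proof -
    have "aug_bd c = pscale (augm c) (gen [])" using c(2) by (simp add: obd_def)
    moreover have "aug_bd (parity_sign c) = - parity_sign (aug_bd c)" by (simp add: parity_sign_aug_bd)
    ultimately have "aug_bd (parity_sign c) = pscale (- augm c) (gen [])" by (simp add: parity_sign_simps parity_sign_gen)
    then show ?thesis by (simp add: obd_def augm_def)
  qed
  ultimately have "cross c d = obd (- cross (parity_sign c) u)"
    by (simp add: u(2) obd_simps obd_cross cross_simps)
  then show ?thesis
    using formal.subspace_neg[OF subspace_ordered_chains cross_in_product[OF assms(1,2) ps u(1)]]
    by (auto simp: ordered_boundaries_def)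
qed

lemma cross_boundary_cycle:
  assumes "abstract_complex K" "abstract_complex L" "c \<in> ordered_boundaries K" "d \<in> ordered_cycles L"
  shows "cross c d \<in> ordered_boundaries (product_complex K L)"
proof -
  obtain u where u: "u \<in> ordered_chains K" "c = obd u" using assms(3) by (auto simp: ordered_boundaries_def)
  have "d \<in> ordered_chains L" "obd d = 0" using assms(4) by (auto simp: ordered_cycles_def)
  then show ?thesis using cross_in_product[OF assms(1,2) u(1)] obd_cross_cycle[of d u] u(2)
    unfolding ordered_boundaries_def by (metis imageI)
qed

text \<open>
  At each time this is the Kuenneth theorem. When \<open>t\<close> leaves \<open>I i \<inter> J j\<close>, one factor has become a boundary
  while the other one, born earlier, is still a cycle.
\<close>

theorem interval_basis_product:
  fixes z :: "'i \<Rightarrow> ('a, 'f::field) chain" and w :: "'j \<Rightarrow> ('b, 'f) chain"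
  assumes R: "filtration R" and S: "filtration S"
    and z: "interval_basis R A z p I" and w: "interval_basis S B w q J"
  shows "interval_basis (\<lambda>t. product_complex (R t) (S t)) (A \<times> B) (\<lambda>(i, j). cross (z i) (w j))
    (\<lambda>(i, j). p i + q j) (\<lambda>(i, j). I i \<inter> J j)"
  unfolding interval_basis_def
proof (intro conjI ballI allI impI)
  note C = R[unfolded filtration_def] S[unfolded filtration_def]
  note Z = z[unfolded interval_basis_def] and W = w[unfolded interval_basis_def]
  have zcyc: "z i \<in> ordered_cycles (R t)" if "i \<in> A" "s \<in> I i" "s \<le> t" for i s t
  proof -
    have "0 \<le> s" using Z that by auto
    then have "z i \<in> ordered_cycles (R s)" using Z that by (auto simp: homology_basis_def)
    then show ?thesis using ordered_cycles_mono[of "R s" "R t"] C that(3) by blast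
  qed
  have wcyc: "w j \<in> ordered_cycles (S t)" if "j \<in> B" "s \<in> J j" "s \<le> t" for j s t
  proof -
    have "0 \<le> s" using W that by auto
    then have "w j \<in> ordered_cycles (S s)" using W that by (auto simp: homology_basis_def)
    then show ?thesis using ordered_cycles_mono[of "S s" "S t"] C that(3) by blast
  qed
  {
    fix ij assume "ij \<in> A \<times> B"
    then obtain i j where ij: "ij = (i, j)" "i \<in> A" "j \<in> B" by auto
    show "is_interval (case ij of (i, j) \<Rightarrow> I i \<inter> J j)" "(case ij of (i, j) \<Rightarrow> I i \<inter> J j) \<subseteq> {0..}"
      "(case ij of (i, j) \<Rightarrow> cross (z i) (w j)) \<in> homogeneous (case ij of (i, j) \<Rightarrow> p i + q j)"
      using Z W ij by (auto intro: is_interval_Int cross_homogeneous)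
    fix s t assume st: "s \<in> (case ij of (i, j) \<Rightarrow> I i \<inter> J j)" "s \<le> t" "t \<notin> (case ij of (i, j) \<Rightarrow> I i \<inter> J j)"
    have compl: "abstract_complex (R t)" "abstract_complex (S t)" using C by auto
    consider "t \<notin> I i" | "t \<notin> J j" using st(3) ij by auto
    then have "cross (z i) (w j) \<in> ordered_boundaries (product_complex (R t) (S t))"
    proof cases
      case 1
      then have "z i \<in> ordered_boundaries (R t)" using Z ij st by blast
      then show ?thesis using wcyc[of j s t] ij st by (intro cross_boundary_cycle[OF compl]) auto
    next
      case 2
      then have "w j \<in> ordered_boundaries (S t)" using W ij st by blast
      then show ?thesis using zcyc[of i s t] ij st by (intro cross_cycle_boundary[OF compl]) auto
    qed
    then show "(case ij of (i, j) \<Rightarrow> cross (z i) (w j)) \<in> ordered_boundaries (product_complex (R t) (S t))"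
      using ij by simp
  next
    fix t :: real assume t: "0 \<le> t"
    have "homology_basis (ordered_cycles (product_complex (R t) (S t))) (ordered_boundaries (product_complex (R t) (S t)))
      ({i \<in> A. t \<in> I i} \<times> {j \<in> B. t \<in> J j}) (\<lambda>(i, j). cross (z i) (w j))"
      using C Z W t by (intro Kuenneth_homology_basis) auto
    moreover have "{i \<in> A. t \<in> I i} \<times> {j \<in> B. t \<in> J j} = {ij \<in> A \<times> B. t \<in> (case ij of (i, j) \<Rightarrow> I i \<inter> J j)}" by auto
    ultimately show "homology_basis (ordered_cycles (product_complex (R t) (S t))) (ordered_boundaries (product_complex (R t) (S t)))
      {ij \<in> A \<times> B. t \<in> (case ij of (i, j) \<Rightarrow> I i \<inter> J j)} (\<lambda>(i, j). cross (z i) (w j))" by simp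
  next
    fix n
    have "{ij \<in> A \<times> B. (case ij of (i, j) \<Rightarrow> p i + q j) = n}
        \<subseteq> (\<Union>m\<le>n. {i \<in> A. p i = m} \<times> {j \<in> B. q j = n - m})" by auto
    then show "finite {ij \<in> A \<times> B. (case ij of (i, j) \<Rightarrow> p i + q j) = n}"
      using Z W by (elim finite_subset) auto
  }
qed

section \<open>Existence of interval bases\<close>

text \<open>
  One step up the first flag, from the span of \<open>E\<close> to \<open>W\<close>. The members of the second flag are treated
  in increasing order, adding to \<open>E\<close> only vectors of the member \<open>M\<close> at hand. If \<open>x \<in> W \<inter> M\<close> is written as
  \<open>u + f\<close> with \<open>u\<close> in the span of \<open>E\<close> and \<open>f\<close> in the span of the new vectors, then \<open>f \<in> M\<close>, therefore
  \<open>u \<in> M\<close>, and \<open>E\<close> is adapted to \<open>M\<close> already.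
\<close>

lemma adapted_basis_extend:
  fixes E :: "('k \<Rightarrow>\<^sub>0 'f::field) set"
  assumes fin: "finite \<B>" and chain: "\<And>B C. B \<in> \<B> \<Longrightarrow> C \<in> \<B> \<Longrightarrow> B \<subseteq> C \<or> C \<subseteq> B"
    and sub: "\<And>B. B \<in> \<B> \<Longrightarrow> formal.subspace B"
    and W: "formal.subspace W" and E: "formal.independent E" "E \<subseteq> W"
    and adapted: "\<And>B. B \<in> \<B> \<Longrightarrow> formal.span E \<inter> B \<subseteq> formal.span (E \<inter> B)"
  shows "\<exists>E'. E \<subseteq> E' \<and> E' \<subseteq> E \<union> (W \<inter> \<Union>\<B>) \<and> formal.independent E' \<and> (\<forall>B\<in>\<B>. W \<inter> B \<subseteq> formal.span (E' \<inter> B))"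
  using fin chain sub adapted
proof (induction "card \<B>" arbitrary: \<B>)
  case 0
  then show ?case using E by auto
next
  case (Suc n)
  have "\<B> \<noteq> {}" using Suc.hyps(2) by auto
  obtain M where M: "M \<in> \<B>" "\<And>B. B \<in> \<B> \<Longrightarrow> M \<subseteq> B \<Longrightarrow> M = B"
    using finite_has_maximal[OF Suc.prems(1) \<open>\<B> \<noteq> {}\<close>] by blast
  have max: "B \<subseteq> M" if "B \<in> \<B>" for B using Suc.prems(2)[OF M(1) that] M(2)[OF that] by blast
  let ?C = "\<B> - {M}"
  have "n = card ?C" using Suc.hyps(2) Suc.prems(1) M(1) by simp
  then have "\<exists>E'. E \<subseteq> E' \<and> E' \<subseteq> E \<union> (W \<inter> \<Union>?C) \<and> formal.independent E' \<and> (\<forall>B\<in>?C. W \<inter> B \<subseteq> formal.span (E' \<inter> B))"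
    by (rule Suc.hyps(1)) (use Suc.prems in \<open>simp_all add: Suc.prems(2)\<close>)
  then obtain E0 where E0: "E \<subseteq> E0" "E0 \<subseteq> E \<union> (W \<inter> \<Union>?C)" "formal.independent E0"
    "\<And>B. B \<in> ?C \<Longrightarrow> W \<inter> B \<subseteq> formal.span (E0 \<inter> B)"
    by blast
  obtain E1 where E1: "E0 \<subseteq> E1" "E1 \<subseteq> E0 \<union> (W \<inter> M)" "formal.independent E1" "E0 \<union> (W \<inter> M) \<subseteq> formal.span E1"
    by (rule formal.maximal_independent_subset_extend[OF _ E0(3), of "E0 \<union> (W \<inter> M)"]) blast+
  have subM: "formal.subspace M" using Suc.prems(3) M(1) by blast
  have new: "E1 \<subseteq> E \<union> (W \<inter> M)" using E1(2) E0(2) max by blast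
  have "W \<inter> M \<subseteq> formal.span (E1 \<inter> M)"
  proof
    fix x assume x: "x \<in> W \<inter> M"
    have "E \<union> (E1 - E) = E1" using E0(1) E1(1) by blast
    then have "x \<in> formal.span (E \<union> (E1 - E))" using E1(4) x by auto
    then obtain u f where uf: "x = u + f" "u \<in> formal.span E" "f \<in> formal.span (E1 - E)"
      unfolding formal.span_Un by auto
    have F: "E1 - E \<subseteq> M" using new by blast
    have f: "f \<in> formal.span (E1 \<inter> M)" using formal.span_mono[of "E1 - E" "E1 \<inter> M"] F uf(3) by blast
    have "f \<in> M" using uf(3) formal.span_minimal[OF F subM] by blast
    then have "u \<in> M" using uf(1) x formal.subspace_diff[OF subM, of x f] by simp
    then have "u \<in> formal.span (E \<inter> M)" using Suc.prems(4)[OF M(1)] uf(2) by blast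
    moreover have "formal.span (E \<inter> M) \<subseteq> formal.span (E1 \<inter> M)"
      by (rule formal.span_mono) (use E0(1) E1(1) in blast)
    ultimately show "x \<in> formal.span (E1 \<inter> M)" using f uf(1) formal.span_add by blast
  qed
  moreover have "W \<inter> B \<subseteq> formal.span (E1 \<inter> B)" if "B \<in> ?C" for B
    by (rule order.trans[OF E0(4)[OF that] formal.span_mono[OF Int_mono[OF E1(1) order_refl]]])
  ultimately have all: "W \<inter> B \<subseteq> formal.span (E1 \<inter> B)" if "B \<in> \<B>" for B
    using that by (cases "B = M") simp_all
  have "E1 \<subseteq> E \<union> (W \<inter> \<Union>\<B>)" using new M(1) by blast
  then show ?case using order.trans[OF E0(1) E1(1)] E1(3) all by (intro exI[of _ E1]) simp
qed

text \<open>
  Two flags of subspaces have a common adapted basis; for complete flags this is the Bruhat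
  decomposition.
\<close>

lemma adapted_basis_two_flags:
  fixes \<Z> \<B> :: "('k \<Rightarrow>\<^sub>0 'f::field) set set"
  assumes "finite \<Z>" "\<And>U V. U \<in> \<Z> \<Longrightarrow> V \<in> \<Z> \<Longrightarrow> U \<subseteq> V \<or> V \<subseteq> U" "\<And>U. U \<in> \<Z> \<Longrightarrow> formal.subspace U"
    and B: "finite \<B>" "\<And>B C. B \<in> \<B> \<Longrightarrow> C \<in> \<B> \<Longrightarrow> B \<subseteq> C \<or> C \<subseteq> B" "\<And>B. B \<in> \<B> \<Longrightarrow> formal.subspace B"
  shows "\<exists>E. formal.independent E \<and> E \<subseteq> \<Union>\<Z> \<and> (\<forall>U\<in>\<Z>. U \<subseteq> formal.span (E \<inter> U)) \<and>
    (\<forall>B\<in>\<B>. formal.span E \<inter> B \<subseteq> formal.span (E \<inter> B))"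
  using assms(1-3)
proof (induction "card \<Z>" arbitrary: \<Z>)
  case 0
  then have "\<Z> = {}" by simp
  then show ?case by (intro exI[of _ "{}"]) (simp add: formal.independent_empty)
next
  case (Suc n)
  have "\<Z> \<noteq> {}" using Suc.hyps(2) by auto
  obtain M where M: "M \<in> \<Z>" "\<And>U. U \<in> \<Z> \<Longrightarrow> M \<subseteq> U \<Longrightarrow> M = U"
    using finite_has_maximal[OF Suc.prems(1) \<open>\<Z> \<noteq> {}\<close>] by blast
  have max: "U \<subseteq> M" if "U \<in> \<Z>" for U using Suc.prems(2)[OF M(1) that] M(2)[OF that] by blast
  have subM: "formal.subspace M" using Suc.prems(3) M(1) by blast
  let ?C = "\<Z> - {M}"
  have "n = card ?C" using Suc.hyps(2) Suc.prems(1) M(1) by simp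
  then have "\<exists>E. formal.independent E \<and> E \<subseteq> \<Union>?C \<and> (\<forall>U\<in>?C. U \<subseteq> formal.span (E \<inter> U)) \<and>
    (\<forall>B\<in>\<B>. formal.span E \<inter> B \<subseteq> formal.span (E \<inter> B))"
    by (rule Suc.hyps(1)) (use Suc.prems in \<open>simp_all add: Suc.prems(2)\<close>)
  then obtain E where E_all: "formal.independent E \<and> E \<subseteq> \<Union>?C \<and> (\<forall>U\<in>?C. U \<subseteq> formal.span (E \<inter> U)) \<and>
    (\<forall>B\<in>\<B>. formal.span E \<inter> B \<subseteq> formal.span (E \<inter> B))"
    by (rule exE)
  then have E: "formal.independent E" "E \<subseteq> \<Union>?C" "\<And>U. U \<in> ?C \<Longrightarrow> U \<subseteq> formal.span (E \<inter> U)"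
    "\<And>B. B \<in> \<B> \<Longrightarrow> formal.span E \<inter> B \<subseteq> formal.span (E \<inter> B)"
    by simp_all
  have EM: "E \<subseteq> M" using E(2) max by blast
  \<comment> \<open>Adding the whole space to the second flag makes the new vectors span \<open>M\<close>.\<close>
  have "\<exists>E'. E \<subseteq> E' \<and> E' \<subseteq> E \<union> (M \<inter> \<Union>(insert UNIV \<B>)) \<and> formal.independent E' \<and>
    (\<forall>B\<in>insert UNIV \<B>. M \<inter> B \<subseteq> formal.span (E' \<inter> B))"
  proof (rule adapted_basis_extend[OF _ _ _ subM E(1) EM])
    show "B \<subseteq> C \<or> C \<subseteq> B" if "B \<in> insert UNIV \<B>" "C \<in> insert UNIV \<B>" for B C
      using that B(2)[of B C] by blast
    show "formal.span E \<inter> B \<subseteq> formal.span (E \<inter> B)" if "B \<in> insert UNIV \<B>" for B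
      using that E(4)[of B] by auto
  qed (use B(1,3) formal.subspace_UNIV in auto)
  then obtain E' where E'_all: "E \<subseteq> E' \<and> E' \<subseteq> E \<union> (M \<inter> \<Union>(insert UNIV \<B>)) \<and> formal.independent E' \<and>
    (\<forall>B\<in>insert UNIV \<B>. M \<inter> B \<subseteq> formal.span (E' \<inter> B))"
    by (rule exE)
  then have E': "E \<subseteq> E'" "E' \<subseteq> E \<union> (M \<inter> \<Union>(insert UNIV \<B>))" "formal.independent E'"
    by (rule conjunct1, rule conjunct2[THEN conjunct1], rule conjunct2[THEN conjunct2, THEN conjunct1])
  have E'span: "M \<inter> B \<subseteq> formal.span (E' \<inter> B)" if "B \<in> insert UNIV \<B>" for B
    by (rule bspec[OF conjunct2[OF conjunct2[OF conjunct2[OF E'_all]]] that])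
  have E'M: "E' \<subseteq> M" using E'(2) EM by blast
  have span: "formal.span E' \<subseteq> M" by (rule formal.span_minimal[OF E'M subM])
  have "formal.span E' \<inter> B \<subseteq> formal.span (E' \<inter> B)" if "B \<in> \<B>" for B
    by (rule order.trans[OF Int_mono[OF span order_refl] E'span]) (use that in simp)
  moreover have "U \<subseteq> formal.span (E' \<inter> U)" if "U \<in> \<Z>" for U
  proof (cases "U = M")
    case True then show ?thesis using E'span[of UNIV] E'M by (simp add: Int_absorb2)
  next
    case False
    then have "U \<in> ?C" using that by simp
    then show ?thesis by (rule order.trans[OF E(3) formal.span_mono[OF Int_mono[OF E'(1) order_refl]]])
  qed
  moreover have "E' \<subseteq> \<Union>\<Z>" using E'M M(1) by blast
  ultimately show ?case using E'(3) by (intro exI[of _ E']) simp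
qed

lemma span_eq_lext: "x \<in> formal.span S \<longleftrightarrow> (\<exists>a. keys a \<subseteq> S \<and> x = lext (\<lambda>k. k) a)"
proof
  assume "x \<in> formal.span S"
  then obtain t r where t: "finite t" "t \<subseteq> S" "x = (\<Sum>k\<in>t. pscale (r k) k)"
    unfolding formal.span_explicit by auto
  have "lext (\<lambda>k. k) (family t r) = (\<Sum>k\<in>t. pscale (lookup (family t r) k) k)"
    by (rule lext_superset) (use t keys_family in auto)
  then have "x = lext (\<lambda>k. k) (family t r)" using t by (simp add: lookup_family)
  then show "\<exists>a. keys a \<subseteq> S \<and> x = lext (\<lambda>k. k) a" using keys_family[OF t(1), of r] t(2) by blast
next
  assume "\<exists>a. keys a \<subseteq> S \<and> x = lext (\<lambda>k. k) a"
  then show "x \<in> formal.span S"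
    unfolding lext_def by (auto intro!: formal.span_sum formal.span_scale intro: formal.span_base)
qed

lemma independent_lext:
  assumes "formal.independent S" "keys a \<subseteq> S" "lext (\<lambda>k. k) a = 0"
  shows "a = 0"
proof (rule poly_mapping_eqI)
  fix k
  have "(\<Sum>k\<in>keys a. pscale (lookup a k) k) = 0" using assms(3) by (simp add: lext_def)
  then have "\<forall>k\<in>keys a. lookup a k = 0" using assms(1,2) formal.independent_explicit_module[of S] finite_keys by blast
  then show "lookup a k = lookup 0 k" by (auto simp: in_keys_iff)
qed

text \<open>
  The vectors of \<open>E\<close> in \<open>Z\<close> span \<open>Z\<close>, those in \<open>B\<close> span \<open>B\<close>, and all of them are independent, so the
  others represent a basis of \<open>Z / B\<close>.
\<close>

lemma homology_basis_adapted:
  assumes E: "formal.independent E" and Z: "Z \<subseteq> formal.span (E \<inter> Z)" and B: "formal.span E \<inter> B \<subseteq> formal.span (E \<inter> B)"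
    and sub: "formal.subspace Z" "formal.subspace B" "B \<subseteq> Z"
  shows "homology_basis Z B {e \<in> E. e \<in> Z \<and> e \<notin> B} (\<lambda>e. e)"
  unfolding homology_basis_def
proof (intro conjI ballI allI impI)
  let ?A = "{e \<in> E. e \<in> Z \<and> e \<notin> B}"
  {
    fix e assume "e \<in> ?A" then show "e \<in> Z" by simp
  next
    fix x assume "x \<in> Z"
    then have "x \<in> formal.span (?A \<union> (E \<inter> B))"
      using Z formal.span_mono[of "E \<inter> Z" "?A \<union> (E \<inter> B)"] by blast
    then obtain u b where ub: "x = u + b" "u \<in> formal.span ?A" "b \<in> formal.span (E \<inter> B)" unfolding formal.span_Un by auto
    obtain a where a: "keys a \<subseteq> ?A" "u = lext (\<lambda>k. k) a" using ub(2) unfolding span_eq_lext by blast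
    have "b \<in> B" using ub(3) formal.span_minimal[OF _ sub(2), of "E \<inter> B"] by blast
    then show "\<exists>a. keys a \<subseteq> ?A \<and> x - lext (\<lambda>e. e) a \<in> B" using a ub(1) by (intro exI[of _ a]) simp
  next
    fix a assume a: "keys a \<subseteq> ?A" "lext (\<lambda>e. e) a \<in> B"
    have "lext (\<lambda>e. e) a \<in> formal.span E" unfolding span_eq_lext using a(1) by (intro exI[of _ a]) auto
    then have "lext (\<lambda>e. e) a \<in> formal.span (E \<inter> B)" by (rule subsetD[OF B IntI[OF _ a(2)]])
    then obtain b where b: "keys b \<subseteq> E \<inter> B" "lext (\<lambda>e. e) a = lext (\<lambda>e. e) b"
      unfolding span_eq_lext by (elim exE conjE) (rule that)
    have "a - b = 0"
      by (rule independent_lext[OF E]) (use keys_diff[of a b] a(1) b in \<open>auto simp: lext_simps\<close>)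
    then have "a = b" by simp
    then have "keys a = {}" using a(1) b(1) by blast
    then show "a = 0" by (simp add: poly_mapping_eqI in_keys_iff)
  }
qed

lemma subspace_ordered_cycles: "formal.subspace (ordered_cycles K)"
  unfolding ordered_cycles_def using subspace_ordered_chains[of K]
  by (auto simp: formal.subspace_def obd_simps)

lemma subspace_ordered_boundaries: "formal.subspace (ordered_boundaries K)"
  unfolding ordered_boundaries_def by (rule subspace_plinear_image[OF plinear_obd subspace_ordered_chains])

lemma ordered_boundaries_subset_cycles: "abstract_complex K \<Longrightarrow> ordered_boundaries K \<subseteq> ordered_cycles K"
  by (auto simp: ordered_boundaries_def ordered_cycles_def obd_obd obd_in_ordered_chains)

lemma finite_chain_image:
  fixes F :: "real \<Rightarrow> 'v set"
  assumes "\<And>s t. s \<le> t \<Longrightarrow> F s \<subseteq> F t"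
  shows "U \<in> F ` {0..} \<Longrightarrow> V \<in> F ` {0..} \<Longrightarrow> U \<subseteq> V \<or> V \<subseteq> U"
  using assms by (metis imageE linear)

text \<open>
  In each degree an adapted basis of the flags of cycles and boundaries; there are only finitely many
  different members, since the complexes are sets of subsets of \<open>X\<close>. The lifetime of a basis vector
  consists of the times at which it is a cycle but not a boundary. Indices record the degree, and
  bases of all degrees together form a homology basis because a chain is the sum of its homogeneous
  parts.
\<close>

lemma interval_basis_exists:
  fixes R :: "real \<Rightarrow> 'a set set"
  assumes R: "filtration R" and fin: "finite X" and X: "\<And>t. R t \<subseteq> Pow X"
  shows "\<exists>E I. interval_basis R {(e :: ('a, 'f::field) chain, n). e \<in> E n} fst snd I"
proof -
  have compl: "abstract_complex (R t)" and mono: "s \<le> t \<Longrightarrow> R s \<subseteq> R t" for s t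
    using R by (auto simp: filtration_def)
  have finR: "finite (range R)"
    by (rule finite_subset[of _ "Pow (Pow X)"]) (use X fin in auto)
  define Z where "Z n t = (ordered_cycles (R t) \<inter> homogeneous n :: ('a, 'f) chain set)" for n t
  define B where "B n t = (ordered_boundaries (R t) \<inter> homogeneous n :: ('a, 'f) chain set)" for n t
  have subZ: "formal.subspace (Z n t)" and subB: "formal.subspace (B n t)" for n t
    unfolding Z_def B_def
    by (intro formal.subspace_inter subspace_ordered_cycles subspace_ordered_boundaries subspace_homogeneous)+
  have BZ: "B n t \<subseteq> Z n t" for n t using ordered_boundaries_subset_cycles[OF compl] by (auto simp: Z_def B_def)
  have monoZ: "Z n s \<subseteq> Z n t" and monoB: "B n s \<subseteq> B n t" if "s \<le> t" for n s t
    using ordered_cycles_mono[OF mono[OF that]] ordered_boundaries_mono[OF mono[OF that]] by (auto simp: Z_def B_def)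
  have "\<exists>E. formal.independent E \<and> E \<subseteq> \<Union>(Z n ` {0..}) \<and> (\<forall>U\<in>Z n ` {0..}. U \<subseteq> formal.span (E \<inter> U)) \<and>
    (\<forall>B\<in>B n ` {0..}. formal.span E \<inter> B \<subseteq> formal.span (E \<inter> B))" for n
  proof (rule adapted_basis_two_flags)
    have "Z n ` {0..} \<subseteq> (\<lambda>K. ordered_cycles K \<inter> homogeneous n) ` range R" by (auto simp: Z_def)
    then show "finite (Z n ` {0..})" by (rule finite_subset[OF _ finite_imageI[OF finR]])
    have "B n ` {0..} \<subseteq> (\<lambda>K. ordered_boundaries K \<inter> homogeneous n) ` range R" by (auto simp: B_def)
    then show "finite (B n ` {0..})" by (rule finite_subset[OF _ finite_imageI[OF finR]])
    show "U \<subseteq> V \<or> V \<subseteq> U" if "U \<in> Z n ` {0..}" "V \<in> Z n ` {0..}" for U V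
      by (rule finite_chain_image[of "Z n", OF monoZ that])
    show "U \<subseteq> V \<or> V \<subseteq> U" if "U \<in> B n ` {0..}" "V \<in> B n ` {0..}" for U V
      by (rule finite_chain_image[of "B n", OF monoB that])
  qed (use subZ subB in auto)
  then obtain E where E: "\<And>n. formal.independent (E n)" "\<And>n. E n \<subseteq> \<Union>(Z n ` {0..})"
    "\<And>n t. 0 \<le> t \<Longrightarrow> Z n t \<subseteq> formal.span (E n \<inter> Z n t)"
    "\<And>n t. 0 \<le> t \<Longrightarrow> formal.span (E n) \<inter> B n t \<subseteq> formal.span (E n \<inter> B n t)"
    by (metis (no_types, lifting) atLeast_iff imageI)
  let ?A = "{(e, n). e \<in> E n}"
  define I where "I = (\<lambda>(e, n). {t. 0 \<le> t \<and> e \<in> Z n t \<and> e \<notin> B n t})"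
  have basis: "homology_basis (Z n t) (B n t) {e \<in> E n. t \<in> I (e, n)} (\<lambda>e. e)" if "0 \<le> t" for n t
    using homology_basis_adapted[OF E(1) E(3)[OF that] E(4)[OF that] subZ subB BZ] that by (simp add: I_def)
  have finE: "finite (E n)" for n
  proof -
    let ?L = "{l. set l \<subseteq> X \<and> length l = Suc n}"
    have finL: "finite ?L" by (rule finite_lists_length_eq[OF fin])
    have "E n \<subseteq> formal.span (gen ` ?L)"
    proof
      fix e assume "e \<in> E n"
      then obtain t where "e \<in> Z n t" using E(2) by blast
      then have k: "keys e \<subseteq> ?L"
        using X[of t] by (auto simp: Z_def ordered_cycles_def ordered_chains_def homogeneous_def)
      have "e = lext gen e" by simp
      also have "\<dots> \<in> formal.span (gen ` ?L)"
        unfolding lext_def using k by (intro formal.span_sum formal.span_scale formal.span_base) auto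
      finally show "e \<in> formal.span (gen ` ?L)" .
    qed
    then show ?thesis using formal.independent_span_bound[OF finite_imageI[OF finL] E(1)] by blast
  qed
  have "interval_basis R ?A fst snd I"
    unfolding interval_basis_def
  proof (intro conjI ballI allI impI)
    fix i assume "i \<in> ?A"
    then obtain e n where i: "i = (e, n)" "e \<in> E n" by auto
    show "is_interval (I i)"
      unfolding is_interval_1
    proof (intro ballI allI impI)
      fix a b x assume "a \<in> I i" "b \<in> I i" "a \<le> x \<and> x \<le> b"
      then show "x \<in> I i" using monoZ[of a x n] monoB[of x b n] i by (auto simp: I_def)
    qed
    show "I i \<subseteq> {0..}" using i by (auto simp: I_def)
    show "fst i \<in> homogeneous (snd i)" using E(2) i by (auto simp: Z_def)
    fix s t assume "s \<in> I i" "s \<le> t" "t \<notin> I i"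
    then show "fst i \<in> ordered_boundaries (R t)" using monoZ[of s t n] i by (auto simp: I_def B_def)
  next
    fix n
    have "{i \<in> ?A. snd i = n} = E n \<times> {n}" by auto
    then show "finite {i \<in> ?A. snd i = n}" using finE by simp
  next
    fix t :: real assume t: "0 \<le> t"
    let ?At = "{i \<in> ?A. t \<in> I i}"
    show "homology_basis (ordered_cycles (R t)) (ordered_boundaries (R t)) ?At fst"
      unfolding homology_basis_def
    proof (intro conjI ballI allI impI)
      show "fst i \<in> ordered_cycles (R t)" if "i \<in> ?At" for i using that by (auto simp: I_def Z_def)
    next
      fix x :: "('a, 'f) chain" assume x: "x \<in> ordered_cycles (R t)"
      have part: "degree_part n x \<in> Z n t" for n
      proof -
        have "obd (degree_part n x) = 0"
        proof (cases n)
          case 0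
          have "k \<notin> keys (obd (degree_part 0 x))" for k
          proof
            assume "k \<in> keys (obd (degree_part 0 x))"
            then obtain m where "m \<in> keys (degree_part 0 x)" "length m = Suc (length k)" "k \<noteq> []"
              using subsetD[OF keys_obd] by blast
            then show False using degree_part_in_homogeneous[of 0 x] by (simp add: homogeneous_def)
          qed
          then show ?thesis using 0 by (intro poly_mapping_eqI) (simp add: in_keys_iff)
        next
          case (Suc m)
          then show ?thesis using degree_part_obd[of m x] x by (simp add: ordered_cycles_def degree_part_simps)
        qed
        then show ?thesis using x degree_part_in_ordered_chains degree_part_in_homogeneous
          by (auto simp: Z_def ordered_cycles_def)
      qed
      have "\<forall>n. \<exists>a. keys a \<subseteq> {e \<in> E n. t \<in> I (e, n)} \<and> degree_part n x - lext (\<lambda>e. e) a \<in> B n t"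
        using basis[OF t] part by (simp add: homology_basis_def)
      from choice[OF this] obtain a where a: "\<And>n. keys (a n) \<subseteq> {e \<in> E n. t \<in> I (e, n)}" "\<And>n. degree_part n x - lext (\<lambda>e. e) (a n) \<in> B n t"
        by auto
      \<comment> \<open>All lists in the support are shorter than \<open>N\<close>; the list \<open>[]\<close> only keeps the maximum defined.\<close>
      define N where "N = Suc (Max (length ` insert [] (keys x)))"
      have N: "length l < N" if "l \<in> keys x" for l unfolding N_def using that by (auto simp: less_Suc_eq_le intro!: Max_ge)
      have nonempty: "l \<noteq> []" if "l \<in> keys x" for l
        using that x ordered_chains_lookup_Nil[OF _ compl, of x t] by (auto simp: ordered_cycles_def in_keys_iff)
      have xsum: "x = (\<Sum>n<N. degree_part n x)"
      proof (rule poly_mapping_eqI)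
        fix l
        have "lookup (\<Sum>n<N. degree_part n x) l = (\<Sum>n<N. if n = length l - 1 \<and> l \<noteq> [] then lookup x l else 0)"
          unfolding lookup_sum by (intro sum.cong) (auto simp: degree_part_def lookup_prestrict)
        also have "\<dots> = (if length l - 1 < N \<and> l \<noteq> [] then lookup x l else 0)" by auto
        also have "\<dots> = lookup x l"
        proof (cases "l \<in> keys x")
          case True
          then have "length l - 1 < N" "l \<noteq> []" using N[OF True] nonempty[OF True] by auto
          then show ?thesis by simp
        qed (simp add: in_keys_iff)
        finally show "lookup x l = lookup (\<Sum>n<N. degree_part n x) l" by simp
      qed
      define b where "b = (\<Sum>n<N. lext (\<lambda>e. gen (e, n)) (a n))"
      have "keys (lext (\<lambda>e. gen (e, n) :: _ \<Rightarrow>\<^sub>0 'f) (a n)) \<subseteq> ?At" for n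
      proof -
        have "keys (lext (\<lambda>e. gen (e, n) :: _ \<Rightarrow>\<^sub>0 'f) (a n)) \<subseteq> (\<Union>e\<in>keys (a n). keys (gen (e, n) :: _ \<Rightarrow>\<^sub>0 'f))"
          by (rule keys_lext)
        then show ?thesis using a(1)[of n] by auto
      qed
      then have kb: "keys b \<subseteq> ?At" unfolding b_def by (intro order.trans[OF keys_sum] UN_least)
      have "lext fst b = (\<Sum>n<N. lext (\<lambda>e. e) (a n))" by (simp add: b_def lext_simps lext_lext)
      then have "x - lext fst b = (\<Sum>n<N. degree_part n x - lext (\<lambda>e. e) (a n))"
        by (subst xsum) (simp add: sum_subtractf)
      also have "\<dots> \<in> ordered_boundaries (R t)"
        using a(2) by (intro formal.subspace_sum[OF subspace_ordered_boundaries]) (simp add: B_def)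
      finally show "\<exists>b. keys b \<subseteq> ?At \<and> x - lext fst b \<in> ordered_boundaries (R t)" using kb by blast
    next
      fix a assume a: "keys a \<subseteq> ?At" "lext fst a \<in> ordered_boundaries (R t)"
      then obtain u where u: "u \<in> ordered_chains (R t)" "lext fst a = obd u" by (auto simp: ordered_boundaries_def)
      have "slice n a = 0" for n
      proof -
        have "degree_part n (lext fst a) = lext fst (prestrict (\<lambda>i. snd i = n) a)"
          by (rule degree_part_lext) (use a(1) in \<open>auto simp: I_def Z_def\<close>)
        also have "\<dots> = lext (\<lambda>e. e) (slice n a)"
          unfolding slice_def prestrict_def lext_lext by (intro lext_cong) (auto simp: lext_simps)
        finally have "lext (\<lambda>e. e) (slice n a) = obd (degree_part (Suc n) u)" by (simp add: u(2) degree_part_obd)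
        moreover have "obd (degree_part (Suc n) u) \<in> B n t"
          using degree_part_in_ordered_chains[OF u(1)] degree_part_in_homogeneous[of n "obd u"]
          by (auto simp: B_def ordered_boundaries_def degree_part_obd)
        moreover have "keys (slice n a) \<subseteq> {e \<in> E n. t \<in> I (e, n)}"
          using a(1) by (auto simp: in_keys_iff lookup_slice)
        ultimately show ?thesis using basis[OF t, of n] by (auto simp: homology_basis_def)
      qed
      then have "lookup a (e, n) = 0" for e n using lookup_slice[of n a e] by simp
      then show "a = 0" by (intro poly_mapping_eqI) auto
    qed
  qed
  then show ?thesis by blast
qed

section \<open>Uniqueness of barcodes\<close>

definition bars :: "real set multiset \<Rightarrow> (real set \<times> nat) set" where
  "bars M = {(I, k). k < count M I}"

definition barcode_module :: "real set multiset \<Rightarrow> ('f::field, real set \<times> nat \<Rightarrow> 'f) persistence_module" where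
  "barcode_module M = persistence_direct_sum (bars M) (\<lambda>(I, k). interval_module I)"

lemma bars_Sigma: "bars M = (SIGMA I:set_mset M. {..<count M I})"
  by (auto simp: bars_def) (metis count_greater_zero_iff gr_zeroI not_less_zero)

lemma finite_bars: "finite (bars M)"
  by (simp add: bars_Sigma)

lemma card_bars_filter: "card {p \<in> bars M. P (fst p)} = size (filter_mset P M)"
proof -
  have "{p \<in> bars M. P (fst p)} = (SIGMA I:{I \<in> set_mset M. P I}. {..<count M I})" by (auto simp: bars_Sigma)
  then have "card {p \<in> bars M. P (fst p)} = (\<Sum>I | I \<in># M \<and> P I. count M I)" by simp
  also have "\<dots> = size (filter_mset P M)"
    unfolding size_multiset_overloaded_eq by (rule sum.cong) auto
  finally show ?thesis .
qed

lemma barcode_module_carrier: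
  "x \<in> carrier (space_at (barcode_module M) t) \<longleftrightarrow>
    x \<in> extensional (bars M) \<and> (\<forall>p\<in>bars M. t \<notin> fst p \<longrightarrow> x p = 0)"
  using finite_bars[of M]
  by (auto simp: barcode_module_def persistence_direct_sum_def interval_module_def PiE_def Pi_def case_prod_beta split: if_splits)

lemma barcode_module_simps:
  "x \<oplus>\<^bsub>space_at (barcode_module M) t\<^esub> y = (\<lambda>p\<in>bars M. x p + y p)"
  "a \<odot>\<^bsub>space_at (barcode_module M) t\<^esub> x = (\<lambda>p\<in>bars M. a * x p)"
  "\<zero>\<^bsub>space_at (barcode_module M) t\<^esub> = (\<lambda>p\<in>bars M. 0)"
  "transition (barcode_module M) s t x = (\<lambda>p\<in>bars M. if s \<in> fst p \<and> t \<in> fst p then x p else 0)"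
  by (auto simp: barcode_module_def persistence_direct_sum_def interval_module_def case_prod_beta)

lemma vectorspace_barcode_module:
  "vectorspace class_ring (space_at (barcode_module M :: ('f::field, _) persistence_module) t)"
proof -
  let ?V = "space_at (barcode_module M :: ('f, _) persistence_module) t"
  have "abelian_group ?V"
  proof (rule abelian_groupI)
    fix x assume "x \<in> carrier ?V"
    then show "\<exists>y\<in>carrier ?V. y \<oplus>\<^bsub>?V\<^esub> x = \<zero>\<^bsub>?V\<^esub>"
      by (intro bexI[of _ "\<lambda>p\<in>bars M. - x p"]) (auto simp: barcode_module_carrier barcode_module_simps)
  qed (auto simp: barcode_module_carrier barcode_module_simps extensional_def algebra_simps)
  then have "module (class_ring :: 'f ring) ?V"
    by (intro moduleI class_cring.is_cring)
      (auto simp: barcode_module_carrier barcode_module_simps extensional_def algebra_simps class_ring_simps)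
  then show ?thesis by (simp add: vectorspace_def class_field)
qed

lemma card_le_of_linear_injection:
  fixes H :: "('p \<Rightarrow>\<^sub>0 'f::field) \<Rightarrow> ('q \<Rightarrow>\<^sub>0 'f)"
  assumes "finite S" "finite S'" and H: "plinear H" and into: "\<And>a. keys (H a) \<subseteq> S'"
    and inj: "\<And>a. keys a \<subseteq> S \<Longrightarrow> H a = 0 \<Longrightarrow> a = 0"
  shows "card S \<le> card S'"
proof -
  let ?g = "\<lambda>p. H (gen p)"
  have inj_g: "inj_on ?g S"
  proof (rule inj_onI, rule ccontr)
    fix p q assume pq: "p \<in> S" "q \<in> S" "?g p = ?g q" "p \<noteq> q"
    have "keys (gen p - gen q :: 'p \<Rightarrow>\<^sub>0 'f) \<subseteq> S"
      using keys_diff[of "gen p" "gen q :: 'p \<Rightarrow>\<^sub>0 'f"] pq by auto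
    then have "gen p - gen q = (0 :: 'p \<Rightarrow>\<^sub>0 'f)" using pq(3) by (intro inj) (auto simp: plinear_simps[OF H])
    then have "lookup (gen p :: 'p \<Rightarrow>\<^sub>0 'f) p = lookup (gen q) p" by simp
    then show False using pq(4) by (simp add: lookup_single when_def)
  qed
  have "formal.independent (?g ` S)"
  proof (subst formal.independent_explicit_finite_subsets, intro allI impI)
    fix T u assume T: "T \<subseteq> ?g ` S" "finite T" and sum: "(\<Sum>v\<in>T. pscale (u v) v) = 0"
    obtain S0 where S0: "S0 \<subseteq> S" "T = ?g ` S0" using T(1) by (meson subset_imageE)
    have fin: "finite S0" using S0(1) assms(1) finite_subset by blast
    let ?a = "family S0 (\<lambda>p. u (?g p))"
    have "H ?a = lext ?g ?a" by (rule plinear_eq_lext[OF H])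
    also have "\<dots> = (\<Sum>p\<in>S0. pscale (u (?g p)) (?g p))"
      by (subst lext_superset[OF fin keys_family[OF fin]]) (simp add: lookup_family[OF fin])
    also have "\<dots> = (\<Sum>v\<in>T. pscale (u v) v)"
      unfolding S0(2) by (subst sum.reindex) (use inj_g S0(1) in \<open>auto intro: inj_on_subset\<close>)
    finally have "?a = 0" using inj[of ?a] sum keys_family[OF fin] S0(1) by (metis order.trans)
    then have "u (?g p) = 0" if "p \<in> S0" for p
      using lookup_family[OF fin, of "\<lambda>p. u (?g p)" p] that by simp
    then show "\<forall>v\<in>T. u v = 0" using S0(2) by blast
  qed
  moreover have "?g ` S \<subseteq> formal.span (gen ` S')"
  proof (intro image_subsetI)
    fix p
    have "H (gen p) = lext gen (H (gen p))" by simp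
    also have "\<dots> \<in> formal.span (gen ` S')"
      unfolding lext_def using into by (intro formal.span_sum formal.span_scale formal.span_base) auto
    finally show "H (gen p) \<in> formal.span (gen ` S')" .
  qed
  ultimately have "card (?g ` S) \<le> card (gen ` S' :: ('q \<Rightarrow>\<^sub>0 'f) set)"
    using formal.independent_span_bound[OF finite_imageI[OF assms(2)]] by blast
  also have "\<dots> \<le> card S'" by (rule card_image_le[OF assms(2)])
  finally show ?thesis using card_image[OF inj_g] by simp
qed

lemma linear_map_facts:
  assumes "linear_map class_ring V W f"
  shows "x \<in> carrier V \<Longrightarrow> f x \<in> carrier W"
    "x \<in> carrier V \<Longrightarrow> y \<in> carrier V \<Longrightarrow> f (x \<oplus>\<^bsub>V\<^esub> y) = f x \<oplus>\<^bsub>W\<^esub> f y"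
    "x \<in> carrier V \<Longrightarrow> f (a \<odot>\<^bsub>V\<^esub> x) = a \<odot>\<^bsub>W\<^esub> f x"
    "x \<in> carrier V \<Longrightarrow> y \<in> carrier V \<Longrightarrow> x \<oplus>\<^bsub>V\<^esub> y \<in> carrier V"
    "x \<in> carrier V \<Longrightarrow> a \<odot>\<^bsub>V\<^esub> x \<in> carrier V"
    "\<zero>\<^bsub>V\<^esub> \<in> carrier V" "f \<zero>\<^bsub>V\<^esub> = \<zero>\<^bsub>W\<^esub>"
proof -
  interpret linear_map class_ring V W f by fact
  show "x \<in> carrier V \<Longrightarrow> f x \<in> carrier W" by (rule T_im)
  show "x \<in> carrier V \<Longrightarrow> y \<in> carrier V \<Longrightarrow> f (x \<oplus>\<^bsub>V\<^esub> y) = f x \<oplus>\<^bsub>W\<^esub> f y" by simp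
  show "x \<in> carrier V \<Longrightarrow> f (a \<odot>\<^bsub>V\<^esub> x) = a \<odot>\<^bsub>W\<^esub> f x" by simp
  show "x \<in> carrier V \<Longrightarrow> y \<in> carrier V \<Longrightarrow> x \<oplus>\<^bsub>V\<^esub> y \<in> carrier V" by simp
  show "x \<in> carrier V \<Longrightarrow> a \<odot>\<^bsub>V\<^esub> x \<in> carrier V" by simp
  show "\<zero>\<^bsub>V\<^esub> \<in> carrier V" "f \<zero>\<^bsub>V\<^esub> = \<zero>\<^bsub>W\<^esub>" by simp_all
qed

text \<open>
  Compare the two decompositions at time \<open>s\<close> through \<open>V\<close>, starting from the combinations of bars of \<open>M\<close>
  that live from \<open>s\<close> to \<open>t\<close>. If the result lives on no bar of \<open>M'\<close> from \<open>s\<close> to \<open>t\<close>, it is killed by the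
  transition to \<open>t\<close>, hence so was the combination, which is then 0. So \<open>M'\<close> has at least as many
  such bars. This is the invariance of the rank of the transition map.
\<close>

lemma barcode_rank_le:
  fixes V :: "('f::field, 'v) persistence_module"
  assumes iso: "persistence_iso V (barcode_module M)" "persistence_iso V (barcode_module M')"
    and maps: "\<And>x. x \<in> carrier (space_at V s) \<Longrightarrow> transition V s t x \<in> carrier (space_at V t)"
    and st: "0 \<le> s" "s \<le> t"
  shows "size {#I \<in># M. s \<in> I \<and> t \<in> I#} \<le> size {#I \<in># M'. s \<in> I \<and> t \<in> I#}"
proof -
  let ?W = "space_at (barcode_module M :: ('f, _) persistence_module)"
    and ?W' = "space_at (barcode_module M' :: ('f, _) persistence_module)"
  obtain f where f: "\<And>t. 0 \<le> t \<Longrightarrow> linear_map class_ring (space_at V t) (?W t) (f t)"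
    "\<And>t. 0 \<le> t \<Longrightarrow> bij_betw (f t) (carrier (space_at V t)) (carrier (?W t))"
    "\<And>s t x. 0 \<le> s \<Longrightarrow> s \<le> t \<Longrightarrow> x \<in> carrier (space_at V s) \<Longrightarrow> f t (transition V s t x) = transition (barcode_module M) s t (f s x)"
    using iso(1) unfolding persistence_iso_def by blast
  obtain f' where f': "\<And>t. 0 \<le> t \<Longrightarrow> linear_map class_ring (space_at V t) (?W' t) (f' t)"
    "\<And>t. 0 \<le> t \<Longrightarrow> bij_betw (f' t) (carrier (space_at V t)) (carrier (?W' t))"
    "\<And>s t x. 0 \<le> s \<Longrightarrow> s \<le> t \<Longrightarrow> x \<in> carrier (space_at V s) \<Longrightarrow> f' t (transition V s t x) = transition (barcode_module M') s t (f' s x)"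
    using iso(2) unfolding persistence_iso_def by blast
  have t: "0 \<le> t" using st by simp
  let ?S = "{p \<in> bars M. s \<in> fst p \<and> t \<in> fst p}" and ?S' = "{p \<in> bars M'. s \<in> fst p \<and> t \<in> fst p}"
  have fin: "finite ?S" "finite ?S'" using finite_bars by auto
  define g where "g = inv_into (carrier (space_at V s)) (f s)"
  have g: "g x \<in> carrier (space_at V s)" "f s (g x) = x" if "x \<in> carrier (?W s)" for x
    using that f(2)[OF st(1)] unfolding g_def bij_betw_def by (auto intro: inv_into_into f_inv_into_f)
  have g_eqI: "g x = u" if "u \<in> carrier (space_at V s)" "f s u = x" for x u
    using that f(2)[OF st(1)] unfolding g_def bij_betw_def by (auto intro: inv_into_f_eq)
  note Fs = linear_map_facts[OF f(1)[OF st(1)]] and F's = linear_map_facts[OF f'(1)[OF st(1)]]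
    and Ft = linear_map_facts[OF f(1)[OF t]] and F't = linear_map_facts[OF f'(1)[OF t]]
  have g_add: "g (x \<oplus>\<^bsub>?W s\<^esub> y) = g x \<oplus>\<^bsub>space_at V s\<^esub> g y" if "x \<in> carrier (?W s)" "y \<in> carrier (?W s)" for x y
    by (rule g_eqI) (use g that Fs in auto)
  have g_smult: "g (a \<odot>\<^bsub>?W s\<^esub> x) = a \<odot>\<^bsub>space_at V s\<^esub> g x" if "x \<in> carrier (?W s)" for x a
    by (rule g_eqI) (use g that Fs in auto)
  define e where "e a = (\<lambda>p\<in>bars M. if s \<in> fst p \<and> t \<in> fst p then lookup a p else 0)" for a :: "real set \<times> nat \<Rightarrow>\<^sub>0 'f"
  have eW: "e a \<in> carrier (?W s)" for a by (auto simp: e_def barcode_module_carrier)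
  have e_lin: "e (a + b) = e a \<oplus>\<^bsub>?W s\<^esub> e b" "e (pscale c a) = c \<odot>\<^bsub>?W s\<^esub> e a" for a b c
    by (auto simp: e_def barcode_module_simps lookup_add)
  define h where "h a = f' s (g (e a))" for a
  have h_lin: "h (a + b) = h a \<oplus>\<^bsub>?W' s\<^esub> h b" "h (pscale c a) = c \<odot>\<^bsub>?W' s\<^esub> h a" for a b c
    unfolding h_def e_lin using g_add[OF eW eW] g_smult[OF eW] F's(2,3) g(1)[OF eW] by auto
  define H where "H a = family ?S' (h a)" for a
  show ?thesis
    unfolding card_bars_filter[symmetric]
  proof (rule card_le_of_linear_injection[OF fin])
    show "plinear H"
      unfolding plinear_def H_def
      by (auto intro!: poly_mapping_eqI simp: lookup_family[OF fin(2)] lookup_add h_lin barcode_module_simps)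
    show "keys (H a) \<subseteq> ?S'" for a unfolding H_def by (rule keys_family[OF fin(2)])
    fix a :: "real set \<times> nat \<Rightarrow>\<^sub>0 'f" assume a: "keys a \<subseteq> ?S" "H a = 0"
    let ?v = "g (e a)" and ?w = "transition V s t (g (e a))"
    have v: "?v \<in> carrier (space_at V s)" by (rule g(1)[OF eW])
    have "transition (barcode_module M') s t (h a) = \<zero>\<^bsub>?W' t\<^esub>"
    proof -
      have "h a p = 0" if "p \<in> ?S'" for p
        using a(2) lookup_family[OF fin(2), of "h a" p] that by (simp add: H_def)
      then show ?thesis by (auto simp: barcode_module_simps)
    qed
    then have "f' t ?w = f' t \<zero>\<^bsub>space_at V t\<^esub>" using f'(3)[OF st v] F't(7) by (simp add: h_def)
    moreover have "inj_on (f' t) (carrier (space_at V t))" using f'(2)[OF t] by (simp add: bij_betw_def)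
    ultimately have "?w = \<zero>\<^bsub>space_at V t\<^esub>" using maps[OF v] F't(6) by (auto dest: inj_onD)
    then have "transition (barcode_module M) s t (e a) = \<zero>\<^bsub>?W t\<^esub>"
      using f(3)[OF st v] g(2)[OF eW] Ft(7) by simp
    then have bar: "(\<lambda>p\<in>bars M. if s \<in> fst p \<and> t \<in> fst p then e a p else 0) p = (\<lambda>p\<in>bars M. 0) p" for p
      unfolding barcode_module_simps by metis
    have zero: "lookup a p = 0" if "p \<in> ?S" for p
      using bar[of p] that by (simp add: e_def)
    show "a = 0"
    proof (rule poly_mapping_eqI)
      fix p show "lookup a p = lookup 0 p"
        using zero[of p] a(1) by (cases "p \<in> keys a") (auto simp: in_keys_iff)
    qed
  qed
qed

text \<open>
  For each \<open>J\<close> that does not contain \<open>I\<close> pick a point of \<open>I\<close> outside \<open>J\<close>; the least and the greatest of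
  these points do the job.
\<close>

lemma interval_separated:
  assumes "finite U" and I: "I \<noteq> {}" and int: "\<And>J. J \<in> U \<Longrightarrow> is_interval (J :: real set)"
  obtains s t where "s \<in> I" "t \<in> I" "s \<le> t" "\<And>J. J \<in> U \<Longrightarrow> s \<in> J \<Longrightarrow> t \<in> J \<Longrightarrow> I \<subseteq> J"
proof -
  obtain p0 where p0: "p0 \<in> I" using I by blast
  have "\<forall>J\<in>{J \<in> U. \<not> I \<subseteq> J}. \<exists>p. p \<in> I \<and> p \<notin> J" by blast
  then obtain p where p: "\<And>J. J \<in> U \<Longrightarrow> \<not> I \<subseteq> J \<Longrightarrow> p J \<in> I \<and> p J \<notin> J" by (metis (mono_tags, lifting) mem_Collect_eq)
  let ?P = "insert p0 (p ` {J \<in> U. \<not> I \<subseteq> J})"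
  have P: "finite ?P" "?P \<noteq> {}" "?P \<subseteq> I" using assms(1) p p0 by auto
  show ?thesis
  proof (rule that[of "Min ?P" "Max ?P"])
    show "Min ?P \<in> I" "Max ?P \<in> I" using Min_in[OF P(1,2)] Max_in[OF P(1,2)] P(3) by blast+
    show "Min ?P \<le> Max ?P" using Min_in[OF P(1,2)] Max_ge[OF P(1)] by blast
    fix J assume J: "J \<in> U" "Min ?P \<in> J" "Max ?P \<in> J"
    show "I \<subseteq> J"
    proof (rule ccontr)
      assume n: "\<not> I \<subseteq> J"
      then have "p J \<in> ?P" using J(1) by blast
      then have "Min ?P \<le> p J" "p J \<le> Max ?P" using Min_le[OF P(1)] Max_ge[OF P(1)] by blast+
      then have "p J \<in> J" using int[OF J(1)] J(2,3) unfolding is_interval_1 by blast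
      then show False using p[OF J(1) n] by blast
    qed
  qed
qed

text \<open>
  Take an interval \<open>I\<close> that is maximal among those of different multiplicity, and \<open>s\<close>, \<open>t\<close> so far apart in
  \<open>I\<close> that every other interval containing both contains \<open>I\<close>. All of these other intervals have equal
  multiplicities, so the ranks from \<open>s\<close> to \<open>t\<close> distinguish the multisets.
\<close>

lemma interval_multiset_eqI:
  fixes M M' :: "real set multiset"
  assumes M: "\<And>I. I \<in># M \<Longrightarrow> I \<noteq> {} \<and> I \<subseteq> {0..} \<and> is_interval I"
    and M': "\<And>I. I \<in># M' \<Longrightarrow> I \<noteq> {} \<and> I \<subseteq> {0..} \<and> is_interval I"
    and eq: "\<And>s t. 0 \<le> s \<Longrightarrow> s \<le> t \<Longrightarrow> size {#I \<in># M. s \<in> I \<and> t \<in> I#} = size {#I \<in># M'. s \<in> I \<and> t \<in> I#}"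
  shows "M = M'"
proof (rule ccontr)
  assume neq: "M \<noteq> M'"
  let ?U = "set_mset M \<union> set_mset M'"
  let ?D = "{I \<in> ?U. count M I \<noteq> count M' I}"
  have "\<exists>I. count M I \<noteq> count M' I" using neq by (meson multiset_eqI)
  then have "?D \<noteq> {}" by (auto simp: not_in_iff) (metis not_in_iff)
  moreover have "finite ?D" by simp
  ultimately obtain I where I: "I \<in> ?D" and max: "\<And>J. J \<in> ?D \<Longrightarrow> I \<subseteq> J \<Longrightarrow> I = J"
    using finite_has_maximal[of ?D] by blast
  have "I \<noteq> {}" "I \<subseteq> {0..}" using I M M' by auto
  obtain s t where st: "s \<in> I" "t \<in> I" "s \<le> t" "\<And>J. J \<in> ?U \<Longrightarrow> s \<in> J \<Longrightarrow> t \<in> J \<Longrightarrow> I \<subseteq> J"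
    using interval_separated[of ?U I] \<open>I \<noteq> {}\<close> M M' by (metis UnE finite_UnI finite_set_mset)
  let ?P = "\<lambda>J. s \<in> J \<and> t \<in> J"
  let ?S = "{J \<in> ?U. ?P J}"
  have size: "size (filter_mset ?P N) = (\<Sum>J\<in>?S. count N J)" if "set_mset N \<subseteq> ?U" for N
    unfolding size_multiset_overloaded_eq using that
    by (intro sum.mono_neutral_cong_left) (auto simp: not_in_iff)
  have "(\<Sum>J\<in>?S. count M J) = (\<Sum>J\<in>?S. count M' J)"
    using eq[of s t] st(1,3) \<open>I \<subseteq> {0..}\<close> size[of M] size[of M'] by auto
  moreover have "I \<in> ?S" "finite ?S" using I st by auto
  moreover have "(\<Sum>J\<in>?S - {I}. count M J) = (\<Sum>J\<in>?S - {I}. count M' J)"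
  proof (rule sum.cong[OF refl])
    fix J assume "J \<in> ?S - {I}"
    then have "J \<in> ?U" "I \<subseteq> J" "J \<noteq> I" using st(4) by auto
    then show "count M J = count M' J" using max[of J] by auto
  qed
  ultimately have "count M I = count M' I" by (simp add: sum.remove)
  then show False using I by simp
qed

text \<open>
  The last assumption is part of functoriality, which a persistence module record does not
  guarantee by itself.
\<close>

lemma barcode_eqI:
  fixes V :: "('f::field, 'v) persistence_module"
  assumes M: "\<And>I. I \<in># M \<Longrightarrow> I \<noteq> {} \<and> I \<subseteq> {0..} \<and> is_interval I"
    and iso: "persistence_iso V (barcode_module M)"
    and maps: "\<And>s t x. 0 \<le> s \<Longrightarrow> s \<le> t \<Longrightarrow> x \<in> carrier (space_at V s) \<Longrightarrow> transition V s t x \<in> carrier (space_at V t)"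
  shows "barcode V = M"
  unfolding barcode_def
proof (rule the_equality)
  show "(\<forall>I\<in>#M. I \<noteq> {} \<and> I \<subseteq> {0..} \<and> is_interval I) \<and>
    persistence_iso V (persistence_direct_sum {(I, k). k < count M I} (\<lambda>(I, k). interval_module I))"
    using M iso by (simp add: barcode_module_def bars_def)
  fix M' assume M': "(\<forall>I\<in>#M'. I \<noteq> {} \<and> I \<subseteq> {0..} \<and> is_interval I) \<and>
    persistence_iso V (persistence_direct_sum {(I, k). k < count M' I} (\<lambda>(I, k). interval_module I))"
  then have iso': "persistence_iso V (barcode_module M')" by (simp add: barcode_module_def bars_def)
  show "M' = M"
  proof (rule interval_multiset_eqI)
    show "size {#I \<in># M'. s \<in> I \<and> t \<in> I#} = size {#I \<in># M. s \<in> I \<and> t \<in> I#}" if "0 \<le> s" "s \<le> t" for s t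
      using barcode_rank_le[OF iso' iso maps[OF that] that] barcode_rank_le[OF iso iso' maps[OF that] that] by simp
  qed (use M M' in auto)
qed

section \<open>Barcodes from interval bases\<close>

definition homology_filtration ::
  "nat \<Rightarrow> (real \<Rightarrow> 'a set set) \<Rightarrow> ('f::field, ('a list \<Rightarrow> 'f) set) persistence_module"
where
  "homology_filtration n R =
    \<lparr>space_at = (\<lambda>t. homology n (R t)), transition = (\<lambda>s t. homology_inclusion n (R t))\<rparr>"

text \<open>
  The coset of boundaries of \<open>x\<close>, as an element of \<open>homology n K\<close>.
\<close>

definition homology_class :: "nat \<Rightarrow> 'a set set \<Rightarrow> ('a, 'f::field) chain \<Rightarrow> ('a list \<Rightarrow> 'f) set" where
  "homology_class n K x = (\<lambda>b. lookup (b + x)) ` oriented_boundaries n K"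

lemma chains_eq_lookup: "chains n K = lookup ` (alternating_chains K \<inter> homogeneous n)"
proof (intro equalityI subsetI)
  fix c :: "'a list \<Rightarrow> 'b" assume c: "c \<in> chains n K"
  then have fin: "finite {vs. c vs \<noteq> 0}" by (simp add: chains_def)
  have lk: "lookup (Abs_poly_mapping c) = c" using fin by simp
  have "Abs_poly_mapping c \<in> alternating_chains K \<inter> homogeneous n"
    using c unfolding alternating_chains_def homogeneous_def chains_def by (simp add: in_keys_iff lk)
  then show "c \<in> lookup ` (alternating_chains K \<inter> homogeneous n)" using lk by (metis image_eqI)
next
  fix c :: "'a list \<Rightarrow> 'b" assume "c \<in> lookup ` (alternating_chains K \<inter> homogeneous n)"
  then show "c \<in> chains n K"
    by (auto simp: chains_def alternating_chains_def homogeneous_def in_keys_iff)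
qed

lemma cycles_eq_lookup: "cycles n K = lookup ` oriented_cycles n K"
proof -
  have "boundary (lookup c) = (\<lambda>_. 0) \<longleftrightarrow> oriented_bd c = 0" for c :: "('a, 'b) chain"
    by (simp add: lookup_oriented_bd[symmetric] poly_mapping_eq_iff fun_eq_iff)
  then show ?thesis by (auto simp: cycles_def chains_eq_lookup oriented_cycles_def)
qed

lemma boundaries_eq_lookup: "boundaries n K = lookup ` oriented_boundaries n K"
  by (simp add: boundaries_def chains_eq_lookup oriented_boundaries_def image_image lookup_oriented_bd)

lemma subspace_oriented_cycles: "formal.subspace (oriented_cycles n K :: ('a, 'f::field) chain set)"
proof -
  have "formal.subspace (alternating_chains K \<inter> homogeneous n :: ('a, 'f) chain set)"
    by (rule formal.subspace_inter[OF subspace_alternating_chains subspace_homogeneous])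
  then show ?thesis unfolding oriented_cycles_def formal.subspace_def by (simp add: oriented_bd_simps)
qed

lemma subspace_oriented_boundaries: "formal.subspace (oriented_boundaries n K :: ('a, 'f::field) chain set)"
  unfolding oriented_boundaries_def
  by (intro subspace_plinear_image plinear_oriented_bd formal.subspace_inter
      subspace_alternating_chains subspace_homogeneous)

lemma oriented_boundaries_subset_cycles:
  assumes "abstract_complex K" shows "oriented_boundaries n K \<subseteq> oriented_cycles n K"
proof
  fix x :: "('a, 'b) chain" assume "x \<in> oriented_boundaries n K"
  then obtain u where u: "x = oriented_bd u" "u \<in> alternating_chains K" "u \<in> homogeneous (Suc n)"
    by (auto simp: oriented_boundaries_def)
  have "degree_part n x = x"
    using degree_part_oriented_bd[of n u] degree_part_homogeneous[OF u(3), of "Suc n"] u(1) by simp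
  then have "x \<in> homogeneous n" by (metis degree_part_in_homogeneous)
  then show "x \<in> oriented_cycles n K"
    using oriented_bd_in_alternating_chains[OF assms u(2)] by (simp add: oriented_cycles_def u(1))
qed

lemma oriented_mono:
  assumes "K \<subseteq> L"
  shows "oriented_cycles n K \<subseteq> oriented_cycles n L" "oriented_boundaries n K \<subseteq> oriented_boundaries n L"
  using assms by (auto simp: oriented_cycles_def oriented_boundaries_def alternating_chains_def)

lemma lookup_add_fun: "lookup (b + x) = (\<lambda>k. lookup b k + lookup x k)"
  by (simp add: fun_eq_iff lookup_add)

lemma coset_homology_class:
  "boundaries n K +>\<^bsub>function_space S\<^esub> lookup x = homology_class n K x"
  by (auto simp: a_r_coset_def' function_space_def boundaries_eq_lookup homology_class_def lookup_add_fun)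

lemma homology_carrier: "carrier (homology n K) = homology_class n K ` oriented_cycles n K"
proof -
  have "carrier (homology n K) = (\<Union>c\<in>cycles n K. {boundaries n K +>\<^bsub>function_space (cycles n K)\<^esub> c})"
    by (simp add: homology_def quotient_space_def A_RCOSETS_def' function_space_def)
  also have "\<dots> = (\<Union>x\<in>oriented_cycles n K. {homology_class n K x})"
    by (subst (1) cycles_eq_lookup) (simp add: coset_homology_class)
  finally show ?thesis by (simp only: UNION_singleton_eq_range)
qed

lemma homology_class_eq_iff:
  fixes x y :: "('a, 'f::field) chain"
  shows "homology_class n K x = homology_class n K y \<longleftrightarrow> x - y \<in> oriented_boundaries n K"
proof
  let ?B = "oriented_boundaries n K :: ('a, 'f) chain set"
  have sub: "formal.subspace ?B" by (rule subspace_oriented_boundaries)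
  assume eq: "homology_class n K x = homology_class n K y"
  have "lookup (0 + x) \<in> homology_class n K x"
    unfolding homology_class_def by (rule imageI[OF formal.subspace_0[OF sub]])
  then have "lookup (0 + x) \<in> homology_class n K y" unfolding eq .
  then have "lookup (0 + x) \<in> (\<lambda>b. lookup (b + y)) ` ?B" by (simp only: homology_class_def)
  then obtain b where "b \<in> ?B" "lookup (0 + x) = lookup (b + y)" by (rule imageE) metis
  then show "x - y \<in> ?B" by (simp add: poly_mapping_eq_iff[symmetric])
next
  let ?B = "oriented_boundaries n K :: ('a, 'f) chain set"
  have sub: "formal.subspace ?B" by (rule subspace_oriented_boundaries)
  have le: "homology_class n K x \<subseteq> homology_class n K y" if xy: "x - y \<in> ?B" for x y :: "('a, 'f) chain"
    unfolding homology_class_def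
  proof (rule image_subsetI)
    fix b assume b: "b \<in> ?B"
    show "lookup (b + x) \<in> (\<lambda>b. lookup (b + y)) ` ?B"
      by (rule image_eqI[OF _ formal.subspace_add[OF sub b xy]]) simp
  qed
  assume xy: "x - y \<in> ?B"
  then have "y - x \<in> ?B" using formal.subspace_neg[OF sub xy] by simp
  then show "homology_class n K x = homology_class n K y" by (intro equalityI le xy)
qed

lemma homology_add:
  fixes x y :: "('a, 'f::field) chain"
  shows "homology_class n K x \<oplus>\<^bsub>homology n K\<^esub> homology_class n K y = homology_class n K (x + y)"
proof -
  let ?B = "oriented_boundaries n K :: ('a, 'f) chain set"
  have sub: "formal.subspace ?B" by (rule subspace_oriented_boundaries)
  have "homology_class n K x \<oplus>\<^bsub>homology n K\<^esub> homology_class n K y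
      = (\<Union>b\<in>?B. \<Union>c\<in>?B. {lookup ((b + x) + (c + y))})"
    by (simp add: homology_def quotient_space_def set_add_def' function_space_def homology_class_def
        lookup_add_fun[of "_ + _" "_ + _"])
  also have "\<dots> = homology_class n K (x + y)"
  proof (intro equalityI UN_least subsetI)
    fix b c w assume b: "b \<in> ?B" and c: "c \<in> ?B" and "w \<in> {lookup ((b + x) + (c + y))}"
    then have "w = lookup ((b + c) + (x + y))" by (simp add: algebra_simps)
    then show "w \<in> homology_class n K (x + y)"
      unfolding homology_class_def by (rule image_eqI[OF _ formal.subspace_add[OF sub b c]])
  next
    fix w assume "w \<in> homology_class n K (x + y)"
    then obtain b where b: "b \<in> ?B" "w = lookup (b + (x + y))" by (auto simp: homology_class_def)
    have "w = lookup ((b + x) + (0 + y))" by (simp add: b(2) add.assoc)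
    then show "w \<in> (\<Union>b\<in>?B. \<Union>c\<in>?B. {lookup ((b + x) + (c + y))})"
      by (intro UN_I[OF b(1)] UN_I[OF formal.subspace_0[OF sub]]) simp
  qed
  finally show ?thesis .
qed

lemma homology_smult:
  fixes x :: "('a, 'f::field) chain"
  shows "a \<odot>\<^bsub>homology n K\<^esub> homology_class n K x = homology_class n K (pscale a x)"
proof -
  let ?B = "oriented_boundaries n K :: ('a, 'f) chain set"
  have sub: "formal.subspace ?B" by (rule subspace_oriented_boundaries)
  have smult: "a \<odot>\<^bsub>function_space S\<^esub> lookup u = lookup (pscale a u)" for u :: "('a, 'f) chain" and S
    by (simp add: function_space_def fun_eq_iff)
  have "a \<odot>\<^bsub>homology n K\<^esub> homology_class n K x = (\<Union>b\<in>?B. homology_class n K (pscale a (b + x)))"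
    by (simp add: homology_def quotient_space_def homology_class_def[of n K x] smult coset_homology_class)
  also have "\<dots> = (\<Union>b\<in>?B. homology_class n K (pscale a x))"
  proof (intro SUP_cong refl)
    fix b assume "b \<in> ?B"
    then have "pscale a (b + x) - pscale a x \<in> ?B"
      using formal.subspace_scale[OF sub, of b a] by (simp add: formal.scale_right_distrib)
    then show "homology_class n K (pscale a (b + x)) = homology_class n K (pscale a x)"
      by (simp add: homology_class_eq_iff)
  qed
  also have "\<dots> = homology_class n K (pscale a x)" using formal.subspace_0[OF sub] by auto
  finally show ?thesis .
qed

lemma homology_inclusion_class:
  fixes x :: "('a, 'f::field) chain"
  assumes "K \<subseteq> L"
  shows "homology_inclusion n L (homology_class n K x) = homology_class n L x"
proof -
  let ?B = "oriented_boundaries n K :: ('a, 'f) chain set"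
    and ?C = "oriented_boundaries n L :: ('a, 'f) chain set"
  have sub: "formal.subspace ?C" "0 \<in> ?B" "?B \<subseteq> ?C"
    by (rule subspace_oriented_boundaries, rule formal.subspace_0[OF subspace_oriented_boundaries],
        rule oriented_mono[OF assms])
  have "homology_inclusion n L (homology_class n K x) = (\<Union>b\<in>?B. \<Union>c\<in>?C. {lookup ((b + x) + c)})"
    by (simp add: homology_inclusion_def set_add_def' function_space_def homology_class_def boundaries_eq_lookup
        lookup_add_fun[of "_ + _"])
  also have "\<dots> = homology_class n L x"
  proof (intro equalityI UN_least subsetI)
    fix b c w assume b: "b \<in> ?B" and c: "c \<in> ?C" and "w \<in> {lookup ((b + x) + c)}"
    then have "w = lookup ((b + c) + x)" by (simp add: algebra_simps)
    then show "w \<in> homology_class n L x"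
      unfolding homology_class_def by (rule image_eqI[OF _ formal.subspace_add[OF sub(1) subsetD[OF sub(3) b] c]])
  next
    fix w assume "w \<in> homology_class n L x"
    then obtain c where c: "c \<in> ?C" "w = lookup (c + x)" by (auto simp: homology_class_def)
    have "w = lookup ((0 + x) + c)" by (simp add: c(2) add.commute)
    then show "w \<in> (\<Union>b\<in>?B. \<Union>c\<in>?C. {lookup ((b + x) + c)})"
      by (intro UN_I[OF sub(2)] UN_I[OF c(1)]) simp
  qed
  finally show ?thesis .
qed

lemma vectorspace_homology:
  assumes K: "abstract_complex K"
  shows "vectorspace class_ring (homology n K :: ('f::field, _) module)"
proof -
  let ?Z = "oriented_cycles n K :: (_ \<Rightarrow>\<^sub>0 'f) set" and ?B = "oriented_boundaries n K :: (_ \<Rightarrow>\<^sub>0 'f) set"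
  let ?M = "function_space (lookup ` ?Z)"
  note sub = subspace_oriented_cycles[of n K, where ?'f = 'f] subspace_oriented_boundaries[of n K, where ?'f = 'f]
  have add: "lookup x \<oplus>\<^bsub>?M\<^esub> lookup y = lookup (x + y)" for x y by (simp add: function_space_def lookup_add_fun)
  have smult: "a \<odot>\<^bsub>?M\<^esub> lookup x = lookup (pscale a x)" for a x by (simp add: function_space_def fun_eq_iff)
  have zero: "\<zero>\<^bsub>?M\<^esub> = lookup (0 :: _ \<Rightarrow>\<^sub>0 'f)" by (simp add: function_space_def fun_eq_iff)
  have car: "carrier ?M = lookup ` ?Z" by (simp add: function_space_def)
  have "abelian_group ?M"
  proof (rule abelian_groupI)
    fix c assume "c \<in> carrier ?M"
    then obtain x where x: "x \<in> ?Z" "c = lookup x" by (auto simp: car)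
    show "\<exists>y\<in>carrier ?M. y \<oplus>\<^bsub>?M\<^esub> c = \<zero>\<^bsub>?M\<^esub>"
      by (rule bexI[of _ "lookup (- x)"]) (use x formal.subspace_neg[OF sub(1)] in \<open>auto simp: add zero car\<close>)
  qed (auto simp: car add zero algebra_simps intro!: imageI formal.subspace_add[OF sub(1)] formal.subspace_0[OF sub(1)])
  then have module: "module (class_ring :: 'f ring) ?M"
    by (intro moduleI class_cring.is_cring)
      (auto simp: car add smult class_ring_simps formal.scale_left_distrib formal.scale_right_distrib
        intro!: imageI formal.subspace_scale[OF sub(1)])
  then have vs: "vectorspace (class_ring :: 'f ring) ?M" by (simp add: vectorspace_def class_field)
  have "submodule (class_ring :: 'f ring) (lookup ` ?B) ?M"
    using module oriented_boundaries_subset_cycles[OF K]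
    by (intro LinearCombinations.submodule.intro)
      (auto simp: car add smult zero intro!: imageI formal.subspace_scale[OF sub(2)]
        formal.subspace_add[OF sub(2)] formal.subspace_0[OF sub(2)])
  from vectorspace_quotient_space[OF vs this] show ?thesis
    by (simp add: homology_def cycles_eq_lookup boundaries_eq_lookup)
qed

lemma homology_filtration_maps:
  assumes "filtration R" "s \<le> t" "x \<in> carrier (space_at (homology_filtration n R) s)"
  shows "transition (homology_filtration n R) s t x \<in> carrier (space_at (homology_filtration n R) t)"
proof -
  have st: "R s \<subseteq> R t" using assms(1,2) by (simp add: filtration_def)
  obtain z where z: "z \<in> oriented_cycles n (R s)" "x = homology_class n (R s) z"
    using assms(3) by (auto simp: homology_filtration_def homology_carrier)
  show ?thesis using oriented_mono(1)[OF st, of n] z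
    by (auto simp: homology_filtration_def homology_carrier homology_inclusion_class[OF st])
qed

text \<open>
  The bars of a multiset of intervals are numbered copies; this numbers the indices that have the same
  interval.
\<close>

lemma bars_bijection:
  assumes "finite A"
  obtains \<beta> where "bij_betw \<beta> (bars (image_mset I (mset_set A))) A" "\<And>p. p \<in> bars (image_mset I (mset_set A)) \<Longrightarrow> I (\<beta> p) = fst p"
proof -
  let ?M = "image_mset I (mset_set A)"
  have count: "count ?M J = card {i \<in> A. I i = J}" for J
  proof -
    have "count ?M J = card (I -` {J} \<inter> A)" using assms by (simp add: count_image_mset)
    also have "I -` {J} \<inter> A = {i \<in> A. I i = J}" by auto
    finally show ?thesis .
  qed
  have "\<exists>h. bij_betw h {0..<card {i \<in> A. I i = J}} {i \<in> A. I i = J}" for J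
    using assms by (intro ex_bij_betw_nat_finite) simp
  then obtain h where h: "\<And>J. bij_betw (h J) {0..<count ?M J} {i \<in> A. I i = J}" unfolding count by metis
  let ?\<beta> = "\<lambda>(J, k). h J k"
  have in_A: "h J k \<in> A" "I (h J k) = J" if "k < count ?M J" for J k
    using bij_betwE[OF h[of J]] that by auto
  have "bij_betw ?\<beta> (bars ?M) A"
  proof (rule bij_betwI')
    fix p q assume "p \<in> bars ?M" "q \<in> bars ?M"
    then obtain J k J' k' where pq: "p = (J, k)" "q = (J', k')" "k < count ?M J" "k' < count ?M J'" by (auto simp: bars_def)
    show "(?\<beta> p = ?\<beta> q) = (p = q)"
    proof
      assume eq: "?\<beta> p = ?\<beta> q"
      then have "J = J'" using in_A(2)[OF pq(3)] in_A(2)[OF pq(4)] pq by simp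
      moreover have "inj_on (h J) {0..<count ?M J}" using h by (simp add: bij_betw_def)
      ultimately show "p = q" using eq pq by (auto dest: inj_onD)
    qed simp
  next
    fix p assume "p \<in> bars ?M" then show "?\<beta> p \<in> A" using in_A by (auto simp: bars_def)
  next
    fix i assume i: "i \<in> A"
    then have "i \<in> h (I i) ` {0..<count ?M (I i)}" using h[of "I i"] by (simp add: bij_betw_def)
    then obtain k where "k < count ?M (I i)" "i = h (I i) k" by auto
    then show "\<exists>p\<in>bars ?M. i = ?\<beta> p" by (intro bexI[of _ "(I i, k)"]) (auto simp: bars_def)
  qed
  moreover have "I (?\<beta> p) = fst p" if "p \<in> bars ?M" for p using in_A that by (auto simp: bars_def)
  ultimately show ?thesis using that by blast
qed

text \<open>
  The isomorphism sends a homology class to its coordinates in the basis of the cycles alive at that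
  time. It is natural because, in passing from \<open>s\<close> to \<open>t\<close>, the cycles that have died become 0 and the
  others are still basis elements.
\<close>

lemma persistence_iso_interval_basis:
  fixes z :: "'i \<Rightarrow> ('a, 'f::field) chain"
  assumes R: "filtration R" and A: "finite A"
    and basis: "\<And>t. 0 \<le> t \<Longrightarrow> homology_basis (oriented_cycles n (R t)) (oriented_boundaries n (R t)) {i \<in> A. t \<in> I i} z"
    and death: "\<And>i s t. i \<in> A \<Longrightarrow> s \<in> I i \<Longrightarrow> s \<le> t \<Longrightarrow> t \<notin> I i \<Longrightarrow> z i \<in> oriented_boundaries n (R t)"
  shows "persistence_iso (homology_filtration n R :: ('f, _) persistence_module)
    (barcode_module (image_mset I (mset_set A)))"
proof -
  let ?M = "image_mset I (mset_set A)"
  let ?V = "homology_filtration n R :: ('f, ('a list \<Rightarrow> 'f) set) persistence_module"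
  let ?W = "barcode_module ?M :: ('f, _) persistence_module"
  obtain \<beta> where \<beta>: "bij_betw \<beta> (bars ?M) A" "\<And>p. p \<in> bars ?M \<Longrightarrow> I (\<beta> p) = fst p"
    using bars_bijection[OF A] by blast
  have \<beta>_in: "\<beta> p \<in> A" if "p \<in> bars ?M" for p using bij_betwE[OF \<beta>(1)] that by blast
  have \<beta>_surj: "\<exists>p. p \<in> bars ?M \<and> \<beta> p = i" if "i \<in> A" for i
  proof -
    have "i \<in> \<beta> ` bars ?M" by (simp only: bij_betw_imp_surj_on[OF \<beta>(1)] that)
    then show ?thesis by (rule imageE) blast
  qed
  define Z where "Z t = (oriented_cycles n (R t) :: ('a, 'f) chain set)" for t
  define B where "B t = (oriented_boundaries n (R t) :: ('a, 'f) chain set)" for t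
  have subZ: "formal.subspace (Z t)" and subB: "formal.subspace (B t)" for t
    by (simp_all add: Z_def B_def subspace_oriented_cycles subspace_oriented_boundaries)
  have mono: "R s \<subseteq> R t" if "s \<le> t" for s t using R that by (simp add: filtration_def)
  have monoZ: "Z s \<subseteq> Z t" and monoB: "B s \<subseteq> B t" if "s \<le> t" for s t
    using oriented_mono[OF mono[OF that]] by (auto simp: Z_def B_def)
  define coord where "coord t x = (THE a. keys a \<subseteq> {i \<in> A. t \<in> I i} \<and> x - lext z a \<in> B t)" for t x
  have coord_eqI: "coord t x = a" if "0 \<le> t" "keys a \<subseteq> {i \<in> A. t \<in> I i}" "x - lext z a \<in> B t" for t x a
    unfolding coord_def
  proof (rule the_equality)
    show "keys a \<subseteq> {i \<in> A. t \<in> I i} \<and> x - lext z a \<in> B t" using that by blast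
    fix b assume b: "keys b \<subseteq> {i \<in> A. t \<in> I i} \<and> x - lext z b \<in> B t"
    have "lext z (b - a) = (x - lext z a) - (x - lext z b)" by (simp add: lext_simps)
    also have "\<dots> \<in> B t" using formal.subspace_diff[OF subB that(3)] b by blast
    finally have "b - a = 0"
      using basis[OF that(1)] keys_diff[of b a] that(2) b unfolding homology_basis_def B_def by blast
    then show "b = a" by simp
  qed
  have coord: "keys (coord t x) \<subseteq> {i \<in> A. t \<in> I i}" "x - lext z (coord t x) \<in> B t" if tx: "0 \<le> t" "x \<in> Z t" for t x
  proof -
    obtain a where a: "keys a \<subseteq> {i \<in> A. t \<in> I i}" "x - lext z a \<in> B t"
      using basis[OF tx(1)] tx(2) by (auto simp: homology_basis_def Z_def B_def)
    then show "keys (coord t x) \<subseteq> {i \<in> A. t \<in> I i}" "x - lext z (coord t x) \<in> B t"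
      by (simp_all only: coord_eqI[OF tx(1) a])
  qed
  have coord_add: "coord t (x + y) = coord t x + coord t y" if "0 \<le> t" "x \<in> Z t" "y \<in> Z t" for t x y
  proof (rule coord_eqI[OF that(1)])
    show "keys (coord t x + coord t y) \<subseteq> {i \<in> A. t \<in> I i}"
      by (rule order.trans[OF keys_add Un_least[OF coord(1)[OF that(1,2)] coord(1)[OF that(1,3)]]])
    have eq: "x + y - lext z (coord t x + coord t y) = (x - lext z (coord t x)) + (y - lext z (coord t y))"
      by (simp add: lext_simps)
    show "x + y - lext z (coord t x + coord t y) \<in> B t"
      unfolding eq by (rule formal.subspace_add[OF subB coord(2)[OF that(1,2)] coord(2)[OF that(1,3)]])
  qed
  have coord_smult: "coord t (pscale c x) = pscale c (coord t x)" if "0 \<le> t" "x \<in> Z t" for t x c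
  proof (rule coord_eqI[OF that(1)])
    show "keys (pscale c (coord t x)) \<subseteq> {i \<in> A. t \<in> I i}"
      by (rule order.trans[OF keys_pscale coord(1)[OF that]])
    have eq: "pscale c x - lext z (pscale c (coord t x)) = pscale c (x - lext z (coord t x))"
      by (simp add: lext_simps formal.scale_right_diff_distrib)
    show "pscale c x - lext z (pscale c (coord t x)) \<in> B t"
      unfolding eq by (rule formal.subspace_scale[OF subB coord(2)[OF that]])
  qed
  have coord_cong: "coord t x = coord t y" if "0 \<le> t" "y \<in> Z t" "x - y \<in> B t" for t x y
  proof (rule coord_eqI[OF that(1) coord(1)[OF that(1,2)]])
    show "x - lext z (coord t y) \<in> B t"
      using formal.subspace_add[OF subB that(3) coord(2)[OF that(1,2)]] by simp
  qed
  define f where "f t C = (\<lambda>p\<in>bars ?M. lookup (coord t (SOME x. x \<in> Z t \<and> C = homology_class n (R t) x)) (\<beta> p))"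
    for t and C :: "('a list \<Rightarrow> 'f) set"
  have f_class: "f t (homology_class n (R t) x) = (\<lambda>p\<in>bars ?M. lookup (coord t x) (\<beta> p))"
    if "0 \<le> t" "x \<in> Z t" for t x
  proof -
    let ?y = "SOME y. y \<in> Z t \<and> homology_class n (R t) x = homology_class n (R t) y"
    have "?y \<in> Z t \<and> homology_class n (R t) x = homology_class n (R t) ?y"
      by (rule someI[of _ x]) (simp add: that(2))
    then have "coord t x = coord t ?y" using that(1) by (intro coord_cong) (auto simp: homology_class_eq_iff B_def)
    then show ?thesis by (simp add: f_def)
  qed
  have V: "carrier (space_at ?V t) = homology_class n (R t) ` Z t" for t
    by (simp add: homology_filtration_def homology_carrier Z_def)
  have V_rep: "\<exists>x. x \<in> Z t \<and> C = homology_class n (R t) x" if "C \<in> carrier (space_at ?V t)" for t C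
    using that unfolding V by (rule imageE) blast
  have V_add: "homology_class n (R t) x \<oplus>\<^bsub>space_at ?V t\<^esub> homology_class n (R t) y = homology_class n (R t) (x + y)"
    and V_smult: "a \<odot>\<^bsub>space_at ?V t\<^esub> homology_class n (R t) x = homology_class n (R t) (pscale a x)"
    for t a and x y :: "('a, 'f) chain"
    by (simp_all add: homology_filtration_def homology_add homology_smult)
  have V_trans: "transition ?V s t (homology_class n (R s) x) = homology_class n (R t) x" if "s \<le> t" for s t x
    by (simp add: homology_filtration_def homology_inclusion_class[OF mono[OF that]])
  have f_into: "f t C \<in> carrier (space_at ?W t)" if t: "0 \<le> t" and C: "C \<in> carrier (space_at ?V t)" for t C
  proof -
    obtain x where x: "x \<in> Z t" "C = homology_class n (R t) x" using V_rep[OF C] by (elim exE conjE)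
    have "lookup (coord t x) (\<beta> p) = 0" if "p \<in> bars ?M" "t \<notin> fst p" for p
    proof -
      have "\<beta> p \<notin> keys (coord t x)" using coord(1)[OF t x(1)] \<beta>(2)[OF that(1)] that(2) by blast
      then show ?thesis by (simp add: in_keys_iff)
    qed
    then show ?thesis by (simp add: x(2) f_class[OF t x(1)] barcode_module_carrier)
  qed
  have linear: "linear_map class_ring (space_at ?V t) (space_at ?W t) (f t)" if t: "0 \<le> t" for t
  proof -
    have "vectorspace (class_ring :: 'f ring) (space_at ?V t)"
      using vectorspace_homology[of "R t" n] R by (simp add: homology_filtration_def filtration_def)
    moreover have "vectorspace (class_ring :: 'f ring) (space_at ?W t)" by (rule vectorspace_barcode_module)
    moreover have "f t \<in> LinearCombinations.module_hom (class_ring :: 'f ring) (space_at ?V t) (space_at ?W t)"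
      unfolding LinearCombinations.module_hom_def
    proof (intro CollectI conjI allI impI)
      show "f t \<in> carrier (space_at ?V t) \<rightarrow> carrier (space_at ?W t)" using f_into[OF t] by blast
      fix C D assume CD: "C \<in> carrier (space_at ?V t) \<and> D \<in> carrier (space_at ?V t)"
      obtain x where x: "x \<in> Z t" "C = homology_class n (R t) x" using V_rep[OF conjunct1[OF CD]] by (elim exE conjE)
      obtain y where y: "y \<in> Z t" "D = homology_class n (R t) y" using V_rep[OF conjunct2[OF CD]] by (elim exE conjE)
      note xy = x y
      show "f t (C \<oplus>\<^bsub>space_at ?V t\<^esub> D) = f t C \<oplus>\<^bsub>space_at ?W t\<^esub> f t D"
        using formal.subspace_add[OF subZ xy(1,3)]
        by (auto simp: xy(2,4) V_add f_class[OF t] xy(1,3) coord_add[OF t] barcode_module_simps lookup_add)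
    next
      fix a C assume aC: "a \<in> carrier (class_ring :: 'f ring) \<and> C \<in> carrier (space_at ?V t)"
      obtain x where x: "x \<in> Z t" "C = homology_class n (R t) x" using V_rep[OF conjunct2[OF aC]] by (elim exE conjE)
      show "f t (a \<odot>\<^bsub>space_at ?V t\<^esub> C) = a \<odot>\<^bsub>space_at ?W t\<^esub> f t C"
        using formal.subspace_scale[OF subZ x(1)]
        by (auto simp: x V_smult f_class[OF t] coord_smult[OF t] barcode_module_simps)
    qed
    ultimately show ?thesis
      by (simp add: linear_map_def mod_hom_def mod_hom_axioms_def vectorspace_def)
  qed
  have bij: "bij_betw (f t) (carrier (space_at ?V t)) (carrier (space_at ?W t))" if t: "0 \<le> t" for t
  proof (rule bij_betwI')
    fix C D assume C: "C \<in> carrier (space_at ?V t)" and D: "D \<in> carrier (space_at ?V t)"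
    obtain x where x: "x \<in> Z t" "C = homology_class n (R t) x" using V_rep[OF C] by (elim exE conjE)
    obtain y where y: "y \<in> Z t" "D = homology_class n (R t) y" using V_rep[OF D] by (elim exE conjE)
    note xy = x y
    show "(f t C = f t D) = (C = D)"
    proof
      assume eq: "f t C = f t D"
      have "lookup (coord t x) i = lookup (coord t y) i" for i
      proof (cases "i \<in> A")
        case True
        obtain p where p: "p \<in> bars ?M" "\<beta> p = i" using \<beta>_surj[OF True] by (elim exE conjE)
        then show ?thesis using fun_cong[OF eq, of p] by (simp add: xy f_class[OF t])
      next
        case False
        then have "i \<notin> keys (coord t x)" "i \<notin> keys (coord t y)"
          using coord(1)[OF t xy(1)] coord(1)[OF t xy(3)] by blast+
        then show ?thesis by (simp add: in_keys_iff)
      qed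
      then have c: "coord t x = coord t y" by (rule poly_mapping_eqI)
      have "x - y = (x - lext z (coord t x)) - (y - lext z (coord t y))" by (simp add: c)
      also have "\<dots> \<in> B t" using formal.subspace_diff[OF subB coord(2)[OF t xy(1)] coord(2)[OF t xy(3)]] .
      finally show "C = D" by (simp add: xy homology_class_eq_iff B_def)
    qed simp
  next
    fix C assume "C \<in> carrier (space_at ?V t)" then show "f t C \<in> carrier (space_at ?W t)" by (rule f_into[OF t])
  next
    fix y assume y: "y \<in> carrier (space_at ?W t)"
    define a where "a = family A (\<lambda>i. y (inv_into (bars ?M) \<beta> i))"
    have inv: "inv_into (bars ?M) \<beta> (\<beta> p) = p" if "p \<in> bars ?M" for p
      using \<beta>(1) that by (simp add: bij_betw_def)
    have la: "lookup a (\<beta> p) = y p" if "p \<in> bars ?M" for p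
      unfolding a_def using that by (simp add: lookup_family[OF A] \<beta>_in inv)
    have ka: "keys a \<subseteq> {i \<in> A. t \<in> I i}"
    proof
      fix i assume i: "i \<in> keys a"
      then have iA: "i \<in> A" using keys_family[OF A] by (auto simp: a_def)
      obtain p where p: "p \<in> bars ?M" "\<beta> p = i" using \<beta>_surj[OF iA] by (elim exE conjE)
      have "y p \<noteq> 0" using i la[OF p(1)] p(2) by (simp add: in_keys_iff)
      then have "t \<in> fst p" using y p(1) by (auto simp: barcode_module_carrier)
      then show "i \<in> {i \<in> A. t \<in> I i}" using \<beta>(2)[OF p(1)] p(2) iA by simp
    qed
    have x: "lext z a \<in> Z t"
      unfolding lext_def using basis[OF t] ka
      by (intro formal.subspace_sum[OF subZ] formal.subspace_scale[OF subZ]) (auto simp: homology_basis_def Z_def)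
    have "coord t (lext z a) = a" by (rule coord_eqI[OF t ka]) (simp add: formal.subspace_0[OF subB])
    then have "f t (homology_class n (R t) (lext z a)) = (\<lambda>p\<in>bars ?M. y p)"
      using la by (auto simp: f_class[OF t x])
    also have "\<dots> = y" using y by (auto simp: barcode_module_carrier extensional_def)
    finally show "\<exists>C\<in>carrier (space_at ?V t). y = f t C" unfolding V using x by (intro bexI[of _ "homology_class n (R t) (lext z a)"]) auto
  qed
  have natural: "f t (transition ?V s t C) = transition ?W s t (f s C)"
    if s: "0 \<le> s" and st: "s \<le> t" and C: "C \<in> carrier (space_at ?V s)" for s t C
  proof -
    have t: "0 \<le> t" using s st by simp
    obtain x where x: "x \<in> Z s" "C = homology_class n (R s) x" using V_rep[OF C] by (elim exE conjE)
    have xt: "x \<in> Z t" using x(1) monoZ[OF st] by blast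
    let ?a = "coord s x" and ?b = "prestrict (\<lambda>i. t \<in> I i) (coord s x)"
    have "coord t x = ?b"
    proof (rule coord_eqI[OF t])
      show "keys ?b \<subseteq> {i \<in> A. t \<in> I i}"
        using coord(1)[OF s x(1)] by (auto simp: in_keys_iff lookup_prestrict split: if_splits)
      have dead: "lext z (?a - ?b) \<in> B t"
        unfolding lext_def
      proof (intro formal.subspace_sum[OF subB] formal.subspace_scale[OF subB])
        fix i assume "i \<in> keys (?a - ?b)"
        then have "i \<in> keys ?a" "t \<notin> I i" by (auto simp: in_keys_iff lookup_minus lookup_prestrict split: if_splits)
        then show "z i \<in> B t" using coord(1)[OF s x(1)] death[of i s t] st by (auto simp: B_def)
      qed
      have old: "x - lext z ?a \<in> B t" by (rule subsetD[OF monoB[OF st] coord(2)[OF s x(1)]])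
      have "x - lext z ?b = (x - lext z ?a) + lext z (?a - ?b)" by (simp add: lext_simps)
      then show "x - lext z ?b \<in> B t" by (simp only: formal.subspace_add[OF subB old dead])
    qed
    moreover have "lookup ?a (\<beta> p) = 0" if "p \<in> bars ?M" "s \<notin> fst p" for p
    proof -
      have "\<beta> p \<notin> keys ?a" using coord(1)[OF s x(1)] \<beta>(2)[OF that(1)] that(2) by blast
      then show ?thesis by (simp add: in_keys_iff)
    qed
    ultimately show ?thesis
      using \<beta>(2) by (auto intro!: restrict_ext simp: x(2) V_trans[OF st] f_class[OF t xt] f_class[OF s x(1)] barcode_module_simps lookup_prestrict)
  qed
  show ?thesis
    unfolding persistence_iso_def using linear bij natural by blast
qed

theorem barcode_interval_basis:
  fixes z :: "'i \<Rightarrow> ('a, 'f::field) chain"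
  assumes R: "filtration R" and z: "interval_basis R A z deg I"
  shows "barcode (homology_filtration n R :: ('f, _) persistence_module) =
    image_mset I (mset_set {i \<in> A. deg i = n \<and> I i \<noteq> {}})"
proof (rule barcode_eqI)
  let ?A = "{i \<in> A. deg i = n \<and> I i \<noteq> {}}"
  note Z = z[unfolded interval_basis_def]
  have fin: "finite ?A" using Z by (auto intro: finite_subset[of _ "{i \<in> A. deg i = n}"])
  show "J \<noteq> {} \<and> J \<subseteq> {0..} \<and> is_interval J" if "J \<in># image_mset I (mset_set ?A)" for J
    using that Z fin by auto
  show "persistence_iso (homology_filtration n R :: ('f, _) persistence_module) (barcode_module (image_mset I (mset_set ?A)))"
  proof (rule persistence_iso_interval_basis[OF R fin, where z = "\<lambda>i. orient (z i)"])
    fix t :: real assume t: "0 \<le> t"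
    have "homology_basis (oriented_cycles n (R t)) (oriented_boundaries n (R t)) {i \<in> {i \<in> A. t \<in> I i}. deg i = n} (\<lambda>i. orient (z i))"
      using Z R t by (intro homology_basis_oriented) (auto simp: filtration_def)
    moreover have "{i \<in> {i \<in> A. t \<in> I i}. deg i = n} = {i \<in> ?A. t \<in> I i}" by auto
    ultimately show "homology_basis (oriented_cycles n (R t)) (oriented_boundaries n (R t)) {i \<in> ?A. t \<in> I i} (\<lambda>i. orient (z i))"
      by simp
  next
    fix i s t assume "i \<in> ?A" "s \<in> I i" "s \<le> t" "t \<notin> I i"
    then show "orient (z i) \<in> oriented_boundaries n (R t)" using Z by (intro orient_boundary) auto
  qed
  show "transition (homology_filtration n R) s t x \<in> carrier (space_at (homology_filtration n R) t)"
    if "s \<le> t" "x \<in> carrier (space_at (homology_filtration n R :: ('f, _) persistence_module) s)" for s t x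
    by (rule homology_filtration_maps[OF R that])
qed

section \<open>Rips complexes of products\<close>

lemma diam_of_less_iff:
  assumes "finite \<sigma>" "\<sigma> \<noteq> {}"
  shows "diam_of d \<sigma> < \<epsilon> \<longleftrightarrow> (\<forall>x\<in>\<sigma>. \<forall>y\<in>\<sigma>. d x y < \<epsilon>)"
proof -
  have eq: "{d x y | x y. x \<in> \<sigma> \<and> y \<in> \<sigma>} = (\<lambda>(x, y). d x y) ` (\<sigma> \<times> \<sigma>)" by auto
  show ?thesis unfolding diam_of_def eq using assms by (subst Max_less_iff) auto
qed

lemma rips_eq: "rips \<epsilon> X d = {\<sigma>. \<sigma> \<subseteq> X \<and> finite \<sigma> \<and> \<sigma> \<noteq> {} \<and> (\<forall>x\<in>\<sigma>. \<forall>y\<in>\<sigma>. d x y < \<epsilon>)}"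
  unfolding rips_def using diam_of_less_iff by blast

lemma filtration_rips: "finite X \<Longrightarrow> filtration (\<lambda>\<epsilon>. rips \<epsilon> X d)"
  unfolding filtration_def abstract_complex_def
proof (intro conjI allI ballI impI)
  fix t assume "finite X"
  then show "finite (rips t X d)" by (auto simp: rips_eq intro: finite_subset[of _ "Pow X"])
qed (auto simp: rips_eq intro: finite_subset, force)

text \<open>
  A maximum of two distances is less than \<open>\<epsilon>\<close> if and only if both are.
\<close>

lemma rips_product:
  fixes X :: "'a set" and Y :: "'b set"
  assumes "finite X" "finite Y"
  shows "rips \<epsilon> (X \<times> Y) (max_dist dX dY) = product_complex (rips \<epsilon> X dX) (rips \<epsilon> Y dY)"
proof (rule Set.set_eqI)
  fix \<rho> :: "('a \<times> 'b) set"
  have sub: "\<rho> \<subseteq> X \<times> Y \<longleftrightarrow> fst ` \<rho> \<subseteq> X \<and> snd ` \<rho> \<subseteq> Y" by (auto simp: subset_iff)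
  have fin: "finite \<rho>" if "\<rho> \<subseteq> X \<times> Y" using finite_subset[OF that] assms by simp
  show "\<rho> \<in> rips \<epsilon> (X \<times> Y) (max_dist dX dY) \<longleftrightarrow> \<rho> \<in> product_complex (rips \<epsilon> X dX) (rips \<epsilon> Y dY)"
    using fin by (auto simp: rips_eq product_complex_def sub max_dist_def)
qed

lemma image_mset_mset_set: "finite B \<Longrightarrow> image_mset g (mset_set B) = (\<Sum>b\<in>B. {#g b#})"
  by (induction B rule: finite_induct) auto

text \<open>
  Two interval bases and their product give all three barcodes; the pairs of indices whose
  intervals meet are sorted by their pair of degrees.
\<close>

theorem corollary1p2:
  fixes X :: "'a set" and dX :: "'a \<Rightarrow> 'a \<Rightarrow> real"
    and Y :: "'b set" and dY :: "'b \<Rightarrow> 'b \<Rightarrow> real"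
    and n :: nat
  assumes "Metric_space X dX" and "finite X"
    and "Metric_space Y dY" and "finite Y"
  shows "rips_barcode TYPE('f::field) n (X \<times> Y) (max_dist dX dY) =
    (\<Sum>(i, j)\<in>{(i, j). i + j = n}.
       {#K \<in># (\<Sum>I\<in>#rips_barcode TYPE('f) i X dX. {#I \<inter> J. J \<in># rips_barcode TYPE('f) j Y dY#}).
          K \<noteq> {}#})"
proof -
  let ?R = "\<lambda>\<epsilon>. rips \<epsilon> X dX" and ?S = "\<lambda>\<epsilon>. rips \<epsilon> Y dY"
  have R: "filtration ?R" and S: "filtration ?S" using assms filtration_rips by auto
  obtain E I where E: "interval_basis ?R {(e :: ('a, 'f) chain, i). e \<in> E i} fst snd I"
    using interval_basis_exists[OF R assms(2)] by (auto simp: rips_eq)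
  obtain F J where F: "interval_basis ?S {(f :: ('b, 'f) chain, j). f \<in> F j} fst snd J"
    using interval_basis_exists[OF S assms(4)] by (auto simp: rips_eq)
  define A where "A = {(e :: ('a, 'f) chain, i). e \<in> E i}"
  define B where "B = {(f :: ('b, 'f) chain, j). f \<in> F j}"
  have filt: "rips_barcode TYPE('f) m Z d = barcode (homology_filtration m (\<lambda>\<epsilon>. rips \<epsilon> Z d) :: ('f, _) persistence_module)"
    for m d and Z :: "'z set"
    by (simp add: rips_barcode_def rips_homology_def homology_filtration_def)
  let ?A = "\<lambda>i. {a \<in> A. snd a = i \<and> I a \<noteq> {}}" and ?B = "\<lambda>j. {b \<in> B. snd b = j \<and> J b \<noteq> {}}"
  have X: "rips_barcode TYPE('f) i X dX = image_mset I (mset_set (?A i))" for i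
    unfolding filt A_def by (rule barcode_interval_basis[OF R E])
  have Y: "rips_barcode TYPE('f) j Y dY = image_mset J (mset_set (?B j))" for j
    unfolding filt B_def by (rule barcode_interval_basis[OF S F])
  let ?K = "\<lambda>(a, b). I a \<inter> J b" and ?deg = "\<lambda>(a, b). snd a + snd b"
  let ?P = "{c \<in> A \<times> B. ?deg c = n \<and> ?K c \<noteq> {}}"
  have fA: "finite (?A i)" for i
    using E by (auto simp: interval_basis_def A_def intro: finite_subset[of _ "{a \<in> {(e, i). e \<in> E i}. snd a = i}"])
  have fB: "finite (?B j)" for j
    using F by (auto simp: interval_basis_def B_def intro: finite_subset[of _ "{b \<in> {(f, j). f \<in> F j}. snd b = j}"])
  have XY: "rips_barcode TYPE('f) n (X \<times> Y) (max_dist dX dY) = image_mset ?K (mset_set ?P)"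
    unfolding filt rips_product[OF assms(2,4)]
    using barcode_interval_basis[OF filtration_product[OF R S] interval_basis_product[OF R S E F], of n]
    by (simp add: A_def B_def)
  let ?N = "{(i, j). i + j = n}"
  let ?Q = "\<lambda>(i, j). {c \<in> ?A i \<times> ?B j. ?K c \<noteq> {}}"
  have summand: "{#K \<in># (\<Sum>I\<in>#rips_barcode TYPE('f) i X dX. {#I \<inter> J. J \<in># rips_barcode TYPE('f) j Y dY#}). K \<noteq> {}#}
      = image_mset ?K (mset_set (?Q (i, j)))" for i j
  proof -
    have "(\<Sum>I\<in>#rips_barcode TYPE('f) i X dX. {#I \<inter> J. J \<in># rips_barcode TYPE('f) j Y dY#})
        = (\<Sum>a\<in>?A i. image_mset (\<lambda>b. I a \<inter> J b) (mset_set (?B j)))"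
      unfolding X Y by (simp add: sum_unfold_sum_mset image_mset.compositionality o_def)
    also have "\<dots> = (\<Sum>a\<in>?A i. \<Sum>b\<in>?B j. {#I a \<inter> J b#})"
      by (simp only: image_mset_mset_set[OF fB])
    also have "\<dots> = (\<Sum>c\<in>?A i \<times> ?B j. {#?K c#})" by (simp add: sum.cartesian_product case_prod_beta)
    also have "\<dots> = image_mset ?K (mset_set (?A i \<times> ?B j))"
      by (rule image_mset_mset_set[symmetric]) (use fA fB in simp)
    finally show ?thesis using fA fB by (simp add: filter_mset_image_mset filter_mset_mset_set)
  qed
  have finN: "finite ?N"
    by (rule finite_subset[of _ "{..n} \<times> {..n}"]) auto
  have finQ: "finite (?Q ij)" for ij
    using fA fB by (simp add: case_prod_beta)
  have P_eq: "?P = (\<Union>ij\<in>?N. ?Q ij)" by auto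
  have "image_mset ?K (mset_set ?P) = (\<Sum>c\<in>(\<Union>ij\<in>?N. ?Q ij). {#?K c#})"
    unfolding P_eq by (rule image_mset_mset_set) (use finQ finN in blast)
  also have "\<dots> = (\<Sum>ij\<in>?N. \<Sum>c\<in>?Q ij. {#?K c#})"
    by (rule sum.UNION_disjoint) (use finQ finN in auto)
  also have "\<dots> = (\<Sum>ij\<in>?N. image_mset ?K (mset_set (?Q ij)))"
    by (simp only: image_mset_mset_set[OF finQ])
  finally show ?thesis
    unfolding XY summand by (simp add: case_prod_beta)
qed

end
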